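(* Let $V$ be a real vector space of dimension $n$, $W\subseteq V$ a linear subspace, and let $\mathcal F_W(V)$ be the singular foliation of vector fields $X$ on $V$ that vanish at the origin and satisfy $X(I_W)\subseteq I_W$, where $I_W\subseteq C^\infty(V)$ is the ideal of functions vanishing on $W$. For $j\in\{1,\dots,n\}$ let $K_j\subseteq \wedge^jV^*\otimes V=\mathrm{Hom}(\wedge^jV,V)$ be $$K_j=\{\phi \mid \phi(w,v_1,\dots,v_{j-1})\in W\ \text{ for all } w\in W,\ v_1,\dots,v_{j-1}\in V\}.$$ Then: (i) For $2\le j\le n$ the Koszul differential $d_j:\Gamma(\wedge^jV^*\otimes V)\to\Gamma(\wedge^{j-1}V^*\otimes V)$ restricts to a map $d_j:\Gamma(K_j)\to\Gamma(K_{j-1})$. (ii) The Nijenhuis–Richardson type bracket $[-,-]$ on $\Gamma(\wedge^\bullet V^*\otimes V)$ (given in the context) restricts to the subspaces $\Gamma(K_j)$. (iii) With $\rho_W=\rho|_{\Gamma(K_1)}$, the complex $$0\to\Gamma(K_n)\xrightarrow{d_n}\Gamma(K_{n-1})\xrightarrow{d_{n-1}}\cdots\xrightarrow{d_2}\Gamma(K_1)\xrightarrow{\rho_W}\mathcal F_W(V)\to0$$ is exact. Consequently, $\Gamma(K_\bullet)$ with the restrictions of $d_\bullet$ and $[-,-]$ (and anchor $\rho_W$) is a universal $L_\infty$-algebroid of $\mathcal F_W$ which is minimal at the origin.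
   Context: For a finite-dimensional real vector space $U$, $\Gamma(U)=C^\infty(V,U)$ denotes the sections of the trivial bundle $U\times V\to V$. Let $\{e_i\}$ be a basis of $V$ with linear coordinates $x^i$. The differential $d_j(\alpha\otimes v)=x^i\iota_{e_i}(\alpha)\otimes v$ is contraction with the Euler vector field $x^i\partial_{x^i}$ (repeated indices are summed), and $\rho:\Gamma(V^*\otimes V)\to\mathfrak X(V)\cong\Gamma(V)$ is the same contraction, $\rho(\phi\otimes v)=\phi\,\partial_v$ with $\phi$ viewed as a linear function. $\Gamma(\wedge^jV^*\otimes V)$ sits in degree $1-j$. Bracket: for $f_1,f_2\in C^\infty(V)$, $\phi_a\in\wedge^{k_a}V^*$, $w_a\in V$, $$[f_1\phi_1\otimes w_1,f_2\phi_2\otimes w_2]=f_1f_2\big(\phi_1\wedge\iota_{w_1}(\phi_2)\otimes w_2-(-1)^{(k_1-1)(k_2-1)}\phi_2\wedge\iota_{w_2}(\phi_1)\otimes w_1\big)+\delta_{k_1,1}f_1\,\rho(\phi_1\otimes w_1)(f_2)\,\phi_2\otimes w_2-\delta_{k_2,1}f_2\,\rho(\phi_2\otimes w_2)(f_1)\,\phi_1\otimes w_1 .$$ A dg-Lie algebroid over $M$ is a graded vector bundle $E=\bigoplus_{i\le0}E_i$ with a $C^\infty(M)$-linear degree $1$ differential $d$ on $\Gamma(E)$, an anchor $\rho:E_0\to TM$ (extended by zero to $E_i$, $i<0$) with $\rho\circ d=0$, and a graded skew-symmetric degree $0$ bracket with $[a,fb]=f[a,b]+\rho(a)(f)b$,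 $\rho[a,b]=[\rho a,\rho b]$, $d[a,b]=[da,b]+(-1)^{|a|}[a,db]$, and the graded Jacobi identity. It is an $L_\infty$-algebroid with vanishing $k$-ary brackets for $k\ge3$. An $L_\infty$-algebroid is a universal $L_\infty$-algebroid of a singular foliation $\mathcal F$ if its underlying complex together with the anchor $\Gamma(E_0)\to\mathcal F$ is a resolution of $\mathcal F$; it is minimal at a point if all the differentials (as vector bundle maps) vanish at that point. *)

theory Defs
  imports "HOL-Analysis.Analysis" "HOL-Library.Function_Algebras"
begin

section \<open>Functions into a vector space form a vector space\<close>

instantiation "fun" :: (type, real_vector) real_vector
begin

definition scaleR_fun :: "real \<Rightarrow> ('a \<Rightarrow> 'b) \<Rightarrow> 'a \<Rightarrow> 'b"
  where "scaleR_fun r f = (\<lambda>x. r *\<^sub>R f x)"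

instance
  by standard (simp_all add: scaleR_fun_def fun_eq_iff scaleR_add_right scaleR_add_left)

end

lemma scaleR_fun_apply [simp]: "(r *\<^sub>R f) x = r *\<^sub>R f x"
  by (simp add: scaleR_fun_def)

lemma sum_fun_apply: "(\<Sum>i\<in>I. f i) x = (\<Sum>i\<in>I. f i x)"
  by (induction I rule: infinite_finite_induct) simp_all


section \<open>Smooth maps, vector fields and singular foliations\<close>

primrec cont_diff :: "nat \<Rightarrow> ('v::euclidean_space \<Rightarrow> 'b::real_normed_vector) \<Rightarrow> bool" where
  "cont_diff 0 f \<longleftrightarrow> continuous_on UNIV f"
| "cont_diff (Suc k) f \<longleftrightarrow> (\<forall>x. f differentiable (at x)) \<and>
     (\<forall>h. cont_diff k (\<lambda>x. frechet_derivative f (at x) h))"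

definition smooth :: "('v::euclidean_space \<Rightarrow> 'b::real_normed_vector) \<Rightarrow> bool"
  where "smooth f \<longleftrightarrow> (\<forall>k. cont_diff k f)"

text \<open>
  \<open>smooth_sections U\<close> is \<open>\<Gamma>(U)\<close>, the smooth maps from \<open>'v\<close> to a finite-dimensional subspace \<open>U\<close>
  of a real vector space without a given norm: smoothness is smoothness of the coefficients with
  respect to finitely many vectors of \<open>U\<close>.
\<close>
definition smooth_sections :: "'f::real_vector set \<Rightarrow> ('v::euclidean_space \<Rightarrow> 'f) set"
  where "smooth_sections U = {s. \<exists>B c. finite B \<and> B \<subseteq> U \<and> (\<forall>b\<in>B. smooth (c b)) \<and>
     (\<forall>x. s x = (\<Sum>b\<in>B. c b x *\<^sub>R b))}"

definition vf_apply :: "('v::euclidean_space \<Rightarrow> 'v) \<Rightarrow> ('v \<Rightarrow> real) \<Rightarrow> 'v \<Rightarrow> real"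
  where "vf_apply X f = (\<lambda>x. frechet_derivative f (at x) (X x))"

definition vf_bracket :: "('v::euclidean_space \<Rightarrow> 'v) \<Rightarrow> ('v \<Rightarrow> 'v) \<Rightarrow> 'v \<Rightarrow> 'v"
  where "vf_bracket X Y = (\<lambda>x. frechet_derivative Y (at x) (X x) - frechet_derivative X (at x) (Y x))"

text \<open>
  A singular foliation on \<open>'v\<close>, given by its globally defined vector fields: a
  \<open>C\<^sup>\<infinity>\<close>-submodule of the vector fields that is involutive, locally finitely generated, and
  determined locally (so that it is the module of global sections of a sheaf).
\<close>
definition singular_foliation :: "('v::euclidean_space \<Rightarrow> 'v) set \<Rightarrow> bool"
  where "singular_foliation \<F> \<longleftrightarrow>
     \<F> \<subseteq> Collect smooth \<and>
     (\<lambda>x. 0) \<in> \<F> \<and>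
     (\<forall>X\<in>\<F>. \<forall>Y\<in>\<F>. (\<lambda>x. X x + Y x) \<in> \<F>) \<and>
     (\<forall>f. \<forall>X\<in>\<F>. smooth f \<longrightarrow> (\<lambda>x. f x *\<^sub>R X x) \<in> \<F>) \<and>
     (\<forall>X\<in>\<F>. \<forall>Y\<in>\<F>. vf_bracket X Y \<in> \<F>) \<and>
     (\<forall>p. \<exists>U G. open U \<and> p \<in> U \<and> finite G \<and> G \<subseteq> \<F> \<and>
        (\<forall>X\<in>\<F>. \<exists>c. (\<forall>Y\<in>G. smooth (c Y)) \<and> (\<forall>x\<in>U. X x = (\<Sum>Y\<in>G. c Y x *\<^sub>R Y x)))) \<and>
     (\<forall>X. smooth X \<and> (\<forall>p. \<exists>U. open U \<and> p \<in> U \<and> (\<exists>Y\<in>\<F>. \<forall>x\<in>U. X x = Y x)) \<longrightarrow> X \<in> \<F>)"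

definition vanishing_ideal :: "'v::euclidean_space set \<Rightarrow> ('v \<Rightarrow> real) set"
  where "vanishing_ideal W = {f. smooth f \<and> (\<forall>w\<in>W. f w = 0)}"

definition subspace_foliation :: "'v::euclidean_space set \<Rightarrow> ('v \<Rightarrow> 'v) set"
  where "subspace_foliation W = {X. smooth X \<and> X 0 = 0 \<and>
     (\<forall>f\<in>vanishing_ideal W. vf_apply X f \<in> vanishing_ideal W)}"


section \<open>dg-Lie algebroids\<close>

definition ksign :: "int \<Rightarrow> real"
  where "ksign k = (if even k then 1 else -1)"

definition extended_anchor ::
    "(('v \<Rightarrow> 'f) \<Rightarrow> 'v \<Rightarrow> 'v) \<Rightarrow> int \<Rightarrow> ('v \<Rightarrow> 'f) \<Rightarrow> 'v::euclidean_space \<Rightarrow> 'v"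
  where "extended_anchor \<rho> i a = (if i = 0 then \<rho> a else (\<lambda>x. 0))"

text \<open>
  dg-Lie algebroids over \<open>M = 'v\<close> whose underlying graded vector bundle is the trivial bundle with
  fibre \<open>E i\<close> in degree \<open>i\<close>, where \<open>E i\<close> is a finite-dimensional subspace of a common vector space
  \<open>'f\<close>. The homogeneous components of the structure maps carry the degrees of their arguments:
  \<open>d i\<close> is the differential on \<open>\<Gamma>(E i)\<close> and \<open>br i k\<close> is the bracket on \<open>\<Gamma>(E i) \<times> \<Gamma>(E k)\<close>. The bundle
  maps \<open>d\<close> and \<open>\<rho>\<close> are given as \<open>C\<^sup>\<infinity>\<close>-linear maps between modules of sections.
\<close>
locale dg_lie_algebroid =
  fixes E :: "int \<Rightarrow> 'f::real_vector set"
    and d :: "int \<Rightarrow> ('v::euclidean_space \<Rightarrow> 'f) \<Rightarrow> ('v \<Rightarrow> 'f)"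
    and \<rho> :: "('v \<Rightarrow> 'f) \<Rightarrow> ('v \<Rightarrow> 'v)"
    and br :: "int \<Rightarrow> int \<Rightarrow> ('v \<Rightarrow> 'f) \<Rightarrow> ('v \<Rightarrow> 'f) \<Rightarrow> ('v \<Rightarrow> 'f)"
  assumes fibre_subspace: "\<And>i. subspace (E i)"
    and fibre_finite_dim: "\<And>i. \<exists>B. finite B \<and> span B = E i"
    and fibre_positive: "\<And>i. i > 0 \<Longrightarrow> E i = {0}"
    and d_closed: "\<And>i a. a \<in> smooth_sections (E i) \<Longrightarrow> d i a \<in> smooth_sections (E (i + 1))"
    and d_add: "\<And>i a b. \<lbrakk>a \<in> smooth_sections (E i); b \<in> smooth_sections (E i)\<rbrakk> \<Longrightarrow>
        d i (\<lambda>x. a x + b x) = (\<lambda>x. d i a x + d i b x)"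
    and d_mult: "\<And>i f a. \<lbrakk>smooth f; a \<in> smooth_sections (E i)\<rbrakk> \<Longrightarrow>
        d i (\<lambda>x. f x *\<^sub>R a x) = (\<lambda>x. f x *\<^sub>R d i a x)"
    and d_d: "\<And>i a. a \<in> smooth_sections (E i) \<Longrightarrow> d (i + 1) (d i a) = (\<lambda>x. 0)"
    and anchor_closed: "\<And>a. a \<in> smooth_sections (E 0) \<Longrightarrow> smooth (\<rho> a)"
    and anchor_add: "\<And>a b. \<lbrakk>a \<in> smooth_sections (E 0); b \<in> smooth_sections (E 0)\<rbrakk> \<Longrightarrow>
        \<rho> (\<lambda>x. a x + b x) = (\<lambda>x. \<rho> a x + \<rho> b x)"
    and anchor_mult: "\<And>f a. \<lbrakk>smooth f; a \<in> smooth_sections (E 0)\<rbrakk> \<Longrightarrow>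
        \<rho> (\<lambda>x. f x *\<^sub>R a x) = (\<lambda>x. f x *\<^sub>R \<rho> a x)"
    and anchor_d: "\<And>a. a \<in> smooth_sections (E (-1)) \<Longrightarrow> \<rho> (d (-1) a) = (\<lambda>x. 0)"
    and br_closed: "\<And>i k a b. \<lbrakk>a \<in> smooth_sections (E i); b \<in> smooth_sections (E k)\<rbrakk> \<Longrightarrow>
        br i k a b \<in> smooth_sections (E (i + k))"
    and br_add: "\<And>i k a b c. \<lbrakk>a \<in> smooth_sections (E i);
        b \<in> smooth_sections (E k); c \<in> smooth_sections (E k)\<rbrakk> \<Longrightarrow>
        br i k a (\<lambda>x. b x + c x) = (\<lambda>x. br i k a b x + br i k a c x)"
    and br_skew: "\<And>i k a b. \<lbrakk>a \<in> smooth_sections (E i); b \<in> smooth_sections (E k)\<rbrakk> \<Longrightarrow>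
        br i k a b = (\<lambda>x. - ksign (i * k) *\<^sub>R br k i b a x)"
    and br_leibniz: "\<And>i k f a b. \<lbrakk>smooth f;
        a \<in> smooth_sections (E i); b \<in> smooth_sections (E k)\<rbrakk> \<Longrightarrow>
        br i k a (\<lambda>x. f x *\<^sub>R b x) =
          (\<lambda>x. f x *\<^sub>R br i k a b x + vf_apply (extended_anchor \<rho> i a) f x *\<^sub>R b x)"
    and anchor_br: "\<And>i k a b. \<lbrakk>a \<in> smooth_sections (E i); b \<in> smooth_sections (E k)\<rbrakk> \<Longrightarrow>
        extended_anchor \<rho> (i + k) (br i k a b) =
          vf_bracket (extended_anchor \<rho> i a) (extended_anchor \<rho> k b)"
    and d_br: "\<And>i k a b. \<lbrakk>a \<in> smooth_sections (E i); b \<in> smooth_sections (E k)\<rbrakk> \<Longrightarrow>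
        d (i + k) (br i k a b) =
          (\<lambda>x. br (i + 1) k (d i a) b x + ksign i *\<^sub>R br i (k + 1) a (d k b) x)"
    and jacobi: "\<And>i k l a b c. \<lbrakk>a \<in> smooth_sections (E i);
        b \<in> smooth_sections (E k); c \<in> smooth_sections (E l)\<rbrakk> \<Longrightarrow>
        br i (k + l) a (br k l b c) =
          (\<lambda>x. br (i + k) l (br i k a b) c x + ksign (i * k) *\<^sub>R br k (i + l) b (br i l a c) x)"

text \<open>
  A dg-Lie algebroid is an \<open>L\<^sub>\<infinity>\<close>-algebroid whose brackets of arity at least three vanish. The
  following says that, as an \<open>L\<^sub>\<infinity>\<close>-algebroid, it is universal for the singular foliation \<open>\<F>\<close>:
  the sections of the underlying complex resolve \<open>\<F>\<close>.
\<close>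
locale universal_dg_lie_algebroid = dg_lie_algebroid E d \<rho> br
  for E :: "int \<Rightarrow> 'f::real_vector set"
    and d :: "int \<Rightarrow> ('v::euclidean_space \<Rightarrow> 'f) \<Rightarrow> ('v \<Rightarrow> 'f)"
    and \<rho> :: "('v \<Rightarrow> 'f) \<Rightarrow> ('v \<Rightarrow> 'v)"
    and br :: "int \<Rightarrow> int \<Rightarrow> ('v \<Rightarrow> 'f) \<Rightarrow> ('v \<Rightarrow> 'f) \<Rightarrow> ('v \<Rightarrow> 'f)" +
  fixes \<F> :: "('v \<Rightarrow> 'v) set"
  assumes foliation: "singular_foliation \<F>"
    and anchor_onto: "\<rho> ` smooth_sections (E 0) = \<F>"
    and exact_at_0: "{a \<in> smooth_sections (E 0). \<rho> a = (\<lambda>x. 0)} = d (-1) ` smooth_sections (E (-1))"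
    and exact_below_0: "\<And>i. i < 0 \<Longrightarrow>
        {a \<in> smooth_sections (E i). d i a = (\<lambda>x. 0)} = d (i - 1) ` smooth_sections (E (i - 1))"

text \<open>
  The bundle map inducing \<open>d i\<close> sends \<open>e\<close> in the fibre over \<open>p\<close> to \<open>d i a p\<close> for any section \<open>a\<close>
  with \<open>a p = e\<close>; it vanishes at \<open>p\<close> iff \<open>d i a p = 0\<close> for all sections \<open>a\<close>. The anchor is not one of
  the differentials.
\<close>
definition minimal_at ::
    "(int \<Rightarrow> 'f::real_vector set) \<Rightarrow> (int \<Rightarrow> ('v::euclidean_space \<Rightarrow> 'f) \<Rightarrow> ('v \<Rightarrow> 'f)) \<Rightarrow> 'v \<Rightarrow> bool"
  where "minimal_at E d p \<longleftrightarrow> (\<forall>i<0. \<forall>a\<in>smooth_sections (E i). d i a p = 0)"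


section \<open>Alternating forms\<close>

text \<open>
  \<open>alt_forms k\<close> is \<open>Hom(\<Lambda>\<^sup>kV, U) = \<Lambda>\<^sup>kV\<^sup>* \<otimes> U\<close> with \<open>V = 'v\<close> and \<open>U = 'u\<close>. The arguments of a form are
  collected in a list; a \<open>k\<close>-form is extended by zero to lists of length different from \<open>k\<close>, which
  makes its representation unique.
\<close>
definition alt_forms :: "nat \<Rightarrow> ('v::real_vector list \<Rightarrow> 'u::real_vector) set"
  where "alt_forms k = {\<phi>.
     (\<forall>vs. length vs \<noteq> k \<longrightarrow> \<phi> vs = 0) \<and>
     (\<forall>vs i. length vs = k \<and> i < k \<longrightarrow> linear (\<lambda>v. \<phi> (vs[i := v]))) \<and>
     (\<forall>vs i j. length vs = k \<and> i < j \<and> j < k \<and> vs ! i = vs ! j \<longrightarrow> \<phi> vs = 0)}"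

definition contract :: "'v \<Rightarrow> ('v list \<Rightarrow> 'u) \<Rightarrow> 'v list \<Rightarrow> 'u"
  where "contract v \<phi> = (\<lambda>vs. \<phi> (v # vs))"

definition tensor :: "('v list \<Rightarrow> real) \<Rightarrow> 'u \<Rightarrow> 'v list \<Rightarrow> 'u::real_vector"
  where "tensor \<phi> u = (\<lambda>vs. \<phi> vs *\<^sub>R u)"

text \<open>
  The wedge product of a \<open>k\<close>-form and an \<open>l\<close>-form as the sum over \<open>(k, l)\<close>-shuffles, without further
  normalisation. A shuffle is encoded by the set \<open>S\<close> of positions of the arguments of the first
  factor, and its sign is given by the number of inversions. Only sets \<open>S\<close> with \<open>card S = k\<close>
  contribute, since a \<open>k\<close>-form vanishes on lists of other lengths.
\<close>
definition shuffle_sign :: "nat \<Rightarrow> nat set \<Rightarrow> real"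
  where "shuffle_sign m S = (-1) ^ card {(i, j). i \<in> S \<and> j \<in> {..<m} - S \<and> j < i}"

definition wedge :: "('v list \<Rightarrow> real) \<Rightarrow> ('v list \<Rightarrow> 'u) \<Rightarrow> 'v list \<Rightarrow> 'u::real_vector"
  where "wedge \<phi> \<psi> = (\<lambda>vs. \<Sum>S\<in>Pow {..<length vs}.
     (shuffle_sign (length vs) S * \<phi> (nths vs S)) *\<^sub>R \<psi> (nths vs ({..<length vs} - S)))"


section \<open>Differential, anchor and bracket on vector-valued forms\<close>

text \<open>
  Contraction with the Euler vector field, whose value at \<open>x\<close> is \<open>x\<close>; see \<open>koszul_d_coordinates\<close>.
\<close>
definition koszul_d :: "('v \<Rightarrow> 'v list \<Rightarrow> 'v) \<Rightarrow> 'v \<Rightarrow> 'v list \<Rightarrow> 'v"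
  where "koszul_d \<alpha> = (\<lambda>x. contract x (\<alpha> x))"

definition koszul_anchor :: "('v \<Rightarrow> 'v list \<Rightarrow> 'v) \<Rightarrow> 'v \<Rightarrow> 'v"
  where "koszul_anchor \<alpha> = (\<lambda>x. \<alpha> x [x])"

definition deriv_along :: "('v \<Rightarrow> 'v) \<Rightarrow> ('v \<Rightarrow> 'v list \<Rightarrow> 'v) \<Rightarrow> 'v \<Rightarrow> 'v list \<Rightarrow> 'v::euclidean_space"
  where "deriv_along X \<beta> = (\<lambda>x vs. frechet_derivative (\<lambda>y. \<beta> y vs) (at x) (X x))"

text \<open>
  The bracket of a section of degree \<open>1 - k\<close> (a \<open>k\<close>-form) and one of degree \<open>1 - l\<close> (an \<open>l\<close>-form).
  It is the bilinear extension of the formula on decomposable sections proved in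
  \<open>nr_bracket_decomposable\<close>, applied to \<open>\<alpha> = (\<Sum>b\<in>Basis. \<alpha>\<^sub>b \<otimes> b)\<close> and \<open>\<beta> = (\<Sum>b\<in>Basis. \<beta>\<^sub>b \<otimes> b)\<close>.
\<close>
definition nr_bracket :: "nat \<Rightarrow> nat \<Rightarrow> ('v \<Rightarrow> 'v list \<Rightarrow> 'v) \<Rightarrow> ('v \<Rightarrow> 'v list \<Rightarrow> 'v) \<Rightarrow>
    'v \<Rightarrow> 'v list \<Rightarrow> 'v::euclidean_space"
  where "nr_bracket k l \<alpha> \<beta> = (\<lambda>x.
     (\<Sum>b\<in>Basis. wedge (\<lambda>vs. \<alpha> x vs \<bullet> b) (contract b (\<beta> x)))
     - (-1) ^ ((k - 1) * (l - 1)) *\<^sub>R (\<Sum>b\<in>Basis. wedge (\<lambda>vs. \<beta> x vs \<bullet> b) (contract b (\<alpha> x)))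
     + (if k = 1 then deriv_along (koszul_anchor \<alpha>) \<beta> x else 0)
     - (if l = 1 then deriv_along (koszul_anchor \<beta>) \<alpha> x else 0))"

lemma linear_contract:
  assumes "\<phi> \<in> alt_forms k"
  shows "linear (\<lambda>v. \<phi> (v # vs))"
proof (cases "length (undefined # vs) = k")
  case True
  then have "linear (\<lambda>v. \<phi> ((undefined # vs)[0 := v]))"
    using assms unfolding alt_forms_def by blast
  then show ?thesis by simp
next
  case False
  then have "\<phi> (v # vs) = 0" for v
    using assms unfolding alt_forms_def by auto
  then show ?thesis by (simp add: linear_zero)
qed

lemma koszul_d_coordinates:
  fixes \<alpha> :: "'v::euclidean_space \<Rightarrow> 'v list \<Rightarrow> 'v"
  assumes "\<And>x. \<alpha> x \<in> alt_forms k"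
    and "finite B" and "\<And>x. x = (\<Sum>e\<in>B. c e x *\<^sub>R e)"
  shows "koszul_d \<alpha> = (\<lambda>x. \<Sum>e\<in>B. c e x *\<^sub>R contract e (\<alpha> x))"
proof (intro ext)
  fix x vs
  interpret l: linear "\<lambda>v. \<alpha> x (v # vs)"
    by (rule linear_contract[OF assms(1)])
  have "koszul_d \<alpha> x vs = \<alpha> x ((\<Sum>e\<in>B. c e x *\<^sub>R e) # vs)"
    using assms(3)[of x] by (simp add: koszul_d_def contract_def)
  also have "\<dots> = (\<Sum>e\<in>B. c e x *\<^sub>R \<alpha> x (e # vs))"
    by (simp add: l.sum l.scale)
  finally show "koszul_d \<alpha> x vs = (\<Sum>e\<in>B. c e x *\<^sub>R contract e (\<alpha> x)) vs"
    by (simp add: sum_fun_apply contract_def)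
qed

lemma koszul_anchor_decomposable:
  "koszul_anchor (\<lambda>x. f x *\<^sub>R tensor \<phi> w) = (\<lambda>x. f x *\<^sub>R (\<phi> [x] *\<^sub>R w))"
  by (simp add: koszul_anchor_def tensor_def)

lemma wedge_decomposable:
  fixes w\<^sub>1 w\<^sub>2 :: "'v::euclidean_space"
  assumes "\<phi>\<^sub>2 \<in> alt_forms l"
  shows "(\<Sum>b\<in>Basis. wedge (\<lambda>vs :: 'v list. (f\<^sub>1 *\<^sub>R tensor \<phi>\<^sub>1 w\<^sub>1) vs \<bullet> b) (contract b (f\<^sub>2 *\<^sub>R tensor \<phi>\<^sub>2 w\<^sub>2)))
    = (f\<^sub>1 * f\<^sub>2) *\<^sub>R tensor (wedge \<phi>\<^sub>1 (contract w\<^sub>1 \<phi>\<^sub>2)) w\<^sub>2"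
proof
  fix vs :: "'v list"
  let ?P = "Pow {..<length vs}"
  let ?s = "\<lambda>S. shuffle_sign (length vs) S"
  let ?c = "\<lambda>S. {..<length vs} - S"
  have lin: "(\<Sum>b\<in>Basis. (w\<^sub>1 \<bullet> b) * \<phi>\<^sub>2 (b # us)) = \<phi>\<^sub>2 (w\<^sub>1 # us)" for us
  proof -
    interpret l: linear "\<lambda>v. \<phi>\<^sub>2 (v # us)"
      by (rule linear_contract[OF assms])
    have "\<phi>\<^sub>2 (w\<^sub>1 # us) = \<phi>\<^sub>2 ((\<Sum>b\<in>Basis. (w\<^sub>1 \<bullet> b) *\<^sub>R b) # us)"
      by (simp add: euclidean_representation)
    also have "\<dots> = (\<Sum>b\<in>Basis. (w\<^sub>1 \<bullet> b) * \<phi>\<^sub>2 (b # us))"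
      by (simp add: l.sum l.scale)
    finally show ?thesis by simp
  qed
  have "(\<Sum>b\<in>Basis. wedge (\<lambda>vs. (f\<^sub>1 *\<^sub>R tensor \<phi>\<^sub>1 w\<^sub>1) vs \<bullet> b) (contract b (f\<^sub>2 *\<^sub>R tensor \<phi>\<^sub>2 w\<^sub>2))) vs
      = (\<Sum>b\<in>Basis. \<Sum>S\<in>?P. (?s S * f\<^sub>1 * f\<^sub>2 * \<phi>\<^sub>1 (nths vs S) * ((w\<^sub>1 \<bullet> b) * \<phi>\<^sub>2 (b # nths vs (?c S)))) *\<^sub>R w\<^sub>2)"
    by (simp add: sum_fun_apply wedge_def tensor_def contract_def mult_ac)
  also have "\<dots> = (\<Sum>S\<in>?P. \<Sum>b\<in>Basis. (?s S * f\<^sub>1 * f\<^sub>2 * \<phi>\<^sub>1 (nths vs S) * ((w\<^sub>1 \<bullet> b) * \<phi>\<^sub>2 (b # nths vs (?c S)))) *\<^sub>R w\<^sub>2)"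
    by (rule sum.swap)
  also have "\<dots> = (\<Sum>S\<in>?P. (?s S * f\<^sub>1 * f\<^sub>2 * \<phi>\<^sub>1 (nths vs S) * \<phi>\<^sub>2 (w\<^sub>1 # nths vs (?c S))) *\<^sub>R w\<^sub>2)"
    by (simp only: scaleR_sum_left[symmetric] sum_distrib_left[symmetric] lin)
  also have "\<dots> = ((f\<^sub>1 * f\<^sub>2) *\<^sub>R tensor (wedge \<phi>\<^sub>1 (contract w\<^sub>1 \<phi>\<^sub>2)) w\<^sub>2) vs"
    by (simp add: wedge_def tensor_def contract_def scaleR_sum_left sum_distrib_left mult_ac
        flip: scaleR_sum_left)
  finally show "(\<Sum>b\<in>Basis. wedge (\<lambda>vs. (f\<^sub>1 *\<^sub>R tensor \<phi>\<^sub>1 w\<^sub>1) vs \<bullet> b) (contract b (f\<^sub>2 *\<^sub>R tensor \<phi>\<^sub>2 w\<^sub>2))) vs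
      = ((f\<^sub>1 * f\<^sub>2) *\<^sub>R tensor (wedge \<phi>\<^sub>1 (contract w\<^sub>1 \<phi>\<^sub>2)) w\<^sub>2) vs" .
qed

lemma deriv_along_decomposable:
  assumes "smooth f"
  shows "deriv_along X (\<lambda>x. f x *\<^sub>R tensor \<phi> w) x = vf_apply X f x *\<^sub>R tensor \<phi> w"
proof
  fix vs
  have "f differentiable (at x)"
    using assms unfolding smooth_def by (metis cont_diff.simps(2))
  then have "(f has_derivative frechet_derivative f (at x)) (at x)"
    by (simp add: frechet_derivative_works)
  then have "((\<lambda>y. f y *\<^sub>R (\<phi> vs *\<^sub>R w)) has_derivative
      (\<lambda>h. frechet_derivative f (at x) h *\<^sub>R (\<phi> vs *\<^sub>R w))) (at x)"
    by (rule has_derivative_scaleR_left)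
  then have "(\<lambda>h. frechet_derivative f (at x) h *\<^sub>R (\<phi> vs *\<^sub>R w)) =
      frechet_derivative (\<lambda>y. f y *\<^sub>R (\<phi> vs *\<^sub>R w)) (at x)"
    by (rule frechet_derivative_at)
  then show "deriv_along X (\<lambda>x. f x *\<^sub>R tensor \<phi> w) x vs = (vf_apply X f x *\<^sub>R tensor \<phi> w) vs"
    by (simp add: deriv_along_def vf_apply_def tensor_def fun_eq_iff del: scaleR_scaleR)
qed

lemma nr_bracket_decomposable:
  fixes w\<^sub>1 w\<^sub>2 :: "'v::euclidean_space"
  assumes "smooth f\<^sub>1" and "smooth f\<^sub>2" and "\<phi>\<^sub>1 \<in> alt_forms k\<^sub>1" and "\<phi>\<^sub>2 \<in> alt_forms k\<^sub>2"
  shows "nr_bracket k\<^sub>1 k\<^sub>2 (\<lambda>x. f\<^sub>1 x *\<^sub>R tensor \<phi>\<^sub>1 w\<^sub>1) (\<lambda>x. f\<^sub>2 x *\<^sub>R tensor \<phi>\<^sub>2 w\<^sub>2) = (\<lambda>x.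
     (f\<^sub>1 x * f\<^sub>2 x) *\<^sub>R (tensor (wedge \<phi>\<^sub>1 (contract w\<^sub>1 \<phi>\<^sub>2)) w\<^sub>2
       - (-1) ^ ((k\<^sub>1 - 1) * (k\<^sub>2 - 1)) *\<^sub>R tensor (wedge \<phi>\<^sub>2 (contract w\<^sub>2 \<phi>\<^sub>1)) w\<^sub>1)
     + (if k\<^sub>1 = 1 then (f\<^sub>1 x * vf_apply (koszul_anchor (\<lambda>x. tensor \<phi>\<^sub>1 w\<^sub>1)) f\<^sub>2 x) *\<^sub>R tensor \<phi>\<^sub>2 w\<^sub>2 else 0)
     - (if k\<^sub>2 = 1 then (f\<^sub>2 x * vf_apply (koszul_anchor (\<lambda>x. tensor \<phi>\<^sub>2 w\<^sub>2)) f\<^sub>1 x) *\<^sub>R tensor \<phi>\<^sub>1 w\<^sub>1 else 0))"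
proof -
  have vf: "vf_apply (koszul_anchor (\<lambda>x. g x *\<^sub>R tensor \<phi> w)) f x
      = g x * vf_apply (koszul_anchor (\<lambda>x. tensor \<phi> w)) f x"
    if "smooth f" for f g :: "'v \<Rightarrow> real" and \<phi> and w :: 'v and x
  proof -
    have "f differentiable (at x)"
      using that unfolding smooth_def by (metis cont_diff.simps(2))
    then have "linear (frechet_derivative f (at x))"
      by (rule linear_frechet_derivative)
    then show ?thesis
      by (simp add: vf_apply_def koszul_anchor_def linear_cmul)
  qed
  show ?thesis
    unfolding nr_bracket_def
    by (simp only: wedge_decomposable[OF assms(3)] wedge_decomposable[OF assms(4)]
        deriv_along_decomposable[OF assms(1)] deriv_along_decomposable[OF assms(2)]
        vf[OF assms(1)] vf[OF assms(2)])
      (auto simp: fun_eq_iff algebra_simps)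
qed


section \<open>The subcomplex of a linear subspace\<close>

definition K_forms :: "'v::euclidean_space set \<Rightarrow> nat \<Rightarrow> ('v list \<Rightarrow> 'v) set"
  where "K_forms W j = {\<phi> \<in> alt_forms j. \<forall>w\<in>W. \<forall>vs. length vs = j - 1 \<longrightarrow> \<phi> (w # vs) \<in> W}"

definition K_graded :: "'v::euclidean_space set \<Rightarrow> int \<Rightarrow> ('v list \<Rightarrow> 'v) set"
  where "K_graded W i = (if 1 - int DIM('v) \<le> i \<and> i \<le> 0 then K_forms W (nat (1 - i)) else {0})"

text \<open>
  Contracting a section of degree \<open>0\<close> gives its anchor, not its differential: the differential on
  \<open>\<Gamma>(K\<^sub>1)\<close> is zero, as there is nothing in degree \<open>1\<close>.
\<close>
definition graded_d :: "int \<Rightarrow> ('v \<Rightarrow> 'v list \<Rightarrow> 'v) \<Rightarrow> 'v \<Rightarrow> 'v list \<Rightarrow> 'v::euclidean_space"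
  where "graded_d i \<alpha> = (if i < 0 then koszul_d \<alpha> else (\<lambda>x. 0))"

definition graded_bracket :: "int \<Rightarrow> int \<Rightarrow> ('v \<Rightarrow> 'v list \<Rightarrow> 'v) \<Rightarrow> ('v \<Rightarrow> 'v list \<Rightarrow> 'v) \<Rightarrow>
    'v \<Rightarrow> 'v list \<Rightarrow> 'v::euclidean_space"
  where "graded_bracket i k = nr_bracket (nat (1 - i)) (nat (1 - k))"

end

theory Submission
  imports Defs
begin

text \<open>
  A section \<open>\<alpha>\<close> of \<open>\<Lambda>\<^sup>kV\<^sup>* \<otimes> V\<close> acts on vector-valued forms by \<open>D\<^sub>\<alpha> \<beta> = \<Sum>\<^sub>b \<alpha>\<^sub>b \<and> \<iota>\<^sub>b \<beta>\<close>, plus the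
  derivative of \<open>\<beta>\<close> along \<open>\<rho>(\<alpha>)\<close> if \<open>k = 1\<close>. The bracket is the graded commutator of the product
  \<open>D\<^sub>\<alpha> \<beta>\<close>, and \<open>[D\<^sub>\<alpha>, D\<^sub>\<beta>] = D\<^bsub>[\<alpha>, \<beta>]\<^esub>\<close> says that this product is graded pre-Lie, which gives the
  Jacobi identity; compatibility with the differential and the anchor comes from the commutator of
  \<open>D\<^sub>\<alpha>\<close> with the contraction by the Euler vector field.

  For exactness, split \<open>V = W \<oplus> W'\<close>. The \<open>W\<close>-component of a section of \<open>K\<^sub>j\<close> is arbitrary, and the
  \<open>W'\<close>-component is a form that vanishes on \<open>W\<close>. Both have primitives given by the Poincare-type
  homotopy that integrates the exterior derivative along segments, towards the origin for the former
  and towards \<open>W\<close> in the direction of \<open>W'\<close> for the latter. Vector fields are the case of \<open>0\<close>-forms,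
  where this is Hadamard's lemma.
\<close>

section \<open>Smooth maps\<close>

text \<open>The obstacle is that the homotopy towards the origin need not preserve the condition
  defining \<open>K_forms\<close>: it also differentiates in the directions of W, and the derivative
  of a form along w in W has no reason to take values in W. For the W-component this is repaired by
  projecting the primitive to W. For the complementary component derivatives along W are avoided
  altogether; the contraction still sees enough, since a form that vanishes on W cannot distinguish
  the Euler vector x from its part in the complement. The price is that the segment ends in W rather
  than at the origin. The weight t^k kills the boundary term there when k > 0. When k = 0 it is
  killed by the two conditions that define the foliation: vanishing at the origin for the
  W-component, tangency to W for the other one. This is why surjectivity of the anchor and exactness
  of the complex come from a single statement.\<close>

lemma cont_diff_Suc_has_derivative:
  "cont_diff (Suc k) f \<Longrightarrow> (f has_derivative frechet_derivative f (at x)) (at x)"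
  by (simp add: frechet_derivative_works)

lemma cont_diff_SucI:
  assumes "\<And>x. (f has_derivative f' x) (at x)" "\<And>h. cont_diff k (\<lambda>x. f' x h)"
  shows "cont_diff (Suc k) f"
proof -
  have "frechet_derivative f (at x) = f' x" for x
    using frechet_derivative_at[OF assms(1)] by simp
  then show ?thesis
    using assms by (auto simp: differentiable_def)
qed

lemma cont_diff_Suc_imp: "cont_diff (Suc k) f \<Longrightarrow> cont_diff k f"
proof (induction k arbitrary: f)
  case 0
  then show ?case
    by (simp add: continuous_on_eq_continuous_at differentiable_imp_continuous_within)
next
  case (Suc k)
  then show ?case
    by (metis cont_diff.simps(2))
qed

lemma smooth_iff:
  "smooth f \<longleftrightarrow> (\<forall>x. f differentiable (at x)) \<and> (\<forall>h. smooth (\<lambda>x. frechet_derivative f (at x) h))"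
  (is "_ \<longleftrightarrow> ?R")
proof
  assume "smooth f"
  then have "cont_diff (Suc k) f" for k by (simp add: smooth_def)
  then show ?R by (auto simp: smooth_def)
next
  assume R: ?R
  then have "cont_diff (Suc k) f" for k by (auto simp: smooth_def)
  then show "smooth f" unfolding smooth_def using cont_diff_Suc_imp by blast
qed

lemma smooth_has_derivative:
  "smooth f \<Longrightarrow> (f has_derivative frechet_derivative f (at x)) (at x)"
  by (meson frechet_derivative_works smooth_iff)

lemma smooth_frechet_derivative: "smooth f \<Longrightarrow> smooth (\<lambda>x. frechet_derivative f (at x) h)"
  using smooth_iff by blast

lemma smooth_continuous: "smooth f \<Longrightarrow> continuous_on S f"
  by (metis cont_diff.simps(1) continuous_on_subset smooth_def subset_UNIV)

lemma smooth_linear_derivative: "smooth f \<Longrightarrow> linear (frechet_derivative f (at x))"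
  by (meson linear_frechet_derivative smooth_iff)

lemma cont_diff_const: "cont_diff k (\<lambda>x. c)"
proof (induction k arbitrary: c)
  case (Suc k)
  show ?case by (rule cont_diff_SucI[OF has_derivative_const Suc])
qed simp

lemma smooth_const [simp]: "smooth (\<lambda>x. c)"
  by (simp add: smooth_def cont_diff_const)

lemma cont_diff_bounded_linear:
  assumes "bounded_linear L" "cont_diff k f"
  shows "cont_diff k (\<lambda>x. L (f x))"
  using assms(2)
proof (induction k arbitrary: f)
  case 0
  then show ?case
    using assms(1) linear_continuous_on_compose bounded_linear.continuous_on by auto
next
  case (Suc k)
  show ?case
  proof (rule cont_diff_SucI)
    show "((\<lambda>x. L (f x)) has_derivative (\<lambda>h. L (frechet_derivative f (at x) h))) (at x)" for x
      by (rule bounded_linear.has_derivative[OF assms(1) cont_diff_Suc_has_derivative[OF Suc.prems]])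
    show "cont_diff k (\<lambda>x. L (frechet_derivative f (at x) h))" for h
      using Suc by simp
  qed
qed

lemma smooth_bounded_linear: "bounded_linear L \<Longrightarrow> smooth f \<Longrightarrow> smooth (\<lambda>x. L (f x))"
  by (simp add: smooth_def cont_diff_bounded_linear)

lemma cont_diff_add:
  assumes "cont_diff k f" "cont_diff k g"
  shows "cont_diff k (\<lambda>x. f x + g x)"
  using assms
proof (induction k arbitrary: f g)
  case 0
  then show ?case by (simp add: continuous_on_add)
next
  case (Suc k)
  show ?case
    by (rule cont_diff_SucI[OF has_derivative_add[OF cont_diff_Suc_has_derivative[OF Suc.prems(1)]
            cont_diff_Suc_has_derivative[OF Suc.prems(2)]]]) (use Suc in simp)
qed

lemma smooth_add [intro]: "smooth f \<Longrightarrow> smooth g \<Longrightarrow> smooth (\<lambda>x. f x + g x)"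
  by (simp add: smooth_def cont_diff_add)

lemma smooth_sum [intro]: "(\<And>i. i \<in> I \<Longrightarrow> smooth (f i)) \<Longrightarrow> smooth (\<lambda>x. \<Sum>i\<in>I. f i x)"
  by (induction I rule: infinite_finite_induct) auto

lemma cont_diff_scaleR:
  assumes "cont_diff k f" "cont_diff k g"
  shows "cont_diff k (\<lambda>x. f x *\<^sub>R g x)"
  using assms
proof (induction k arbitrary: f g)
  case 0
  then show ?case by (simp add: continuous_on_scaleR)
next
  case (Suc k)
  show ?case
    by (rule cont_diff_SucI[OF has_derivative_scaleR[OF cont_diff_Suc_has_derivative[OF Suc.prems(1)]
            cont_diff_Suc_has_derivative[OF Suc.prems(2)]]])
      (intro cont_diff_add Suc.IH; use Suc.prems cont_diff_Suc_imp in auto)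
qed

lemma smooth_scaleR [intro]: "smooth f \<Longrightarrow> smooth g \<Longrightarrow> smooth (\<lambda>x. f x *\<^sub>R g x)"
  by (simp add: smooth_def cont_diff_scaleR)

lemma smooth_mult:
  fixes f g :: "'v::euclidean_space \<Rightarrow> real"
  shows "smooth f \<Longrightarrow> smooth g \<Longrightarrow> smooth (\<lambda>x. f x * g x)"
  using smooth_scaleR[of f g] by simp

lemma smooth_linear:
  fixes L :: "'a::euclidean_space \<Rightarrow> 'b::real_normed_vector"
  shows "linear L \<Longrightarrow> smooth f \<Longrightarrow> smooth (\<lambda>x. L (f x))"
  by (simp add: smooth_bounded_linear linear_conv_bounded_linear)

lemma smooth_ident [simp]: "smooth (\<lambda>x. x)"
  unfolding smooth_iff[of "\<lambda>x. x"] by simp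

lemma smooth_uminus [intro]: "smooth f \<Longrightarrow> smooth (\<lambda>x. - f x)"
  using smooth_bounded_linear[OF bounded_linear_minus[OF bounded_linear_ident]] by blast

lemma smooth_diff [intro]: "smooth f \<Longrightarrow> smooth g \<Longrightarrow> smooth (\<lambda>x. f x - g x)"
  using smooth_add[of f "\<lambda>x. - g x"] by auto

lemma smooth_inner_left [intro]: "smooth f \<Longrightarrow> smooth (\<lambda>x. f x \<bullet> b)"
  using smooth_bounded_linear[OF bounded_linear_inner_left] by blast

text \<open>Expanding the vector field in the basis turns an argument that moves with the base point
  into finitely many fixed ones. This covers contraction with the Euler field and derivatives along
  a vector field, where smoothness is known in fixed directions only.\<close>

lemma smooth_linear_family:
  fixes X :: "'v::euclidean_space \<Rightarrow> 'v"
  assumes "\<And>x. linear (F x)" "\<And>h. smooth (\<lambda>x. F x h)" "smooth X"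
  shows "smooth (\<lambda>x. F x (X x))"
proof -
  have "F x (X x) = (\<Sum>e\<in>Basis. (X x \<bullet> e) *\<^sub>R F x e)" for x
  proof -
    interpret linear "F x" by fact
    have "F x (X x) = F x (\<Sum>e\<in>Basis. (X x \<bullet> e) *\<^sub>R e)"
      by (simp add: euclidean_representation)
    then show ?thesis by (simp only: sum scale)
  qed
  then show ?thesis
    by (simp add: assms smooth_sum smooth_scaleR smooth_inner_left)
qed

lemma smooth_frechet_along:
  "smooth f \<Longrightarrow> smooth X \<Longrightarrow> smooth (\<lambda>x. frechet_derivative f (at x) (X x))"
  by (rule smooth_linear_family) (auto intro: smooth_linear_derivative smooth_frechet_derivative)

section \<open>Symmetry of second derivatives\<close>

text \<open>The mean value theorem twice, in direction \<open>h\<close> and then in direction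
  \<open>k\<close>. The second difference is symmetric in \<open>h\<close> and \<open>k\<close>, so
  comparing the two orders relates the two mixed derivatives.\<close>

lemma smooth_second_difference:
  fixes f :: "'v::euclidean_space \<Rightarrow> real"
  assumes f: "smooth f" and u: "u > 0"
  shows "\<exists>\<xi>\<in>{0..u}. \<exists>\<eta>\<in>{0..u}. f (x + u *\<^sub>R h + u *\<^sub>R k) - f (x + u *\<^sub>R h) - f (x + u *\<^sub>R k) + f x
    = u\<^sup>2 * frechet_derivative (\<lambda>y. frechet_derivative f (at y) h) (at (x + \<xi> *\<^sub>R h + \<eta> *\<^sub>R k)) k"
proof -
  let ?D = "\<lambda>g y. frechet_derivative g (at y)"
  have line: "((\<lambda>s. g (a + s *\<^sub>R v)) has_real_derivative ?D g (a + s *\<^sub>R v) v) (at s)"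
    if "smooth g" for g :: "'v \<Rightarrow> real" and a v s
  proof -
    have "((\<lambda>s. a + s *\<^sub>R v) has_derivative (\<lambda>t. t *\<^sub>R v)) (at s)"
      by (auto intro!: derivative_eq_intros)
    then have "(g \<circ> (\<lambda>s. a + s *\<^sub>R v) has_derivative (?D g (a + s *\<^sub>R v) \<circ> (\<lambda>t. t *\<^sub>R v))) (at s)"
      by (rule diff_chain_at) (rule smooth_has_derivative[OF that])
    then show ?thesis
      unfolding has_field_derivative_def
      using linear_cmul[OF smooth_linear_derivative[OF that]]
      by (simp add: o_def mult_commute_abs)
  qed
  \<comment> \<open>The mean value theorem on [0, u] for f (x + u k + s h) - f (x + s h) as a
    function of s; the terms with factor 0 are its value at the left end.\<close>
  have "\<exists>\<xi>>0. \<xi> < u \<and> (f (x + u *\<^sub>R k + u *\<^sub>R h) - f (x + u *\<^sub>R h)) - (f (x + u *\<^sub>R k + 0 *\<^sub>R h) - f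
      (x + 0 *\<^sub>R h))
      = (u - 0) * (?D f (x + u *\<^sub>R k + \<xi> *\<^sub>R h) h - ?D f (x + \<xi> *\<^sub>R h) h)"
    by (rule MVT2[OF u]) (auto intro!: DERIV_diff line f)
  then obtain \<xi> where \<xi>: "\<xi> > 0" "\<xi> < u" and
    1: "f (x + u *\<^sub>R h + u *\<^sub>R k) - f (x + u *\<^sub>R h) - f (x + u *\<^sub>R k) + f x
      = u * (?D f (x + \<xi> *\<^sub>R h + u *\<^sub>R k) h - ?D f (x + \<xi> *\<^sub>R h) h)"
    by (auto simp: algebra_simps)
  have "\<exists>\<eta>>0. \<eta> < u \<and> ?D f (x + \<xi> *\<^sub>R h + u *\<^sub>R k) h - ?D f (x + \<xi> *\<^sub>R h + 0 *\<^sub>R k) h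
      = (u - 0) * ?D (\<lambda>y. ?D f y h) (x + \<xi> *\<^sub>R h + \<eta> *\<^sub>R k) k"
    by (rule MVT2[OF u], rule line[OF smooth_frechet_derivative[OF f]])
  then obtain \<eta> where \<eta>: "\<eta> > 0" "\<eta> < u" and
    2: "?D f (x + \<xi> *\<^sub>R h + u *\<^sub>R k) h - ?D f (x + \<xi> *\<^sub>R h) h
      = u * ?D (\<lambda>y. ?D f y h) (x + \<xi> *\<^sub>R h + \<eta> *\<^sub>R k) k"
    by auto
  have "f (x + u *\<^sub>R h + u *\<^sub>R k) - f (x + u *\<^sub>R h) - f (x + u *\<^sub>R k) + f x
    = u\<^sup>2 * ?D (\<lambda>y. ?D f y h) (x + \<xi> *\<^sub>R h + \<eta> *\<^sub>R k) k"
    unfolding 1 2 by (simp add: power2_eq_square)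
  then show ?thesis
    using \<xi> \<eta> by force
qed

lemma smooth_second_derivative_symmetric_real:
  fixes f :: "'v::euclidean_space \<Rightarrow> real"
  assumes f: "smooth f"
  shows "frechet_derivative (\<lambda>y. frechet_derivative f (at y) h) (at x) k
       = frechet_derivative (\<lambda>y. frechet_derivative f (at y) k) (at x) h"
proof -
  define G where "G h k y = frechet_derivative (\<lambda>y. frechet_derivative f (at y) h) (at y) k" for h k y
  have cont: "\<exists>d>0. \<forall>y. dist y x < d \<longrightarrow> dist (G h k y) (G h k x) < e" if "e > 0" for h k e
  proof -
    have "continuous_on UNIV (G h k)"
      unfolding G_def by (intro smooth_continuous smooth_frechet_derivative f)
    then show ?thesis using that unfolding continuous_on_iff by auto
  qed
  have near: "\<exists>d>0. \<forall>u \<xi> \<eta>. 0 < u \<longrightarrow> u < d \<longrightarrow> \<xi> \<in> {0..u} \<longrightarrow> \<eta> \<in> {0..u} \<longrightarrow>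
      dist (G h k (x + \<xi> *\<^sub>R h + \<eta> *\<^sub>R k)) (G h k x) < e"
    if e: "e > 0" for h k e
  proof -
    obtain d where d: "d > 0" "\<And>y. dist y x < d \<Longrightarrow> dist (G h k y) (G h k x) < e"
      using cont[OF e] by blast
    \<comment> \<open>The intermediate points stay within u * c of x; the summand 1 keeps c positive
      when \<open>h\<close> and \<open>k\<close> are both 0.\<close>
    define c where "c = norm h + norm k + 1"
    have c: "c > 0" unfolding c_def by (simp add: add_nonneg_pos)
    show ?thesis
    proof (intro exI[of _ "d / c"] conjI allI impI d(2))
      show "0 < d / c" using c d by simp
      fix u \<xi> \<eta> :: real
      assume u: "0 < u" "u < d / c" and \<xi>: "\<xi> \<in> {0..u}" and \<eta>: "\<eta> \<in> {0..u}"
      have "dist (x + \<xi> *\<^sub>R h + \<eta> *\<^sub>R k) x \<le> \<xi> * norm h + \<eta> * norm k"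
        using norm_triangle_ineq[of "\<xi> *\<^sub>R h" "\<eta> *\<^sub>R k"] \<xi> \<eta> by (simp add: dist_norm)
      also have "\<dots> \<le> u * norm h + u * norm k"
        using \<xi> \<eta> by (intro add_mono mult_right_mono) auto
      also have "\<dots> \<le> u * c" using u by (simp add: c_def algebra_simps)
      also have "\<dots> < d" using u c by (simp add: field_simps)
      finally show "dist (x + \<xi> *\<^sub>R h + \<eta> *\<^sub>R k) x < d" .
    qed
  qed
  have "dist (G h k x) (G k h x) < e" if e: "e > 0" for e
  proof -
    obtain d1 where d1: "d1 > 0" "\<And>u \<xi> \<eta>. 0 < u \<Longrightarrow> u < d1 \<Longrightarrow> \<xi> \<in> {0..u} \<Longrightarrow> \<eta> \<in> {0..u} \<Longrightarrow>
      dist (G h k (x + \<xi> *\<^sub>R h + \<eta> *\<^sub>R k)) (G h k x) < e / 2"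
      using near[of "e / 2" h k] e by auto
    obtain d2 where d2: "d2 > 0" "\<And>u \<xi> \<eta>. 0 < u \<Longrightarrow> u < d2 \<Longrightarrow> \<xi> \<in> {0..u} \<Longrightarrow> \<eta> \<in> {0..u} \<Longrightarrow>
      dist (G k h (x + \<xi> *\<^sub>R k + \<eta> *\<^sub>R h)) (G k h x) < e / 2"
      using near[of "e / 2" k h] e by auto
    \<comment> \<open>The same u serves both orders: they compute the same second difference, so the
      two mixed derivatives agree at their intermediate points, each of which is within e / 2 of the
      value at x.\<close>
    define u where "u = min d1 d2 / 2"
    have u: "u > 0" "u < d1" "u < d2" using d1(1) d2(1) by (auto simp: u_def)
    obtain \<xi> \<eta> where 1: "\<xi> \<in> {0..u}" "\<eta> \<in> {0..u}"
      "f (x + u *\<^sub>R h + u *\<^sub>R k) - f (x + u *\<^sub>R h) - f (x + u *\<^sub>R k) + f x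
        = u\<^sup>2 * G h k (x + \<xi> *\<^sub>R h + \<eta> *\<^sub>R k)"
      using smooth_second_difference[OF f u(1), of x h k] unfolding G_def by blast
    obtain \<xi>' \<eta>' where 2: "\<xi>' \<in> {0..u}" "\<eta>' \<in> {0..u}"
      "f (x + u *\<^sub>R k + u *\<^sub>R h) - f (x + u *\<^sub>R k) - f (x + u *\<^sub>R h) + f x
        = u\<^sup>2 * G k h (x + \<xi>' *\<^sub>R k + \<eta>' *\<^sub>R h)"
      using smooth_second_difference[OF f u(1), of x k h] unfolding G_def by blast
    have "u\<^sup>2 * G h k (x + \<xi> *\<^sub>R h + \<eta> *\<^sub>R k) = u\<^sup>2 * G k h (x + \<xi>' *\<^sub>R k + \<eta>' *\<^sub>R h)"
      unfolding 1(3)[symmetric] 2(3)[symmetric] by (simp add: algebra_simps)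
    then have "G h k (x + \<xi> *\<^sub>R h + \<eta> *\<^sub>R k) = G k h (x + \<xi>' *\<^sub>R k + \<eta>' *\<^sub>R h)"
      using u(1) by simp
    then show ?thesis
      using d1(2)[OF u(1,2) 1(1,2)] d2(2)[OF u(1,3) 2(1,2)] unfolding dist_real_def by linarith
  qed
  then have "G h k x = G k h x"
    by (meson less_irrefl zero_less_dist_iff)
  then show ?thesis
    unfolding G_def .
qed

lemma smooth_second_derivative_symmetric:
  fixes f :: "'v::euclidean_space \<Rightarrow> 'b::euclidean_space"
  assumes f: "smooth f"
  shows "frechet_derivative (\<lambda>y. frechet_derivative f (at y) h) (at x) k
       = frechet_derivative (\<lambda>y. frechet_derivative f (at y) k) (at x) h"
proof (rule euclidean_eqI)
  fix b :: 'b
  assume "b \<in> Basis"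
  have comp: "frechet_derivative (\<lambda>y. g y \<bullet> b) (at y) h = frechet_derivative g (at y) h \<bullet> b"
    if "smooth g" for g :: "'v \<Rightarrow> 'b" and y h
    using frechet_derivative_at[OF has_derivative_inner_left[OF smooth_has_derivative[OF that]]]
    by (simp add: fun_eq_iff)
  show "frechet_derivative (\<lambda>y. frechet_derivative f (at y) h) (at x) k \<bullet> b
       = frechet_derivative (\<lambda>y. frechet_derivative f (at y) k) (at x) h \<bullet> b"
    using smooth_second_derivative_symmetric_real[OF smooth_inner_left[OF f, of b], of h x k]
    by (simp add: comp f smooth_frechet_derivative)
qed

section \<open>Integrals along segments\<close>

text \<open>Differentiating under the integral in direction \<open>h\<close> yields the derivative
  of \<open>f\<close> in direction \<open>P h + t *\<^sub>R Q h\<close>, and the factor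
  \<open>t\<close> can be absorbed into the weight. Integrals of this shape are thus closed under
  differentiation, provided the induction ranges over all \<open>p\<close> and
  \<open>f\<close>.\<close>

lemma cont_diff_integral_segment:
  fixes f :: "'v::euclidean_space \<Rightarrow> 'b::euclidean_space" and p :: "real \<Rightarrow> real" and P Q :: "'v \<Rightarrow> 'v"
  assumes P: "linear P" and Q: "linear Q" and "continuous_on {0..1} p" and "smooth f"
  shows "cont_diff k (\<lambda>x. integral {0..1} (\<lambda>t. p t *\<^sub>R f (P x + t *\<^sub>R Q x)))"
  using assms(3,4)
proof (induction k arbitrary: p f)
  case 0
  have "continuous_on (UNIV \<times> cbox 0 1) (\<lambda>(x, t). p t *\<^sub>R f (P x + t *\<^sub>R Q x))"
    unfolding split_beta
    by (intro continuous_intros continuous_on_compose2[OF 0(1)] continuous_on_compose2[OF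
        smooth_continuous[OF 0(2), of UNIV]]
        linear_continuous_on_compose[OF _ P] linear_continuous_on_compose[OF _ Q]) auto
  then show ?case
    using integral_continuous_on_param[of UNIV "0::real" 1 "\<lambda>x t. p t *\<^sub>R f (P x + t *\<^sub>R Q x)"]
    by simp
next
  case (Suc k)
  let ?D = "\<lambda>y. frechet_derivative f (at y)"
  let ?G = "\<lambda>x h. integral {0..1} (\<lambda>t. p t *\<^sub>R ?D (P x + t *\<^sub>R Q x) (P h + t *\<^sub>R Q h))"
  \<comment> \<open>The Leibniz rule asks for a derivative that is continuous as a bounded operator;
    in finite dimension this follows from continuity in each direction.\<close>
  define fx where "fx x t = Blinfun (\<lambda>h. p t *\<^sub>R ?D (P x + t *\<^sub>R Q x) (P h + t *\<^sub>R Q h))" for x t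
  have lin: "linear (\<lambda>h. p t *\<^sub>R ?D (P x + t *\<^sub>R Q x) (P h + t *\<^sub>R Q h))" for x t
  proof -
    interpret D: linear "?D (P x + t *\<^sub>R Q x)" by (rule smooth_linear_derivative[OF Suc.prems(2)])
    interpret P: linear P by fact
    interpret Q: linear Q by fact
    show ?thesis
      by (rule linearI) (simp_all add: D.add D.scale P.add P.scale Q.add Q.scale algebra_simps)
  qed
  have fx: "blinfun_apply (fx x t) = (\<lambda>h. p t *\<^sub>R ?D (P x + t *\<^sub>R Q x) (P h + t *\<^sub>R Q h))" for x t
    unfolding fx_def by (rule bounded_linear_Blinfun_apply) (use lin linear_conv_bounded_linear in
        blast)
  have exp: "?D y (P h + t *\<^sub>R Q h) = ?D y (P h) + t *\<^sub>R ?D y (Q h)" for y h t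
  proof -
    interpret D: linear "?D y" by (rule smooth_linear_derivative[OF Suc.prems(2)])
    show ?thesis by (simp add: D.add D.scale)
  qed
  have contD: "continuous_on S (\<lambda>z. ?D (g z) h)" if "continuous_on S g" for S g and h :: 'v
    by (rule continuous_on_compose2[OF smooth_continuous[OF smooth_frechet_derivative[OF
        Suc.prems(2)], of UNIV]])
      (use that in auto)
  have contfx: "continuous_on (UNIV \<times> cbox 0 1) (\<lambda>(x, t). fx x t)"
    unfolding split_beta
  proof (rule continuous_on_blinfun_componentwise)
    fix i :: 'v
    show "continuous_on (UNIV \<times> cbox 0 1) (\<lambda>z. blinfun_apply (fx (fst z) (snd z)) i)"
      unfolding fx exp
      by (intro continuous_intros continuous_on_compose2[OF Suc.prems(1)] contD
        linear_continuous_on_compose[OF _ P] linear_continuous_on_compose[OF _ Q]) auto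
  qed
  have contx: "continuous_on (cbox 0 1) (\<lambda>t. p t *\<^sub>R f (P x + t *\<^sub>R Q x))" for x
    by (intro continuous_intros continuous_on_compose2[OF Suc.prems(1)] continuous_on_compose2[OF
        smooth_continuous[OF Suc.prems(2), of UNIV]]) auto
  show ?case
  proof (rule cont_diff_SucI)
    fix x
    have L: "((\<lambda>x. integral (cbox 0 1) (\<lambda>t. p t *\<^sub>R f (P x + t *\<^sub>R Q x))) has_derivative integral
        (cbox 0 1) (fx x)) (at x within UNIV)"
    proof (rule leibniz_rule[OF _ _ contfx])
      fix x t
      have "((\<lambda>x. P x + t *\<^sub>R Q x) has_derivative (\<lambda>h. P h + t *\<^sub>R Q h)) (at x)"
        by (intro has_derivative_add has_derivative_scaleR_right linear_imp_has_derivative P Q)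
      then have "(f \<circ> (\<lambda>x. P x + t *\<^sub>R Q x) has_derivative ?D (P x + t *\<^sub>R Q x) \<circ> (\<lambda>h. P h + t *\<^sub>R Q
          h)) (at x)"
        by (rule diff_chain_at) (rule smooth_has_derivative[OF Suc.prems(2)])
      then show "((\<lambda>x. p t *\<^sub>R f (P x + t *\<^sub>R Q x)) has_derivative blinfun_apply (fx x t)) (at x
          within UNIV)"
        unfolding fx by (auto simp: o_def intro: has_derivative_scaleR_right)
    next
      show "(\<lambda>t. p t *\<^sub>R f (P x + t *\<^sub>R Q x)) integrable_on cbox 0 1" for x
        by (rule integrable_continuous[OF contx])
    qed auto
    show "((\<lambda>x. integral {0..1} (\<lambda>t. p t *\<^sub>R f (P x + t *\<^sub>R Q x))) has_derivative ?G x) (at x)"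
    proof (rule has_derivative_eq_rhs[OF L[unfolded box_real(2)]])
      have "continuous_on (cbox 0 1) (fx x)"
        using continuous_on_compose2[OF contfx, of "cbox 0 1" "\<lambda>t. (x, t)"]
        by (auto simp: continuous_on_Pair continuous_on_const continuous_on_id image_subset_iff)
      then have "fx x integrable_on cbox 0 1"
        by (rule integrable_continuous)
      then show "blinfun_apply (integral {0..1} (fx x)) = ?G x"
        by (simp add: fun_eq_iff blinfun_apply_integral fx)
    qed
  next
    fix h
    have "?G x h = integral {0..1} (\<lambda>t. p t *\<^sub>R ?D (P x + t *\<^sub>R Q x) (P h))
        + integral {0..1} (\<lambda>t. (p t * t) *\<^sub>R ?D (P x + t *\<^sub>R Q x) (Q h))" for x
    proof (subst integral_add[symmetric])
      show "(\<lambda>t. p t *\<^sub>R ?D (P x + t *\<^sub>R Q x) (P h)) integrable_on {0..1}"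
        "(\<lambda>t. (p t * t) *\<^sub>R ?D (P x + t *\<^sub>R Q x) (Q h)) integrable_on {0..1}"
        by (rule integrable_continuous_interval,
          intro continuous_intros continuous_on_compose2[OF Suc.prems(1)] contD, auto)+
    qed (simp add: exp scaleR_add_right)
    moreover have "cont_diff k (\<lambda>x. integral {0..1} (\<lambda>t. p t *\<^sub>R ?D (P x + t *\<^sub>R Q x) (P h)))"
      by (rule Suc.IH) (use Suc.prems smooth_frechet_derivative in auto)
    moreover have "cont_diff k (\<lambda>x. integral {0..1} (\<lambda>t. (p t * t) *\<^sub>R ?D (P x + t *\<^sub>R Q x) (Q h)))"
      by (rule Suc.IH) (use Suc.prems smooth_frechet_derivative in \<open>auto intro!: continuous_intros\<close>)
    ultimately show "cont_diff k (\<lambda>x. ?G x h)"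
      by (simp add: cont_diff_add)
  qed
qed

lemma smooth_integral_segment:
  fixes f :: "'v::euclidean_space \<Rightarrow> 'b::euclidean_space" and P Q :: "'v \<Rightarrow> 'v"
  assumes "linear P" "linear Q" "continuous_on {0..1} p" "smooth f"
  shows "smooth (\<lambda>x. integral {0..1} (\<lambda>t. p t *\<^sub>R f (P x + t *\<^sub>R Q x)))"
  unfolding smooth_def using cont_diff_integral_segment[OF assms] by blast

section \<open>Alternating forms\<close>

lemma contract_zero [simp]: "contract v 0 = 0"
  and contract_add: "contract v (\<phi> + \<psi>) = contract v \<phi> + contract v \<psi>"
  and contract_scaleR: "contract v (r *\<^sub>R \<phi>) = r *\<^sub>R contract v \<phi>"
  and contract_diff: "contract v (\<phi> - \<psi>) = contract v \<phi> - contract v \<psi>"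
  for \<phi> \<psi> :: "'v list \<Rightarrow> 'u::real_vector"
  by (simp_all add: contract_def fun_eq_iff)

lemma contract_zero_fun [simp]: "contract v (\<lambda>vs. 0) = (\<lambda>vs. 0)"
  by (simp add: contract_def)

lemma contract_sum: "contract v (\<Sum>i\<in>I. f i) = (\<Sum>i\<in>I. contract v (f i))"
  by (simp add: contract_def fun_eq_iff sum_fun_apply)

text \<open>The identities between forms below are proved by the induction that this rule provides, since all
  operations have simple commutation rules with contractions.\<close>

lemma form_eqI:
  assumes "\<phi> [] = \<psi> []" "\<And>v. contract v \<phi> = contract v \<psi>"
  shows "\<phi> = \<psi>"
proof
  fix vs
  show "\<phi> vs = \<psi> vs"
    by (cases vs) (use assms in \<open>auto simp: contract_def fun_eq_iff\<close>)
qed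

text \<open>The sign rules for wedge products depend on a form only through its degree, which is
  isolated here.\<close>

definition form_degree :: "nat \<Rightarrow> ('v list \<Rightarrow> 'u::zero) \<Rightarrow> bool"
  where "form_degree k \<phi> \<longleftrightarrow> (\<forall>vs. length vs \<noteq> k \<longrightarrow> \<phi> vs = 0)"

lemma alt_forms_degree: "\<phi> \<in> alt_forms k \<Longrightarrow> form_degree k \<phi>"
  by (simp add: alt_forms_def form_degree_def)

lemma form_degree_contract: "form_degree k \<phi> \<Longrightarrow> form_degree (k - 1) (contract v \<phi>)"
  by (auto simp: form_degree_def contract_def)

lemma contract_0_form: "form_degree 0 \<phi> \<Longrightarrow> contract v \<phi> = 0"
  by (auto simp: form_degree_def contract_def)

lemma form_degree_inner:
  fixes \<phi> :: "'v list \<Rightarrow> 'u::real_inner"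
  shows "form_degree k \<phi> \<Longrightarrow> form_degree k (\<lambda>vs. \<phi> vs \<bullet> b)"
  by (auto simp: form_degree_def)

lemma contract_inner: "contract v (\<lambda>vs. \<phi> vs \<bullet> b) = (\<lambda>vs. contract v \<phi> vs \<bullet> b)"
  by (simp add: contract_def)

lemma subspace_alt_forms: "subspace (alt_forms k)"
proof (rule subspaceI)
  fix \<phi> \<psi> :: "'a list \<Rightarrow> 'b" and r :: real
  show "\<phi> + \<psi> \<in> alt_forms k" if "\<phi> \<in> alt_forms k" "\<psi> \<in> alt_forms k"
    using that unfolding alt_forms_def by (auto intro!: linear_compose_add)
  show "r *\<^sub>R \<phi> \<in> alt_forms k" if "\<phi> \<in> alt_forms k"
    using that unfolding alt_forms_def by (auto intro!: linear_compose_scale_right)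
qed (auto simp: alt_forms_def linear_zero)

lemma alt_forms_contract:
  assumes "\<phi> \<in> alt_forms (Suc k)"
  shows "contract v \<phi> \<in> alt_forms k"
proof -
  have "linear (\<lambda>u. \<phi> (v # vs[i := u]))" if "length vs = k" "i < k" for vs i
  proof -
    have "linear (\<lambda>u. \<phi> ((v # vs)[Suc i := u]))"
      using assms that unfolding alt_forms_def by (force simp del: list_update_code list_update.simps)
    then show ?thesis by simp
  qed
  moreover have "\<phi> (v # vs) = 0" if "length vs = k" "i < j" "j < k" "vs ! i = vs ! j" for vs i j
  proof -
    have "length (v # vs) = Suc k \<and> Suc i < Suc j \<and> Suc j < Suc k \<and> (v # vs) ! Suc i = (v # vs) ! Suc j"
      using that by simp
    then show ?thesis
      using assms unfolding alt_forms_def by blast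
  qed
  ultimately show ?thesis
    using assms unfolding alt_forms_def contract_def by auto
qed

text \<open>Truncated subtraction is harmless at \<open>k = 0\<close>, where the contraction is the
  zero form.\<close>

lemma alt_forms_contract_pred: "\<phi> \<in> alt_forms k \<Longrightarrow> contract v \<phi> \<in> alt_forms (k - 1)"
  by (cases k) (auto simp: alt_forms_contract contract_0_form alt_forms_degree
      subspace_0[OF subspace_alt_forms])

lemma contract_contract_self:
  assumes "\<phi> \<in> alt_forms k"
  shows "contract v (contract v \<phi>) = 0"
proof
  fix vs
  show "contract v (contract v \<phi>) vs = 0 vs"
  proof (cases "length (v # v # vs) = k")
    case True
    then have "length (v # v # vs) = k \<and> (0::nat) < 1 \<and> 1 < k \<and> (v # v # vs) ! 0 = (v # v # vs) ! 1"
      by auto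
    then show ?thesis
      using assms unfolding alt_forms_def contract_def zero_fun_apply by blast
  next
    case False
    then show ?thesis
      using alt_forms_degree[OF assms] by (auto simp: form_degree_def contract_def)
  qed
qed

lemma contract_linear:
  assumes "\<phi> \<in> alt_forms k"
  shows "linear (\<lambda>v. contract v \<phi>)"
proof -
  interpret l: linear "\<lambda>v. \<phi> (v # vs)" for vs by (rule linear_contract[OF assms])
  show ?thesis
    by (rule linearI) (simp_all add: contract_def fun_eq_iff l.add l.scale)
qed

text \<open>Polarisation of \<open>contract_contract_self\<close> at \<open>u + v\<close>.\<close>

lemma contract_contract_anticomm:
  assumes "\<phi> \<in> alt_forms k"
  shows "contract u (contract v \<phi>) = - contract v (contract u \<phi>)"
proof -
  interpret l: linear "\<lambda>v. contract v \<phi>" by (rule contract_linear[OF assms])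
  have "contract (u + v) (contract (u + v) \<phi>) = 0"
    by (rule contract_contract_self[OF assms])
  moreover have "contract (u + v) (contract (u + v) \<phi>) = contract u (contract u \<phi>) + contract v
      (contract u \<phi>)
     + (contract u (contract v \<phi>) + contract v (contract v \<phi>))"
  proof -
    have "contract (u + v) (contract w \<phi>) = contract u (contract w \<phi>) + contract v (contract w \<phi>)" for w
      using linear_add[OF contract_linear[OF alt_forms_contract_pred[OF assms]]] .
    then show ?thesis by (simp add: l.add contract_add)
  qed
  ultimately show ?thesis
    by (simp add: contract_contract_self[OF assms] add_eq_0_iff)
qed

lemma contract_basis_sum:
  fixes \<phi> :: "'v::euclidean_space list \<Rightarrow> 'u::real_vector"
  assumes "\<phi> \<in> alt_forms k"
  shows "(\<Sum>b\<in>Basis. (v \<bullet> b) *\<^sub>R contract b \<phi>) = contract v \<phi>"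
proof -
  interpret l: linear "\<lambda>v. contract v \<phi>" by (rule contract_linear[OF assms])
  have "contract v \<phi> = contract (\<Sum>b\<in>Basis. (v \<bullet> b) *\<^sub>R b) \<phi>"
    by (simp add: euclidean_representation)
  then show ?thesis by (simp only: l.sum l.scale)
qed

text \<open>Makes alternation accessible to induction on the degree. A repetition at positions i < j
  is seen by the contraction with the first argument if i > 0 and by \<open>self\<close> if the
  positions are 0 and 1; otherwise exchanging the first two arguments reduces it to the case i >
  0.\<close>

lemma alt_forms_SucI:
  assumes nil: "\<phi> [] = 0"
    and con: "\<And>v. contract v \<phi> \<in> alt_forms k"
    and lin: "linear (\<lambda>v. contract v \<phi>)"
    and self: "\<And>v. contract v (contract v \<phi>) = 0"
  shows "\<phi> \<in> alt_forms (Suc k)"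
proof -
  interpret l: linear "\<lambda>v. contract v \<phi>" by fact
  have swap: "\<phi> (u # v # vs) = - \<phi> (v # u # vs)" for u v vs
  proof -
    have "contract (u + v) (contract (u + v) \<phi>) = 0"
      by (rule self)
    moreover have "contract (u + v) (contract (u + v) \<phi>) = contract u (contract u \<phi>) + contract v
        (contract u \<phi>)
       + (contract u (contract v \<phi>) + contract v (contract v \<phi>))"
    proof -
      have "contract (u + v) (contract w \<phi>) = contract u (contract w \<phi>) + contract v (contract w \<phi>)"
          for w
        using linear_add[OF contract_linear[OF con]] .
      then show ?thesis by (simp add: l.add contract_add)
    qed
    ultimately have "contract v (contract u \<phi>) + contract u (contract v \<phi>) = 0"
      by (simp add: self)
    then have "\<phi> (u # v # vs) + \<phi> (v # u # vs) = 0"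
      by (simp add: contract_def fun_eq_iff)
    then show ?thesis by (simp add: eq_neg_iff_add_eq_0)
  qed
  have "\<phi> vs = 0" if "length vs \<noteq> Suc k" for vs
    using nil con that by (cases vs) (force simp: alt_forms_def contract_def)+
  moreover have "linear (\<lambda>v. \<phi> (vs[i := v]))" if "length vs = Suc k" "i < Suc k" for vs i
  proof (cases vs)
    case (Cons a us)
    show ?thesis
    proof (cases i)
      case 0
      show ?thesis
        unfolding 0 Cons list_update.simps nat.case
        by (rule linearI) (use l.add l.scale in \<open>simp_all add: contract_def fun_eq_iff\<close>)
    next
      case (Suc i')
      then show ?thesis
        using con[of a] that by (simp add: Cons alt_forms_def contract_def)
    qed
  qed (use that in simp)
  moreover have "\<phi> vs = 0" if vs: "length vs = Suc k" "i < j" "j < Suc k" "vs ! i = vs ! j" for vs i j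
  proof (cases i)
    case (Suc i')
    then obtain a us j' where "vs = a # us" "j = Suc j'"
      using vs by (cases vs; cases j) auto
    then show ?thesis
      using con[of a] vs Suc unfolding alt_forms_def contract_def by force
  next
    case 0
    then obtain a us where us: "vs = a # us" "j \<noteq> 0" using vs by (cases vs) auto
    then obtain b ws where ws: "vs = a # b # ws" using vs by (cases us) auto
    show ?thesis
    proof (cases "j = 1")
      case True
      then show ?thesis
        using self[of a] vs 0 ws by (simp add: contract_def fun_eq_iff)
    next
      case False
      then obtain j' where j': "j = Suc (Suc j')"
        using us by (metis One_nat_def not0_implies_Suc)
      have "(a # ws) ! 0 = (a # ws) ! Suc j'" "length (a # ws) = k" "Suc j' < k"
        using vs 0 ws j' by auto
      then have "contract b \<phi> (a # ws) = 0"
        using con[of b] unfolding alt_forms_def by blast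
      then show ?thesis
        using swap[of a b ws] ws by (simp add: contract_def)
    qed
  qed
  ultimately show ?thesis
    unfolding alt_forms_def by blast
qed

lemma alt_forms_0_iff: "\<phi> \<in> alt_forms 0 \<longleftrightarrow> form_degree 0 \<phi>"
  by (auto simp: alt_forms_def form_degree_def)

lemma alt_forms_0I: "(\<And>v vs. \<phi> (v # vs) = 0) \<Longrightarrow> \<phi> \<in> alt_forms 0"
  by (auto simp: alt_forms_0_iff form_degree_def neq_Nil_conv)

lemma alt_form_eq_0I:
  fixes \<phi> :: "'v::euclidean_space list \<Rightarrow> 'u::real_vector"
  assumes "\<phi> \<in> alt_forms k" "\<And>bs. set bs \<subseteq> Basis \<Longrightarrow> length bs = k \<Longrightarrow> \<phi> bs = 0"
  shows "\<phi> = 0"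
  using assms
proof (induction k arbitrary: \<phi>)
  case 0
  show ?case
  proof
    fix vs show "\<phi> vs = 0 vs"
      using 0(1) 0(2)[of "[]"] by (cases vs) (auto simp: alt_forms_0_iff form_degree_def)
  qed
next
  case (Suc k)
  have "contract b \<phi> = 0" if "b \<in> Basis" for b
    by (rule Suc.IH[OF alt_forms_contract[OF Suc.prems(1)]]) (use Suc.prems(2) that in \<open>simp add:
        contract_def\<close>)
  then have con: "contract v \<phi> = 0" for v
    using contract_basis_sum[OF Suc.prems(1), of v] by simp
  show ?case
  proof (rule form_eqI)
    show "\<phi> [] = 0 []"
      using alt_forms_degree[OF Suc.prems(1)] by (simp add: form_degree_def)
  qed (simp add: con func_zero)
qed

text \<open>Pigeonhole: a list of more than \<open>DIM('v)\<close> basis vectors repeats one of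
  them. This is what makes the complex end at the dimension.\<close>

lemma alt_forms_above_dim:
  fixes \<phi> :: "'v::euclidean_space list \<Rightarrow> 'u::real_vector"
  assumes "\<phi> \<in> alt_forms k" "DIM('v) < k"
  shows "\<phi> = 0"
proof (rule alt_form_eq_0I[OF assms(1)])
  fix bs :: "'v list"
  assume bs: "set bs \<subseteq> Basis" "length bs = k"
  have "card (set bs) \<le> DIM('v)"
    by (rule card_mono) (use bs in auto)
  then have "\<not> distinct bs"
    using assms bs distinct_card by fastforce
  then obtain i j where "i < j" "j < length bs" "bs ! i = bs ! j"
    unfolding distinct_conv_nth by (metis nat_neq_iff)
  then show "\<phi> bs = 0"
    using assms bs unfolding alt_forms_def by blast
qed

section \<open>Wedge products\<close>

lemma wedge_zero_left [simp]: "wedge 0 \<psi> = 0"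
  and wedge_zero_right [simp]: "wedge \<phi> 0 = 0"
  and wedge_add_left: "wedge (\<phi> + \<phi>') \<psi> = wedge \<phi> \<psi> + wedge \<phi>' \<psi>"
  and wedge_add_right: "wedge \<phi> (\<psi> + \<psi>') = wedge \<phi> \<psi> + wedge \<phi> \<psi>'"
  and wedge_scaleR_left: "wedge (r *\<^sub>R \<phi>) \<psi> = r *\<^sub>R wedge \<phi> \<psi>"
  and wedge_scaleR_right: "wedge \<phi> (r *\<^sub>R \<psi>) = r *\<^sub>R wedge \<phi> \<psi>"
  by (simp_all add: wedge_def fun_eq_iff scaleR_left_distrib scaleR_right_distrib sum.distrib
      scaleR_sum_right mult_ac distrib_left)

lemma wedge_uminus_right: "wedge \<phi> (- \<psi>) = - wedge \<phi> \<psi>"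
  using wedge_scaleR_right[of \<phi> "-1" \<psi>] by simp

lemma wedge_sum_left:
  fixes f :: "'i \<Rightarrow> 'v list \<Rightarrow> real" and \<psi> :: "'v list \<Rightarrow> 'u::real_vector"
  shows "wedge (\<Sum>i\<in>I. f i) \<psi> = (\<Sum>i\<in>I. wedge (f i) \<psi>)"
proof -
  interpret linear "\<lambda>\<phi>. wedge \<phi> \<psi>"
    by (rule linearI) (simp_all add: wedge_add_left wedge_scaleR_left)
  show ?thesis by (rule sum)
qed

lemma wedge_sum_right:
  fixes \<phi> :: "'v list \<Rightarrow> real" and f :: "'i \<Rightarrow> 'v list \<Rightarrow> 'u::real_vector"
  shows "wedge \<phi> (\<Sum>i\<in>I. f i) = (\<Sum>i\<in>I. wedge \<phi> (f i))"
proof -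
  interpret linear "\<lambda>\<psi>. wedge \<phi> \<psi>"
    by (rule linearI) (simp_all add: wedge_add_right wedge_scaleR_right)
  show ?thesis by (rule sum)
qed

lemma wedge_Nil: "wedge \<phi> \<psi> [] = \<phi> [] *\<^sub>R \<psi> []"
  by (simp add: wedge_def shuffle_sign_def)

lemma length_nths_complement:
  assumes "S \<subseteq> {..<length vs}"
  shows "length (nths vs S) = card S" and "length (nths vs ({..<length vs} - S)) = length vs - card S"
proof -
  have "{i. i < length vs \<and> i \<in> S} = S" "{i. i < length vs \<and> i \<in> {..<length vs} - S} = {..<length
      vs} - S"
    using assms by auto
  then show "length (nths vs S) = card S" "length (nths vs ({..<length vs} - S)) = length vs - card S"
    using assms finite_subset[OF assms] by (simp_all add: length_nths card_Diff_subset)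
qed

lemma form_degree_wedge:
  assumes "form_degree k \<phi>" "form_degree l \<psi>"
  shows "form_degree (k + l) (wedge \<phi> \<psi>)"
  unfolding form_degree_def wedge_def
proof (intro allI impI sum.neutral ballI)
  fix vs :: "'a list" and S
  assume *: "length vs \<noteq> k + l" "S \<in> Pow {..<length vs}"
  then have "card S \<le> length vs"
    using card_mono[of "{..<length vs}" S] by auto
  then have "length (nths vs S) \<noteq> k \<or> length (nths vs ({..<length vs} - S)) \<noteq> l"
    using * length_nths_complement[of S vs] by auto
  then show "(shuffle_sign (length vs) S * \<phi> (nths vs S)) *\<^sub>R \<psi> (nths vs ({..<length vs} - S)) = 0"
    using assms by (auto simp: form_degree_def)
qed

lemma shuffle_sign_insert_0:
  assumes "T \<subseteq> {..<n}"
  shows "shuffle_sign (Suc n) (insert 0 (Suc ` T)) = shuffle_sign n T"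
proof -
  have "{(i, j). i \<in> insert 0 (Suc ` T) \<and> j \<in> {..<Suc n} - insert 0 (Suc ` T) \<and> j < i}
     = map_prod Suc Suc ` {(i, j). i \<in> T \<and> j \<in> {..<n} - T \<and> j < i}"
    by (auto simp: image_iff less_Suc_eq_0_disj)
  then show ?thesis
    unfolding shuffle_sign_def by (simp add: card_image inj_on_def)
qed

text \<open>Position 0 belongs to the second factor and precedes every position of the first, so
  each of the \<open>card T\<close> shifted positions acquires one more inversion.\<close>

lemma shuffle_sign_Suc_image:
  assumes "T \<subseteq> {..<n}"
  shows "shuffle_sign (Suc n) (Suc ` T) = (-1) ^ card T * shuffle_sign n T"
proof -
  have fin: "finite T" using assms finite_subset by blast
  have "finite {(i, j). i \<in> T \<and> j \<in> {..<n} - T \<and> j < i}"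
    by (rule finite_subset[of _ "T \<times> {..<n}"]) (use fin in auto)
  moreover have "{(i, j). i \<in> Suc ` T \<and> j \<in> {..<Suc n} - Suc ` T \<and> j < i}
     = map_prod Suc Suc ` {(i, j). i \<in> T \<and> j \<in> {..<n} - T \<and> j < i} \<union> (\<lambda>i. (Suc i, 0)) ` T"
    by (auto simp: image_iff less_Suc_eq_0_disj)
  ultimately have "card {(i, j). i \<in> Suc ` T \<and> j \<in> {..<Suc n} - Suc ` T \<and> j < i}
     = card {(i, j). i \<in> T \<and> j \<in> {..<n} - T \<and> j < i} + card T"
    using fin by (subst \<open>_ = _ \<union> _\<close>, subst card_Un_disjoint) (auto simp: card_image inj_on_def)
  then show ?thesis
    unfolding shuffle_sign_def by (simp add: power_add)
qed

lemma Pow_lessThan_Suc: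
  "Pow {..<Suc n} = (\<lambda>T. insert 0 (Suc ` T)) ` Pow {..<n} \<union> (\<lambda>T. Suc ` T) ` Pow {..<n}"
proof -
  have "{..<Suc n} = insert 0 (Suc ` {..<n})"
    by (rule lessThan_Suc_eq_insert_0)
  then show ?thesis
    by (simp only: Pow_insert image_Pow_surj[OF refl, symmetric] image_image Un_commute)
qed

text \<open>Splitting shuffles by whether the first argument goes to the first factor.\<close>

lemma contract_wedge:
  assumes "form_degree k \<phi>"
  shows "contract v (wedge \<phi> \<psi>) = wedge (contract v \<phi>) \<psi> + (-1) ^ k *\<^sub>R wedge \<phi> (contract v \<psi>)"
proof
  fix vs :: "'a list"
  let ?n = "length vs"
  let ?f = "\<lambda>S. (shuffle_sign (Suc ?n) S * \<phi> (nths (v # vs) S)) *\<^sub>R \<psi> (nths (v # vs) ({..<Suc ?n} - S))"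
  have inj0: "inj_on (\<lambda>T. insert 0 (Suc ` T)) (Pow {..<?n})"
    by (rule inj_onI) (metis Diff_insert_absorb image_iff inj_Suc inj_image_eq_iff nat.distinct(1))
  have inj1: "inj_on (\<lambda>T. Suc ` T) (Pow {..<?n})"
    by (rule inj_onI) (metis inj_Suc inj_image_eq_iff)
  have "contract v (wedge \<phi> \<psi>) vs = (\<Sum>S\<in>Pow {..<Suc ?n}. ?f S)"
    by (simp add: contract_def wedge_def)
  also have "\<dots> = (\<Sum>T\<in>Pow {..<?n}. ?f (insert 0 (Suc ` T))) + (\<Sum>T\<in>Pow {..<?n}. ?f (Suc ` T))"
    unfolding Pow_lessThan_Suc
    by (subst sum.union_disjoint) (auto simp: sum.reindex[OF inj0] sum.reindex[OF inj1])
  also have "(\<Sum>T\<in>Pow {..<?n}. ?f (insert 0 (Suc ` T))) = wedge (contract v \<phi>) \<psi> vs"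
    unfolding wedge_def
  proof (rule sum.cong)
    fix T assume "T \<in> Pow {..<?n}"
    moreover have "{j. Suc j < Suc ?n \<and> Suc j \<notin> insert 0 (Suc ` T)} = {..<?n} - T" by auto
    ultimately show "?f (insert 0 (Suc ` T)) = (shuffle_sign ?n T * contract v \<phi> (nths vs T)) *\<^sub>R \<psi>
        (nths vs ({..<?n} - T))"
      by (simp add: nths_Cons shuffle_sign_insert_0 contract_def image_iff)
  qed simp
  also have "(\<Sum>T\<in>Pow {..<?n}. ?f (Suc ` T)) = (-1) ^ k *\<^sub>R wedge \<phi> (contract v \<psi>) vs"
    unfolding wedge_def scaleR_sum_right
  proof (rule sum.cong)
    fix T assume T: "T \<in> Pow {..<?n}"
    have eq: "{j. Suc j < Suc ?n \<and> Suc j \<notin> Suc ` T} = {..<?n} - T" by auto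
    \<comment> \<open>The sign depends on \<open>card T\<close>, but only sets with
      \<open>card T = k\<close> contribute, as \<phi> vanishes on lists of other lengths.\<close>
    have "(-1) ^ card T * \<phi> (nths vs T) = (-1) ^ k * \<phi> (nths vs T)"
      using assms length_nths_complement(1)[of T vs] T
      by (cases "card T = k") (auto simp: form_degree_def)
    with eq T show "?f (Suc ` T) = (-1) ^ k *\<^sub>R ((shuffle_sign ?n T * \<phi> (nths vs T)) *\<^sub>R contract v
        \<psi> (nths vs ({..<?n} - T)))"
      by (simp add: nths_Cons shuffle_sign_Suc_image contract_def image_iff mult_ac)
  qed simp
  finally show "contract v (wedge \<phi> \<psi>) vs = (wedge (contract v \<phi>) \<psi> + (-1) ^ k *\<^sub>R wedge \<phi> (contract
      v \<psi>)) vs"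
    by simp
qed

text \<open>Contraction is an antiderivation, so an induction over the argument list with arbitrary
  factors replaces the bookkeeping of shuffles of three blocks.\<close>

lemma wedge_assoc:
  assumes "form_degree k \<phi>" "form_degree l \<psi>"
  shows "wedge (wedge \<phi> \<psi>) \<omega> = wedge \<phi> (wedge \<psi> \<omega>)"
proof
  fix vs
  show "wedge (wedge \<phi> \<psi>) \<omega> vs = wedge \<phi> (wedge \<psi> \<omega>) vs"
    using assms
  proof (induction vs arbitrary: \<phi> \<psi> \<omega> k l)
    case Nil
    then show ?case by (simp add: wedge_Nil)
  next
    case (Cons v vs)
    note d = Cons.prems form_degree_contract[OF Cons.prems(1), of v] form_degree_contract[OF
        Cons.prems(2), of v]
    have "contract v (wedge (wedge \<phi> \<psi>) \<omega>) vs = contract v (wedge \<phi> (wedge \<psi> \<omega>)) vs"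
      by (simp add: contract_wedge[OF d(1)] contract_wedge[OF d(2)]
        contract_wedge[OF form_degree_wedge[OF d(1,2)]] wedge_add_left wedge_add_right
        wedge_scaleR_left wedge_scaleR_right Cons.IH[OF d(1,2)] Cons.IH[OF d(1,4)] Cons.IH[OF d(3,2)]
        power_add algebra_simps)
    then show ?case by (simp add: contract_def)
  qed
qed

lemma wedge_commute:
  fixes \<phi> \<psi> :: "'v list \<Rightarrow> real"
  assumes "form_degree k \<phi>" "form_degree l \<psi>"
  shows "wedge \<phi> \<psi> = (-1) ^ (k * l) *\<^sub>R wedge \<psi> \<phi>"
proof
  fix vs
  show "wedge \<phi> \<psi> vs = ((-1) ^ (k * l) *\<^sub>R wedge \<psi> \<phi>) vs"
    using assms
  proof (induction vs arbitrary: \<phi> \<psi> k l)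
    case Nil
    then show ?case
      by (cases k; cases l) (auto simp add: wedge_Nil form_degree_def)
  next
    case (Cons v vs)
    note d = Cons.prems form_degree_contract[OF Cons.prems(1), of v] form_degree_contract[OF
        Cons.prems(2), of v]
    \<comment> \<open>The degree \<open>k - 1\<close> of the contraction is truncated for
      \<open>k = 0\<close>; the contracted form is zero in that case.\<close>
    have 1: "wedge (contract v \<phi>) \<psi> vs = (-1) ^ (k * l + l) * wedge \<psi> (contract v \<phi>) vs"
    proof (cases k)
      case 0
      then show ?thesis using contract_0_form[of \<phi> v] d(1) by simp
    next
      case (Suc k')
      then show ?thesis using Cons.IH[OF d(3,2)] by (simp add: power_add flip: power_mult_distrib)
    qed
    have 2: "wedge \<phi> (contract v \<psi>) vs = (-1) ^ (k * l + k) * wedge (contract v \<psi>) \<phi> vs"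
    proof (cases l)
      case 0
      then show ?thesis using contract_0_form[of \<psi> v] d(2) by simp
    next
      case (Suc l')
      then show ?thesis using Cons.IH[OF d(1,4)] by (simp add: power_add flip: power_mult_distrib)
    qed
    have "contract v (wedge \<phi> \<psi>) vs = contract v ((-1) ^ (k * l) *\<^sub>R wedge \<psi> \<phi>) vs"
      by (simp add: contract_wedge[OF d(1)] contract_wedge[OF d(2)] contract_scaleR 1 2 power_add
          algebra_simps
         flip: power_mult_distrib)
    then show ?case by (simp add: contract_def)
  qed
qed

lemma wedge_left_commute:
  assumes "form_degree k \<phi>" "form_degree l \<psi>"
  shows "wedge \<phi> (wedge \<psi> \<omega>) = (-1) ^ (k * l) *\<^sub>R wedge \<psi> (wedge \<phi> \<omega>)"
  using wedge_assoc[OF assms, of \<omega>] wedge_assoc[OF assms(2,1), of \<omega>] wedge_commute[OF assms]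
  by (simp add: wedge_scaleR_left)

text \<open>Induction on the total degree through \<open>alt_forms_SucI\<close>, since contracting
  either factor lowers it by one. In the double contraction the two mixed terms cancel: one carries
  the sign for degree k, the other that for degree k - 1.\<close>

lemma wedge_alt_forms:
  assumes "\<phi> \<in> alt_forms k" "\<psi> \<in> alt_forms l"
  shows "wedge \<phi> \<psi> \<in> alt_forms (k + l)"
  using assms
proof (induction "k + l" arbitrary: k l \<phi> \<psi>)
  case 0
  then show ?case
    using form_degree_wedge[of 0 \<phi> 0 \<psi>] by (simp add: alt_forms_0_iff)
next
  case (Suc n)
  note d = Suc.prems[THEN alt_forms_degree]
  note cw = contract_wedge[OF d(1)]
  have cc: "contract v \<phi> \<in> alt_forms (k - 1)" "contract v \<psi> \<in> alt_forms (l - 1)" for v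
    using Suc.prems by (blast intro: alt_forms_contract_pred)+
  have "wedge \<phi> \<psi> \<in> alt_forms (Suc n)"
  proof (rule alt_forms_SucI)
    show "wedge \<phi> \<psi> [] = 0"
      using form_degree_wedge[OF d] Suc.hyps(2) unfolding form_degree_def by (metis Zero_not_Suc
          list.size(3))
    have 1: "wedge (contract v \<phi>) \<psi> \<in> alt_forms n" for v
    proof (cases k)
      case 0
      then show ?thesis
        using contract_0_form[of \<phi> v] d(1) by (simp add: subspace_0[OF subspace_alt_forms])
    next
      case (Suc k')
      then show ?thesis
        using Suc.hyps(1)[OF _ cc(1) Suc.prems(2)] \<open>Suc n = k + l\<close> by simp
    qed
    have 2: "wedge \<phi> (contract v \<psi>) \<in> alt_forms n" for v
    proof (cases l)
      case 0
      then show ?thesis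
        using contract_0_form[of \<psi> v] d(2) by (simp add: subspace_0[OF subspace_alt_forms])
    next
      case (Suc l')
      then show ?thesis
        using Suc.hyps(1)[OF _ Suc.prems(1) cc(2)] \<open>Suc n = k + l\<close> by simp
    qed
    show "contract v (wedge \<phi> \<psi>) \<in> alt_forms n" for v
      unfolding cw by (intro subspace_add[OF subspace_alt_forms] subspace_scale[OF
          subspace_alt_forms] 1 2)
    show "linear (\<lambda>v. contract v (wedge \<phi> \<psi>))"
      by (rule linearI) (simp_all add: cw linear_add[OF contract_linear[OF Suc.prems(1)]]
         linear_add[OF contract_linear[OF Suc.prems(2)]] linear_cmul[OF contract_linear[OF
             Suc.prems(1)]]
         linear_cmul[OF contract_linear[OF Suc.prems(2)]] wedge_add_left wedge_add_right
         wedge_scaleR_left wedge_scaleR_right algebra_simps)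
    show "contract v (contract v (wedge \<phi> \<psi>)) = 0" for v
    proof (cases k)
      case 0
      then show ?thesis
        using contract_0_form[of \<phi> v] d(1)
        by (simp add: cw contract_add contract_scaleR contract_contract_self[OF Suc.prems(2)])
    next
      case (Suc k')
      then show ?thesis
        by (simp add: cw contract_add contract_diff contract_scaleR contract_wedge[OF
            form_degree_contract[OF d(1)]]
          contract_contract_self[OF Suc.prems(2)] contract_contract_self[OF Suc.prems(1)])
    qed
  qed
  then show ?case using Suc.hyps(2) by simp
qed

section \<open>The Nijenhuis-Richardson product\<close>

text \<open>The insertion of \<alpha> into \<beta>. The codomain of \<beta> is general because the
  associator is computed through the scalar components, on which insertion is a derivation.\<close>

definition nr_comp :: "('v list \<Rightarrow> 'v) \<Rightarrow> ('v list \<Rightarrow> 'u) \<Rightarrow> 'v::euclidean_space list \<Rightarrow> 'u::real_vector"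
  where "nr_comp \<alpha> \<beta> = (\<Sum>b\<in>Basis. wedge (\<lambda>vs. \<alpha> vs \<bullet> b) (contract b \<beta>))"

lemma form_inner_add: "(\<lambda>vs. (\<phi> + \<psi>) vs \<bullet> b) = (\<lambda>vs. \<phi> vs \<bullet> b) + (\<lambda>vs. \<psi> vs \<bullet> b)"
  and form_inner_scaleR: "(\<lambda>vs. (r *\<^sub>R \<phi>) vs \<bullet> b) = r *\<^sub>R (\<lambda>vs. \<phi> vs \<bullet> b)"
  for \<phi> \<psi> :: "'v list \<Rightarrow> 'u::real_inner"
  by (simp_all add: fun_eq_iff inner_left_distrib)

lemma nr_comp_add_left: "nr_comp (\<alpha> + \<alpha>') \<beta> = nr_comp \<alpha> \<beta> + nr_comp \<alpha>' \<beta>"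
  unfolding nr_comp_def form_inner_add wedge_add_left sum.distrib ..

lemma nr_comp_scaleR_left: "nr_comp (r *\<^sub>R \<alpha>) \<beta> = r *\<^sub>R nr_comp \<alpha> \<beta>"
  unfolding nr_comp_def form_inner_scaleR wedge_scaleR_left scaleR_sum_right ..

lemma nr_comp_add_right: "nr_comp \<alpha> (\<beta> + \<beta>') = nr_comp \<alpha> \<beta> + nr_comp \<alpha> \<beta>'"
  unfolding nr_comp_def contract_add wedge_add_right sum.distrib ..

lemma nr_comp_scaleR_right: "nr_comp \<alpha> (r *\<^sub>R \<beta>) = r *\<^sub>R nr_comp \<alpha> \<beta>"
  unfolding nr_comp_def contract_scaleR wedge_scaleR_right scaleR_sum_right ..

lemma linear_nr_comp_left: "linear (\<lambda>\<alpha>. nr_comp \<alpha> \<beta>)"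
  and linear_nr_comp_right: "linear (nr_comp \<alpha>)"
  by (rule linearI; simp add: nr_comp_add_left nr_comp_add_right nr_comp_scaleR_left
      nr_comp_scaleR_right)+

lemmas nr_comp_diff_left = linear_diff[OF linear_nr_comp_left]
lemmas nr_comp_diff_right = linear_diff[OF linear_nr_comp_right]
lemmas nr_comp_sum_right = linear_sum[OF linear_nr_comp_right]

lemma nr_comp_0_form_right: "form_degree 0 \<beta> \<Longrightarrow> nr_comp \<alpha> \<beta> = 0"
  unfolding nr_comp_def by (simp add: contract_0_form)

lemma alt_forms_inner:
  assumes "\<alpha> \<in> alt_forms k"
  shows "(\<lambda>vs. \<alpha> vs \<bullet> b) \<in> alt_forms k"
proof -
  have "linear (\<lambda>v. g v \<bullet> b)" if "linear g" for g :: "'a \<Rightarrow> 'b"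
    by (rule linearI) (simp_all add: linear_add[OF that] linear_cmul[OF that] inner_left_distrib)
  then show ?thesis
    using assms unfolding alt_forms_def by auto
qed

lemma alt_forms_linear_image:
  assumes "linear L" "\<alpha> \<in> alt_forms k"
  shows "(\<lambda>vs. L (\<alpha> vs)) \<in> alt_forms k"
proof -
  have "linear (\<lambda>v. L (g v))" if "linear g" for g
    using linear_compose[OF that assms(1)] by (simp add: o_def)
  then show ?thesis
    using assms(2) linear_0[OF assms(1)] unfolding alt_forms_def by auto
qed

lemma nr_comp_alt_forms:
  assumes "\<alpha> \<in> alt_forms k" "\<beta> \<in> alt_forms (Suc l)"
  shows "nr_comp \<alpha> \<beta> \<in> alt_forms (k + l)"
  unfolding nr_comp_def
  by (intro subspace_sum[OF subspace_alt_forms] wedge_alt_forms alt_forms_inner alt_forms_contract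
      assms)

text \<open>Passing the component of \<alpha> costs \<open>(-1) ^ k\<close>, and the contractions by
  \<open>v\<close> and by the basis vector anticommute, which gives the minus sign.\<close>

lemma contract_nr_comp:
  assumes "form_degree k \<alpha>" "\<beta> \<in> alt_forms l"
  shows "contract v (nr_comp \<alpha> \<beta>) = nr_comp (contract v \<alpha>) \<beta> - (-1) ^ k *\<^sub>R nr_comp \<alpha> (contract v \<beta>)"
proof -
  have "contract v (nr_comp \<alpha> \<beta>) = (\<Sum>b\<in>Basis. wedge (\<lambda>vs. contract v \<alpha> vs \<bullet> b) (contract b \<beta>)
      + (-1) ^ k *\<^sub>R wedge (\<lambda>vs. \<alpha> vs \<bullet> b) ((-1) *\<^sub>R contract b (contract v \<beta>)))"
    unfolding nr_comp_def contract_sum contract_wedge[OF form_degree_inner[OF assms(1)]] contract_inner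
    using contract_contract_anticomm[OF assms(2), of v] by (auto intro!: sum.cong)
  also have "\<dots> = nr_comp (contract v \<alpha>) \<beta> - (-1) ^ k *\<^sub>R nr_comp \<alpha> (contract v \<beta>)"
    unfolding nr_comp_def wedge_scaleR_right
    by (simp add: sum.distrib scaleR_sum_right sum_subtractf)
  finally show ?thesis .
qed

lemma wedge_0_form_left:
  fixes \<phi> :: "'v list \<Rightarrow> real" and \<psi> :: "'v list \<Rightarrow> 'u::real_vector"
  assumes "form_degree 0 \<phi>"
  shows "wedge \<phi> \<psi> = \<phi> [] *\<^sub>R \<psi>"
proof
  fix vs
  show "wedge \<phi> \<psi> vs = (\<phi> [] *\<^sub>R \<psi>) vs"
  proof (induction vs arbitrary: \<psi>)
    case (Cons v vs)
    have "contract v (wedge \<phi> \<psi>) vs = wedge \<phi> (contract v \<psi>) vs"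
      using contract_wedge[OF assms, of v \<psi>] contract_0_form[OF assms, of v] by simp
    then show ?case using Cons.IH[of "contract v \<psi>"] by (simp add: contract_def)
  qed (simp add: wedge_Nil)
qed

lemma nr_comp_0_form_left:
  fixes \<beta> :: "'v::euclidean_space list \<Rightarrow> 'u::real_vector"
  assumes "form_degree 0 \<alpha>" "\<beta> \<in> alt_forms l"
  shows "nr_comp \<alpha> \<beta> = contract (\<alpha> []) \<beta>"
proof -
  have "nr_comp \<alpha> \<beta> = (\<Sum>b\<in>Basis. (\<alpha> [] \<bullet> b) *\<^sub>R contract b \<beta>)"
    unfolding nr_comp_def by (intro sum.cong) (simp_all add: wedge_0_form_left form_degree_inner
        assms(1))
  then show ?thesis
    by (simp add: contract_basis_sum[OF assms(2)])
qed

section \<open>The associator of the insertion product\<close>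

text \<open>Moving the component of \<alpha> past \<phi> costs \<open>(-1) ^ (k * p)\<close>, moving
  the contraction past it \<open>(-1) ^ p\<close>. The exponent \<open>Suc k * p\<close> has the
  parity of (k - 1) p, as expected of a derivation of degree k - 1, and makes sense for
  \<open>k = 0\<close> as well.\<close>

lemma nr_comp_wedge:
  assumes "form_degree k \<alpha>" "form_degree p \<phi>"
  shows "nr_comp \<alpha> (wedge \<phi> \<psi>) = wedge (nr_comp \<alpha> \<phi>) \<psi> + (-1) ^ (Suc k * p) *\<^sub>R wedge \<phi> (nr_comp \<alpha> \<psi>)"
proof -
  have "wedge (\<lambda>vs. \<alpha> vs \<bullet> b) (contract b (wedge \<phi> \<psi>)) = wedge (wedge (\<lambda>vs. \<alpha> vs \<bullet> b) (contract b \<phi>)) \<psi>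
      + (-1) ^ (Suc k * p) *\<^sub>R wedge \<phi> (wedge (\<lambda>vs. \<alpha> vs \<bullet> b) (contract b \<psi>))" for b
    unfolding contract_wedge[OF assms(2)] wedge_add_right wedge_scaleR_right
      wedge_assoc[OF form_degree_inner[OF assms(1)] form_degree_contract[OF assms(2)]]
      wedge_left_commute[OF form_degree_inner[OF assms(1)] assms(2)]
    by (simp add: power_add mult.commute)
  then show ?thesis
    unfolding nr_comp_def wedge_sum_left wedge_sum_right scaleR_sum_right sum.distrib[symmetric]
    by simp
qed

lemma nr_comp_inner: "(\<lambda>vs. nr_comp \<alpha> \<beta> vs \<bullet> c) = nr_comp \<alpha> (\<lambda>vs. \<beta> vs \<bullet> c)"
  unfolding nr_comp_def wedge_def sum_fun_apply contract_def inner_sum_left inner_scaleR_left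
  by (simp only: real_scaleR_def fun_eq_iff sum_fun_apply simp_thms)

text \<open>The derivation rule applied to each summand of \<open>nr_comp \<beta> \<gamma>\<close>:
  letting \<alpha> act on the components of \<beta> reassembles the composite insertion, and what
  remains is the second-order operator inserting both forms into \<gamma>.\<close>

lemma nr_comp_assoc:
  assumes "form_degree k \<alpha>" "form_degree l \<beta>"
  shows "nr_comp \<alpha> (nr_comp \<beta> \<gamma>) = nr_comp (nr_comp \<alpha> \<beta>) \<gamma> + (-1) ^ (Suc k * l) *\<^sub>R
    (\<Sum>b\<in>Basis. \<Sum>c\<in>Basis. wedge (\<lambda>vs. \<beta> vs \<bullet> b) (wedge (\<lambda>vs. \<alpha> vs \<bullet> c) (contract c (contract b \<gamma>))))"
proof -
  have "nr_comp \<alpha> (nr_comp \<beta> \<gamma>) = (\<Sum>b\<in>Basis. nr_comp \<alpha> (wedge (\<lambda>vs. \<beta> vs \<bullet> b) (contract b \<gamma>)))"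
    unfolding nr_comp_def[of \<beta>] nr_comp_sum_right ..
  also have "\<dots> = (\<Sum>b\<in>Basis. wedge (\<lambda>vs. nr_comp \<alpha> \<beta> vs \<bullet> b) (contract b \<gamma>)
     + (-1) ^ (Suc k * l) *\<^sub>R (\<Sum>c\<in>Basis. wedge (\<lambda>vs. \<beta> vs \<bullet> b) (wedge (\<lambda>vs. \<alpha> vs \<bullet> c) (contract c
         (contract b \<gamma>)))))"
    unfolding nr_comp_wedge[OF assms(1) form_degree_inner[OF assms(2)]] nr_comp_inner
    by (simp only: nr_comp_def[of \<alpha> "contract _ \<gamma>"] wedge_sum_right)
  also have "\<dots> = nr_comp (nr_comp \<alpha> \<beta>) \<gamma> + (-1) ^ (Suc k * l) *\<^sub>R
    (\<Sum>b\<in>Basis. \<Sum>c\<in>Basis. wedge (\<lambda>vs. \<beta> vs \<bullet> b) (wedge (\<lambda>vs. \<alpha> vs \<bullet> c) (contract c (contract b \<gamma>))))"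
    unfolding nr_comp_def[of "nr_comp \<alpha> \<beta>"] sum.distrib scaleR_sum_right ..
  finally show ?thesis .
qed

text \<open>The second-order part in \<open>nr_comp_assoc\<close> is graded symmetric: exchanging
  the component forms costs \<open>(-1) ^ (Suc k * Suc l)\<close> and exchanging the two
  contractions another -1. Form degrees are written as successors because a (k+1)-form has degree -k
  in the grading of the bracket.\<close>

lemma nr_comp_associator_symmetric:
  assumes "form_degree (Suc k) \<alpha>" "form_degree (Suc l) \<beta>" "\<gamma> \<in> alt_forms m"
  shows "nr_comp \<alpha> (nr_comp \<beta> \<gamma>) - nr_comp (nr_comp \<alpha> \<beta>) \<gamma>
    = (-1) ^ (k * l) *\<^sub>R (nr_comp \<beta> (nr_comp \<alpha> \<gamma>) - nr_comp (nr_comp \<beta> \<alpha>) \<gamma>)"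
proof -
  let ?T = "\<lambda>\<alpha> \<beta> b c. wedge (\<lambda>vs. \<beta> vs \<bullet> b) (wedge (\<lambda>vs. \<alpha> vs \<bullet> c) (contract c (contract b \<gamma>)))"
  have "?T \<alpha> \<beta> b c = (-1) ^ (Suc k * Suc l + 1) *\<^sub>R ?T \<beta> \<alpha> c b" for b c
  proof -
    have "?T \<alpha> \<beta> b c = (-1) ^ (Suc l * Suc k) *\<^sub>R
        wedge (\<lambda>vs. \<alpha> vs \<bullet> c) (wedge (\<lambda>vs. \<beta> vs \<bullet> b) (contract c (contract b \<gamma>)))"
      by (rule wedge_left_commute[OF form_degree_inner[OF assms(2)] form_degree_inner[OF assms(1)]])
    moreover have swap: "contract c (contract b \<gamma>) = (-1) *\<^sub>R contract b (contract c \<gamma>)"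
      unfolding contract_contract_anticomm[OF assms(3), of c b] by (rule scaleR_minus1_left[symmetric])
    ultimately have "?T \<alpha> \<beta> b c = ((-1) ^ (Suc l * Suc k) * (-1)) *\<^sub>R ?T \<beta> \<alpha> c b"
      unfolding swap wedge_scaleR_right scaleR_scaleR by simp
    then show ?thesis
      by (simp add: mult.commute)
  qed
  then have "(\<Sum>b\<in>Basis. \<Sum>c\<in>Basis. ?T \<alpha> \<beta> b c) = (-1) ^ (Suc k * Suc l + 1) *\<^sub>R (\<Sum>b\<in>Basis. \<Sum>c\<in>Basis.
      ?T \<beta> \<alpha> c b)"
    by (simp only: scaleR_sum_right)
  also have "(\<Sum>b\<in>Basis. \<Sum>c\<in>Basis. ?T \<beta> \<alpha> c b) = (\<Sum>b\<in>Basis. \<Sum>c\<in>Basis. ?T \<beta> \<alpha> b c)"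
    by (rule sum.swap)
  finally have *: "(\<Sum>b\<in>Basis. \<Sum>c\<in>Basis. ?T \<alpha> \<beta> b c) = (-1) ^ (Suc k * Suc l + 1) *\<^sub>R (\<Sum>b\<in>Basis.
      \<Sum>c\<in>Basis. ?T \<beta> \<alpha> b c)" .
  show ?thesis
    unfolding nr_comp_assoc[OF assms(1,2)] nr_comp_assoc[OF assms(2,1)] * scaleR_scaleR
        add_diff_cancel_left'
    by (rule arg_cong[where f="\<lambda>r. r *\<^sub>R _"]) (simp add: power_add uminus_power_if)
qed

section \<open>Sections of bundles of forms\<close>

text \<open>The coefficients are evaluations, which become smooth functions for a smooth section,
  and the \<open>u i\<close> lie in U. Evaluation on basis lists is injective on U; a linear left
  inverse with range in U sends the standard coordinate vectors to the \<open>u i\<close>, which may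
  be linearly dependent.\<close>

lemma alt_forms_subspace_coordinates:
  fixes U :: "('v::euclidean_space list \<Rightarrow> 'u::euclidean_space) set"
  assumes "subspace U" "U \<subseteq> alt_forms k"
  obtains F and u :: "'v list \<times> 'u \<Rightarrow> 'v list \<Rightarrow> 'u"
  where "finite F" "\<And>i. u i \<in> U" "\<And>\<phi>. \<phi> \<in> U \<Longrightarrow> \<phi> = (\<Sum>i\<in>F. (\<phi> (fst i) \<bullet> snd i) *\<^sub>R u i)"
proof -
  define F :: "('v list \<times> 'u) set" where "F = {bs. set bs \<subseteq> Basis \<and> length bs = k} \<times> Basis"
  define f :: "('v list \<Rightarrow> 'u) \<Rightarrow> 'v list \<times> 'u \<Rightarrow> real"
    where "f \<phi> = (\<lambda>i. if i \<in> F then \<phi> (fst i) \<bullet> snd i else 0)" for \<phi>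
  define \<delta> :: "'v list \<times> 'u \<Rightarrow> 'v list \<times> 'u \<Rightarrow> real" where "\<delta> i = (\<lambda>j. if j = i then 1 else 0)" for i
  have fin: "finite F" unfolding F_def by (simp add: finite_lists_length_eq)
  have lin: "linear f"
    by (rule linearI) (simp_all add: f_def fun_eq_iff inner_left_distrib)
  have "inj_on f U"
  proof (rule inj_onI)
    fix \<phi> \<psi> assume *: "\<phi> \<in> U" "\<psi> \<in> U" "f \<phi> = f \<psi>"
    have "\<phi> - \<psi> = 0"
    proof (rule alt_form_eq_0I)
      show "\<phi> - \<psi> \<in> alt_forms k"
        using * assms by (auto intro: subspace_diff[OF subspace_alt_forms])
      fix bs :: "'v list" assume bs: "set bs \<subseteq> Basis" "length bs = k"
      have "\<phi> bs \<bullet> b = \<psi> bs \<bullet> b" if "b \<in> Basis" for b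
        using fun_cong[OF *(3), of "(bs, b)"] bs that by (simp add: f_def F_def)
      then show "(\<phi> - \<psi>) bs = 0"
        by (simp add: euclidean_eq_iff[of "\<phi> bs"])
    qed
    then show "\<phi> = \<psi>" by simp
  qed
  then obtain g where g: "range g \<subseteq> U" "linear g" "\<And>\<phi>. \<phi> \<in> U \<Longrightarrow> g (f \<phi>) = \<phi>"
    using linear_exists_left_inverse_on[OF lin assms(1)] by blast
  have "\<phi> = (\<Sum>i\<in>F. (\<phi> (fst i) \<bullet> snd i) *\<^sub>R g (\<delta> i))" if "\<phi> \<in> U" for \<phi>
  proof -
    have "f \<phi> = (\<Sum>i\<in>F. (\<phi> (fst i) \<bullet> snd i) *\<^sub>R \<delta> i)"
      using fin by (auto simp: f_def \<delta>_def fun_eq_iff sum_fun_apply if_distrib cong: if_cong)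
    then have "g (f \<phi>) = (\<Sum>i\<in>F. (\<phi> (fst i) \<bullet> snd i) *\<^sub>R g (\<delta> i))"
      by (simp only: linear_sum[OF g(2)] linear_cmul[OF g(2)])
    then show ?thesis using g(3)[OF that] by simp
  qed
  then show thesis
    using that[OF fin, of "\<lambda>i. g (\<delta> i)"] g(1) by blast
qed

lemma alt_forms_subspace_finite_span:
  fixes U :: "('v::euclidean_space list \<Rightarrow> 'u::euclidean_space) set"
  assumes "subspace U" "U \<subseteq> alt_forms k"
  shows "\<exists>B. finite B \<and> span B = U"
proof -
  obtain F and u :: "'v list \<times> 'u \<Rightarrow> 'v list \<Rightarrow> 'u"
    where F: "finite F" "\<And>i. u i \<in> U" "\<And>\<phi>. \<phi> \<in> U \<Longrightarrow> \<phi> = (\<Sum>i\<in>F. (\<phi> (fst i) \<bullet> snd i) *\<^sub>R u i)"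
    using alt_forms_subspace_coordinates[OF assms] by blast
  have "span (u ` F) = U"
  proof
    show "span (u ` F) \<subseteq> U"
      using F(2) assms(1) by (intro span_minimal) auto
    show "U \<subseteq> span (u ` F)"
    proof
      fix \<phi> assume "\<phi> \<in> U"
      then show "\<phi> \<in> span (u ` F)"
        by (subst F(3)) (auto intro!: span_sum span_scale intro: span_base)
    qed
  qed
  then show ?thesis using F(1) by blast
qed

text \<open>The coordinates by evaluations convert the existence of smooth coefficients into a test
  on single values and single argument lists, the form in which all sections below are
  checked.\<close>

lemma smooth_sections_iff:
  fixes U :: "('v::euclidean_space list \<Rightarrow> 'u::euclidean_space) set" and s :: "'w::euclidean_space \<Rightarrow> _"
  assumes "subspace U" "U \<subseteq> alt_forms k"
  shows "s \<in> smooth_sections U \<longleftrightarrow> (\<forall>x. s x \<in> U) \<and> (\<forall>vs. smooth (\<lambda>x. s x vs))"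
proof (intro iffI conjI allI)
  assume "s \<in> smooth_sections U"
  then obtain B c where *: "finite B" "B \<subseteq> U" "\<And>b. b \<in> B \<Longrightarrow> smooth (c b)" "\<And>x. s x = (\<Sum>b\<in>B. c b x *\<^sub>R b)"
    unfolding smooth_sections_def by auto
  show "s x \<in> U" for x
    unfolding *(4) using *(2) by (auto intro!: subspace_sum subspace_scale assms)
  show "smooth (\<lambda>x. s x vs)" for vs
    unfolding *(4) sum_fun_apply scaleR_fun_apply by (intro smooth_sum smooth_scaleR *(3) smooth_const)
next
  assume s: "(\<forall>x. s x \<in> U) \<and> (\<forall>vs. smooth (\<lambda>x. s x vs))"
  obtain F and u :: "'v list \<times> 'u \<Rightarrow> 'v list \<Rightarrow> 'u"
    where F: "finite F" "\<And>i. u i \<in> U" "\<And>\<phi>. \<phi> \<in> U \<Longrightarrow> \<phi> = (\<Sum>i\<in>F. (\<phi> (fst i) \<bullet> snd i) *\<^sub>R u i)"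
    using alt_forms_subspace_coordinates[OF assms] by blast
  \<comment> \<open>Different indices may share the same vector \<open>u i\<close>, so their
    coefficients are collected.\<close>
  define c where "c b x = (\<Sum>i\<in>{i\<in>F. u i = b}. s x (fst i) \<bullet> snd i)" for b x
  have "s x = (\<Sum>b\<in>u ` F. c b x *\<^sub>R b)" for x
  proof -
    have "s x = (\<Sum>i\<in>F. (s x (fst i) \<bullet> snd i) *\<^sub>R u i)"
      using F(3)[of "s x"] s by blast
    also have "\<dots> = (\<Sum>b\<in>u ` F. \<Sum>i\<in>{i\<in>F. u i = b}. (s x (fst i) \<bullet> snd i) *\<^sub>R u i)"
      by (rule sum.image_gen[OF F(1)])
    also have "\<dots> = (\<Sum>b\<in>u ` F. c b x *\<^sub>R b)"
      unfolding c_def scaleR_sum_left by (intro sum.cong) auto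
    finally show ?thesis .
  qed
  moreover have "smooth (c b)" for b
    using s unfolding c_def by (intro smooth_sum smooth_inner_left) auto
  ultimately show "s \<in> smooth_sections U"
    unfolding smooth_sections_def using F(1,2) by blast
qed

lemma smooth_sections_alt_forms_iff:
  fixes \<alpha> :: "'w::euclidean_space \<Rightarrow> 'v::euclidean_space list \<Rightarrow> 'u::euclidean_space"
  shows "\<alpha> \<in> smooth_sections (alt_forms k) \<longleftrightarrow> (\<forall>x. \<alpha> x \<in> alt_forms k) \<and> (\<forall>vs. smooth (\<lambda>x. \<alpha> x vs))"
  by (rule smooth_sections_iff[OF subspace_alt_forms order_refl])

lemma section_alt_forms: "\<alpha> \<in> smooth_sections (alt_forms k) \<Longrightarrow> \<alpha> x \<in> alt_forms k"
  and section_smooth: "\<alpha> \<in> smooth_sections (alt_forms k) \<Longrightarrow> smooth (\<lambda>x. \<alpha> x vs)"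
  and section_degree: "\<alpha> \<in> smooth_sections (alt_forms k) \<Longrightarrow> form_degree k (\<alpha> x)"
  for \<alpha> :: "'w::euclidean_space \<Rightarrow> 'v::euclidean_space list \<Rightarrow> 'u::euclidean_space"
  by (auto simp: smooth_sections_alt_forms_iff alt_forms_degree)

lemma smooth_sections_add:
  fixes U :: "('v::euclidean_space list \<Rightarrow> 'u::euclidean_space) set" and \<alpha> \<beta> :: "'w::euclidean_space \<Rightarrow> _"
  assumes "subspace U" "U \<subseteq> alt_forms k" "\<alpha> \<in> smooth_sections U" "\<beta> \<in> smooth_sections U"
  shows "(\<lambda>x. \<alpha> x + \<beta> x) \<in> smooth_sections U"
  using assms(3,4) by (auto simp: smooth_sections_iff[OF assms(1,2)] subspace_add[OF assms(1)])

lemma smooth_sections_mult: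
  fixes U :: "('v::euclidean_space list \<Rightarrow> 'u::euclidean_space) set" and \<alpha> \<beta> :: "'w::euclidean_space \<Rightarrow> _"
  assumes "subspace U" "U \<subseteq> alt_forms k" "\<alpha> \<in> smooth_sections U" "smooth f"
  shows "(\<lambda>x. f x *\<^sub>R \<alpha> x) \<in> smooth_sections U"
  using assms(3,4) by (auto simp: smooth_sections_iff[OF assms(1,2)] subspace_scale[OF assms(1)])

lemma smooth_sections_diff_scaleR:
  fixes U :: "('v::euclidean_space list \<Rightarrow> 'u::euclidean_space) set" and \<alpha> \<beta> :: "'w::euclidean_space \<Rightarrow> _"
  assumes "subspace U" "U \<subseteq> alt_forms k" "\<alpha> \<in> smooth_sections U" "\<beta> \<in> smooth_sections U"
  shows "(\<lambda>x. \<alpha> x - r *\<^sub>R \<beta> x) \<in> smooth_sections U"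
  using smooth_sections_add[OF assms(1-3) smooth_sections_mult[OF assms(1,2,4), of "\<lambda>x. - r"]] by simp

lemma zero_section: "(\<lambda>x. 0) \<in> smooth_sections U"
  unfolding smooth_sections_def by (auto intro!: exI[of _ "{}"])

section \<open>Derivatives of sections\<close>

text \<open>Taken at each argument list separately, because the space of forms carries no
  norm.\<close>

definition form_deriv ::
    "('w::euclidean_space \<Rightarrow> 'v list \<Rightarrow> 'u) \<Rightarrow> 'w \<Rightarrow> 'w \<Rightarrow> 'v list \<Rightarrow> 'u::euclidean_space"
  where "form_deriv \<alpha> x h = (\<lambda>vs. frechet_derivative (\<lambda>y. \<alpha> y vs) (at x) h)"

lemma deriv_along_form_deriv: "deriv_along X \<beta> x = form_deriv \<beta> x (X x)"
  by (simp add: deriv_along_def form_deriv_def)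

lemma frechet_derivative_add:
  "smooth f \<Longrightarrow> smooth g \<Longrightarrow>
    frechet_derivative (\<lambda>y. f y + g y) (at x) h = frechet_derivative f (at x) h + frechet_derivative
        g (at x) h"
  using frechet_derivative_at[OF has_derivative_add[OF smooth_has_derivative smooth_has_derivative],
      of f g x]
  by (simp add: fun_eq_iff)

lemma frechet_derivative_linear_image:
  assumes "bounded_linear L" "smooth f"
  shows "frechet_derivative (\<lambda>y. L (f y)) (at x) h = L (frechet_derivative f (at x) h)"
  using frechet_derivative_at[OF bounded_linear.has_derivative[OF assms(1) smooth_has_derivative[OF
      assms(2)]], of x]
  by (simp add: fun_eq_iff)

text \<open>Below, \<open>T\<close> is a directional derivative at a point or an integral along a segment.\<close>

lemma alt_forms_functional:
  fixes T :: "('w::euclidean_space \<Rightarrow> 'u::euclidean_space) \<Rightarrow> 'u" and \<alpha> :: "'w \<Rightarrow> 'v::euclidean_space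
      list \<Rightarrow> 'u"
  assumes add: "\<And>f g. smooth f \<Longrightarrow> smooth g \<Longrightarrow> T (\<lambda>x. f x + g x) = T f + T g"
    and scale: "\<And>r f. smooth f \<Longrightarrow> T (\<lambda>x. r *\<^sub>R f x) = r *\<^sub>R T f"
    and \<alpha>: "\<alpha> \<in> smooth_sections (alt_forms k)"
  shows "(\<lambda>vs. T (\<lambda>x. \<alpha> x vs)) \<in> alt_forms k"
proof -
  have T0: "T (\<lambda>x. 0) = 0"
    using scale[of "\<lambda>x. 0" 0] by simp
  have z: "T (\<lambda>x. \<alpha> x vs) = 0" if "\<And>x. \<alpha> x vs = 0" for vs
    using T0 that by simp
  have "linear (\<lambda>v. T (\<lambda>x. \<alpha> x (vs[i := v])))" if vs: "length vs = k" "i < k" for vs i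
  proof -
    have lin: "linear (\<lambda>v. \<alpha> x (vs[i := v]))" for x
      using section_alt_forms[OF \<alpha>] vs unfolding alt_forms_def by blast
    show ?thesis
      by (rule linearI) (simp_all add: linear_add[OF lin] linear_cmul[OF lin] add scale
          section_smooth[OF \<alpha>])
  qed
  moreover have "T (\<lambda>x. \<alpha> x vs) = 0" if "length vs \<noteq> k" for vs
    using section_alt_forms[OF \<alpha>] that unfolding alt_forms_def by (intro z) blast
  moreover have "T (\<lambda>x. \<alpha> x vs) = 0" if "length vs = k \<and> i < j \<and> j < k \<and> vs ! i = vs ! j" for vs i j
    using section_alt_forms[OF \<alpha>] that unfolding alt_forms_def by (intro z) blast
  ultimately show ?thesis
    unfolding alt_forms_def by blast
qed

lemma form_deriv_alt_forms:
  fixes \<alpha> :: "'w::euclidean_space \<Rightarrow> 'v::euclidean_space list \<Rightarrow> 'u::euclidean_space"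
  assumes "\<alpha> \<in> smooth_sections (alt_forms k)"
  shows "form_deriv \<alpha> x h \<in> alt_forms k"
  unfolding form_deriv_def
  by (rule alt_forms_functional[OF _ _ assms])
    (auto simp: frechet_derivative_add frechet_derivative_linear_image bounded_linear_scaleR_right)

lemma form_deriv_has_derivative:
  fixes \<alpha> :: "'w::euclidean_space \<Rightarrow> 'v::euclidean_space list \<Rightarrow> 'u::euclidean_space"
  assumes "\<alpha> \<in> smooth_sections (alt_forms k)"
  shows "((\<lambda>y. \<alpha> y vs) has_derivative (\<lambda>h. form_deriv \<alpha> x h vs)) (at x)"
  unfolding form_deriv_def by (rule smooth_has_derivative[OF section_smooth[OF assms]])

lemma form_derivI:
  assumes "\<And>vs. ((\<lambda>y. \<alpha> y vs) has_derivative (\<lambda>h. D h vs)) (at x)"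
  shows "form_deriv \<alpha> x h = D h"
  unfolding form_deriv_def frechet_derivative_at[OF assms, symmetric] ..

lemma linear_form_deriv:
  fixes \<alpha> :: "'w::euclidean_space \<Rightarrow> 'v::euclidean_space list \<Rightarrow> 'u::euclidean_space"
  assumes "\<alpha> \<in> smooth_sections (alt_forms k)"
  shows "linear (form_deriv \<alpha> x)"
  using smooth_linear_derivative[OF section_smooth[OF assms]]
  by (intro linearI) (auto simp: form_deriv_def fun_eq_iff linear_add linear_cmul)

lemma deriv_along_section:
  fixes \<beta> :: "'v::euclidean_space \<Rightarrow> 'v list \<Rightarrow> 'v"
  assumes "\<beta> \<in> smooth_sections (alt_forms k)" "smooth X"
  shows "deriv_along X \<beta> \<in> smooth_sections (alt_forms k)"
  using form_deriv_alt_forms[OF assms(1)] smooth_frechet_along[OF section_smooth[OF assms(1)] assms(2)]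
  by (auto simp: smooth_sections_alt_forms_iff deriv_along_form_deriv) (simp add: form_deriv_def)

text \<open>Product rule for a linear map that varies with the base point. Expanding the argument in
  the basis leaves only products of scalar functions with \<open>F y e\<close> in fixed directions
  \<open>e\<close>.\<close>

lemma has_derivative_linear_family:
  fixes X :: "'v::euclidean_space \<Rightarrow> 'v" and F :: "'v \<Rightarrow> 'v \<Rightarrow> 'b::euclidean_space"
  assumes lin: "\<And>x. linear (F x)" and F: "\<And>h. smooth (\<lambda>x. F x h)" and X: "smooth X"
  shows "((\<lambda>y. F y (X y)) has_derivative
    (\<lambda>h. frechet_derivative (\<lambda>y. F y (X x)) (at x) h + F x (frechet_derivative X (at x) h))) (at x)"
proof -
  have exp: "F y v = (\<Sum>e\<in>Basis. (v \<bullet> e) *\<^sub>R F y e)" for y v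
  proof -
    interpret linear "F y" by fact
    have "F y v = F y (\<Sum>e\<in>Basis. (v \<bullet> e) *\<^sub>R e)"
      by (simp add: euclidean_representation)
    then show ?thesis by (simp only: sum scale)
  qed
  let ?D = "\<lambda>e. frechet_derivative (\<lambda>y. F y e) (at x)"
  have D: "((\<lambda>y. F y e) has_derivative ?D e) (at x)" for e
    by (rule smooth_has_derivative[OF F])
  have DX: "((\<lambda>y. X y \<bullet> e) has_derivative (\<lambda>h. frechet_derivative X (at x) h \<bullet> e)) (at x)" for e
    by (rule has_derivative_inner_left[OF smooth_has_derivative[OF X]])
  \<comment> \<open>Differentiation preserves linearity in \<open>v\<close>; this resums the basis
    expansion at the end.\<close>
  have D_exp: "?D v h = (\<Sum>e\<in>Basis. (v \<bullet> e) *\<^sub>R ?D e h)" for v h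
  proof -
    have eq: "(\<lambda>y. F y v) = (\<lambda>y. \<Sum>e\<in>Basis. (v \<bullet> e) *\<^sub>R F y e)"
      by (intro ext exp)
    have "((\<lambda>y. F y v) has_derivative (\<lambda>h. \<Sum>e\<in>Basis. (v \<bullet> e) *\<^sub>R ?D e h)) (at x)"
      unfolding eq by (intro has_derivative_sum has_derivative_scaleR_right D)
    from frechet_derivative_at[OF this] show ?thesis
      by metis
  qed
  have eq: "(\<lambda>y. F y (X y)) = (\<lambda>y. \<Sum>e\<in>Basis. (X y \<bullet> e) *\<^sub>R F y e)"
    by (intro ext exp)
  have "((\<lambda>y. F y (X y)) has_derivative
      (\<lambda>h. \<Sum>e\<in>Basis. (X x \<bullet> e) *\<^sub>R ?D e h + (frechet_derivative X (at x) h \<bullet> e) *\<^sub>R F x e)) (at x)"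
    unfolding eq by (intro has_derivative_sum has_derivative_scaleR D DX)
  then show ?thesis
  proof (rule has_derivative_eq_rhs)
    show "(\<lambda>h. \<Sum>e\<in>Basis. (X x \<bullet> e) *\<^sub>R ?D e h + (frechet_derivative X (at x) h \<bullet> e) *\<^sub>R F x e)
      = (\<lambda>h. ?D (X x) h + F x (frechet_derivative X (at x) h))"
      by (intro ext, subst D_exp[of "X x"], subst (2) exp) (rule sum.distrib)
  qed
qed

text \<open>The second derivatives of \<open>f\<close> cancel by symmetry, and only the derivatives
  of the two fields survive.\<close>

lemma frechet_along_commutator:
  fixes X Y :: "'v::euclidean_space \<Rightarrow> 'v" and f :: "'v \<Rightarrow> 'b::euclidean_space"
  assumes f: "smooth f" and X: "smooth X" and Y: "smooth Y"
  shows "frechet_derivative (\<lambda>y. frechet_derivative f (at y) (Y y)) (at x) (X x)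
    - frechet_derivative (\<lambda>y. frechet_derivative f (at y) (X y)) (at x) (Y x)
    = frechet_derivative f (at x) (vf_bracket X Y x)"
proof -
  have *: "frechet_derivative (\<lambda>y. frechet_derivative f (at y) (Z y)) (at x) h
     = frechet_derivative (\<lambda>y. frechet_derivative f (at y) (Z x)) (at x) h
       + frechet_derivative f (at x) (frechet_derivative Z (at x) h)" if "smooth Z" for Z h
    using frechet_derivative_at[OF has_derivative_linear_family[OF smooth_linear_derivative[OF f]
        smooth_frechet_derivative[OF f] that], of x] by (simp add: fun_eq_iff)
  show ?thesis
    unfolding *[OF X] *[OF Y] vf_bracket_def linear_diff[OF smooth_linear_derivative[OF f]]
    using smooth_second_derivative_symmetric[OF f, of "Y x" x "X x"] by simp
qed

lemma deriv_along_commutator: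
  fixes X Y :: "'v::euclidean_space \<Rightarrow> 'v"
  assumes "\<gamma> \<in> smooth_sections (alt_forms k)" "smooth X" "smooth Y"
  shows "deriv_along X (deriv_along Y \<gamma>) x - deriv_along Y (deriv_along X \<gamma>) x
    = deriv_along (vf_bracket X Y) \<gamma> x"
  unfolding deriv_along_def fun_eq_iff
  using frechet_along_commutator[OF section_smooth[OF assms(1)] assms(2,3)] by simp

section \<open>Differential, anchor and bracket on sections\<close>

lemma koszul_d_section:
  fixes \<alpha> :: "'v::euclidean_space \<Rightarrow> 'v list \<Rightarrow> 'v"
  assumes "\<alpha> \<in> smooth_sections (alt_forms k)"
  shows "koszul_d \<alpha> \<in> smooth_sections (alt_forms (k - 1))"
  unfolding smooth_sections_alt_forms_iff koszul_d_def
proof (intro conjI allI)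
  show "contract x (\<alpha> x) \<in> alt_forms (k - 1)" for x
    by (rule alt_forms_contract_pred[OF section_alt_forms[OF assms]])
  show "smooth (\<lambda>x. contract x (\<alpha> x) vs)" for vs
    unfolding contract_def
    by (rule smooth_linear_family[OF linear_contract[OF section_alt_forms[OF assms]]
        section_smooth[OF assms]]) simp
qed

text \<open>Reading vector fields as sections of 0-forms makes the anchor the last Koszul map, so
  its properties become the lowest case of those of \<open>koszul_d\<close>.\<close>

lemma koszul_anchor_eq_koszul_d: "koszul_anchor \<alpha> x = koszul_d \<alpha> x []"
  by (simp add: koszul_anchor_def koszul_d_def contract_def)

lemma smooth_koszul_anchor:
  fixes \<alpha> :: "'v::euclidean_space \<Rightarrow> 'v list \<Rightarrow> 'v"
  assumes "\<alpha> \<in> smooth_sections (alt_forms k)"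
  shows "smooth (koszul_anchor \<alpha>)"
  using section_smooth[OF koszul_d_section[OF assms], of "[]"]
  by (simp add: koszul_anchor_eq_koszul_d[abs_def])

lemma koszul_d_koszul_d:
  fixes \<alpha> :: "'v::euclidean_space \<Rightarrow> 'v list \<Rightarrow> 'v"
  assumes "\<alpha> \<in> smooth_sections (alt_forms k)"
  shows "koszul_d (koszul_d \<alpha>) = (\<lambda>x. 0)"
  unfolding koszul_d_def contract_contract_self[OF section_alt_forms[OF assms]] ..

lemma koszul_anchor_koszul_d:
  fixes \<alpha> :: "'v::euclidean_space \<Rightarrow> 'v list \<Rightarrow> 'v"
  assumes "\<alpha> \<in> smooth_sections (alt_forms k)"
  shows "koszul_anchor (koszul_d \<alpha>) = (\<lambda>x. 0)"
  using koszul_d_koszul_d[OF assms] by (simp add: koszul_anchor_eq_koszul_d fun_eq_iff)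

text \<open>This is the action of the derivation that \<open>\<alpha>\<close> defines on functions on the graded manifold
  \<open>T[1]V\<close>; the derivative term makes it commute with the Euler contraction for \<open>k = 1\<close>.\<close>

definition nr_act :: "nat \<Rightarrow> ('v \<Rightarrow> 'v list \<Rightarrow> 'v) \<Rightarrow> ('v \<Rightarrow> 'v list \<Rightarrow> 'v) \<Rightarrow> 'v \<Rightarrow> 'v list \<Rightarrow>
    'v::euclidean_space"
  where "nr_act k \<alpha> \<beta> = (\<lambda>x. nr_comp (\<alpha> x) (\<beta> x) + (if k = 1 then deriv_along (koszul_anchor \<alpha>) \<beta> x
      else 0))"

lemma nr_bracket_nr_act:
  "nr_bracket k l \<alpha> \<beta> = (\<lambda>x. nr_act k \<alpha> \<beta> x - (-1) ^ ((k - 1) * (l - 1)) *\<^sub>R nr_act l \<beta> \<alpha> x)"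
  unfolding nr_bracket_def nr_act_def nr_comp_def
  by (auto simp: scaleR_add_right)

lemma form_deriv_nr_comp:
  fixes \<alpha> \<beta> :: "'v::euclidean_space \<Rightarrow> 'v list \<Rightarrow> 'v"
  assumes \<alpha>: "\<alpha> \<in> smooth_sections (alt_forms k)" and \<beta>: "\<beta> \<in> smooth_sections (alt_forms l)"
  shows "((\<lambda>y. nr_comp (\<alpha> y) (\<beta> y) vs) has_derivative
     (\<lambda>h. (nr_comp (form_deriv \<alpha> x h) (\<beta> x) + nr_comp (\<alpha> x) (form_deriv \<beta> x h)) vs)) (at x)"
proof -
  let ?s = "\<lambda>S. shuffle_sign (length vs) S" and ?c = "\<lambda>S. {..<length vs} - S"
  have "((\<lambda>y. \<Sum>b\<in>Basis. \<Sum>S\<in>Pow {..<length vs}. (?s S * (\<alpha> y (nths vs S) \<bullet> b)) *\<^sub>R \<beta> y (b # nths vs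
      (?c S)))
     has_derivative (\<lambda>h. \<Sum>b\<in>Basis. \<Sum>S\<in>Pow {..<length vs}.
        (?s S * (\<alpha> x (nths vs S) \<bullet> b)) *\<^sub>R form_deriv \<beta> x h (b # nths vs (?c S))
      + (?s S * (form_deriv \<alpha> x h (nths vs S) \<bullet> b)) *\<^sub>R \<beta> x (b # nths vs (?c S)))) (at x)"
    by (intro has_derivative_sum has_derivative_scaleR has_derivative_mult_right
        has_derivative_inner_left
      form_deriv_has_derivative[OF \<alpha>] form_deriv_has_derivative[OF \<beta>])
  then show ?thesis
    unfolding nr_comp_def wedge_def contract_def sum_fun_apply plus_fun_apply
    by (simp add: sum.distrib add.commute)
qed

lemma deriv_along_nr_comp:
  fixes \<alpha> \<beta> :: "'v::euclidean_space \<Rightarrow> 'v list \<Rightarrow> 'v"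
  assumes \<alpha>: "\<alpha> \<in> smooth_sections (alt_forms k)" and \<beta>: "\<beta> \<in> smooth_sections (alt_forms l)"
  shows "deriv_along X (\<lambda>x. nr_comp (\<alpha> x) (\<beta> x)) x
    = nr_comp (deriv_along X \<alpha> x) (\<beta> x) + nr_comp (\<alpha> x) (deriv_along X \<beta> x)"
  unfolding deriv_along_form_deriv by (rule form_derivI[OF form_deriv_nr_comp[OF assms]])

lemma nr_comp_section:
  fixes \<alpha> \<beta> :: "'v::euclidean_space \<Rightarrow> 'v list \<Rightarrow> 'v"
  assumes \<alpha>: "\<alpha> \<in> smooth_sections (alt_forms k)" and \<beta>: "\<beta> \<in> smooth_sections (alt_forms (Suc l))"
  shows "(\<lambda>x. nr_comp (\<alpha> x) (\<beta> x)) \<in> smooth_sections (alt_forms (k + l))"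
  unfolding smooth_sections_alt_forms_iff
proof (intro conjI allI)
  show "nr_comp (\<alpha> x) (\<beta> x) \<in> alt_forms (k + l)" for x
    by (rule nr_comp_alt_forms[OF section_alt_forms[OF \<alpha>] section_alt_forms[OF \<beta>]])
  show "smooth (\<lambda>x. nr_comp (\<alpha> x) (\<beta> x) vs)" for vs
    unfolding nr_comp_def wedge_def contract_def sum_fun_apply
    by (intro smooth_sum smooth_mult smooth_scaleR smooth_inner_left smooth_const section_smooth[OF
        \<alpha>] section_smooth[OF \<beta>])
qed

text \<open>The case \<open>l = 0\<close> is included because the Euler contraction of a 1-form is a
  0-form; the insertion vanishes there and only the derivative can be non-zero.\<close>

lemma nr_act_section:
  fixes \<alpha> \<beta> :: "'v::euclidean_space \<Rightarrow> 'v list \<Rightarrow> 'v"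
  assumes \<alpha>: "\<alpha> \<in> smooth_sections (alt_forms (Suc k))" and \<beta>: "\<beta> \<in> smooth_sections (alt_forms l)"
  shows "nr_act (Suc k) \<alpha> \<beta> \<in> smooth_sections (alt_forms (k + l))"
proof -
  note add = smooth_sections_add[OF subspace_alt_forms order_refl]
  have 1: "(\<lambda>x. nr_comp (\<alpha> x) (\<beta> x)) \<in> smooth_sections (alt_forms (k + l))"
  proof (cases l)
    case 0
    then have "nr_comp (\<alpha> x) (\<beta> x) = 0" for x
      using nr_comp_0_form_right section_degree[OF \<beta>] by blast
    then show ?thesis using zero_section by simp
  next
    case (Suc l')
    then show ?thesis using nr_comp_section[OF \<alpha>, of \<beta> l'] \<beta> by simp
  qed
  have 2: "(\<lambda>x. if Suc k = 1 then deriv_along (koszul_anchor \<alpha>) \<beta> x else 0) \<in> smooth_sections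
      (alt_forms (k + l))"
    using deriv_along_section[OF \<beta> smooth_koszul_anchor[OF \<alpha>]] zero_section
    by (cases "k = 0") simp_all
  show ?thesis unfolding nr_act_def by (rule add[OF 1 2])
qed

section \<open>Compatibility with the Euler contraction and the anchor\<close>

text \<open>Product rule for the contraction with the Euler field, whose derivative along X is X
  itself.\<close>

lemma deriv_along_koszul_d:
  fixes \<beta> :: "'v::euclidean_space \<Rightarrow> 'v list \<Rightarrow> 'v"
  assumes \<beta>: "\<beta> \<in> smooth_sections (alt_forms k)"
  shows "deriv_along X (koszul_d \<beta>) x = contract x (deriv_along X \<beta> x) + contract (X x) (\<beta> x)"
proof
  fix vs
  have "((\<lambda>y. \<beta> y (y # vs)) has_derivative (\<lambda>h. frechet_derivative (\<lambda>y. \<beta> y (x # vs)) (at x) h + \<beta> x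
      (h # vs))) (at x)"
    using has_derivative_linear_family[where F = "\<lambda>y v. \<beta> y (v # vs)" and X = "\<lambda>y. y" and x = x,
        OF linear_contract[OF section_alt_forms[OF \<beta>]] section_smooth[OF \<beta>] smooth_ident] by simp
  from frechet_derivative_at[OF this]
  show "deriv_along X (koszul_d \<beta>) x vs = (contract x (deriv_along X \<beta> x) + contract (X x) (\<beta> x)) vs"
    by (simp add: deriv_along_def koszul_d_def contract_def fun_eq_iff)
qed

lemma deriv_along_zero_field:
  fixes \<beta> :: "'v::euclidean_space \<Rightarrow> 'v list \<Rightarrow> 'v"
  assumes \<beta>: "\<beta> \<in> smooth_sections (alt_forms k)"
  shows "deriv_along (\<lambda>x. 0) \<beta> x = 0"
  unfolding deriv_along_form_deriv by (rule linear_0[OF linear_form_deriv[OF \<beta>]])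

text \<open>For \<open>k = 0\<close> the contracted \<alpha> is the vector
  \<open>koszul_anchor \<alpha> x\<close>, and its insertion into \<beta> cancels the extra term of
  \<open>deriv_along_koszul_d\<close>. For \<open>k > 0\<close> this is the contraction rule of the
  insertion alone.\<close>

lemma koszul_d_nr_act:
  fixes \<alpha> \<beta> :: "'v::euclidean_space \<Rightarrow> 'v list \<Rightarrow> 'v"
  assumes \<alpha>: "\<alpha> \<in> smooth_sections (alt_forms (Suc k))" and \<beta>: "\<beta> \<in> smooth_sections (alt_forms l)"
  shows "koszul_d (nr_act (Suc k) \<alpha> \<beta>) x
    = (if k = 0 then 0 else nr_act k (koszul_d \<alpha>) \<beta> x) + (-1) ^ k *\<^sub>R nr_act (Suc k) \<alpha> (koszul_d \<beta>) x"
proof -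
  have c: "contract x (nr_comp (\<alpha> x) (\<beta> x))
      = nr_comp (contract x (\<alpha> x)) (\<beta> x) + (-1) ^ k *\<^sub>R nr_comp (\<alpha> x) (contract x (\<beta> x))"
    using contract_nr_comp[OF section_degree[OF \<alpha>] section_alt_forms[OF \<beta>], of x x] by simp
  show ?thesis
  proof (cases "k = 0")
    case True
    have "form_degree 0 (contract x (\<alpha> x))"
      using form_degree_contract[OF section_degree[OF \<alpha>], of x] True by simp
    from nr_comp_0_form_left[OF this section_alt_forms[OF \<beta>]]
    have "nr_comp (contract x (\<alpha> x)) (\<beta> x) = contract (koszul_anchor \<alpha> x) (\<beta> x)"
      by (simp add: koszul_anchor_def contract_def)
    then show ?thesis
      using c deriv_along_koszul_d[OF \<beta>, of "koszul_anchor \<alpha>" x] True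
      by (simp add: nr_act_def koszul_d_def contract_add)
  next
    case False
    \<comment> \<open>For \<open>k = 1\<close> the definition contributes a derivative along the
      anchor of \<open>koszul_d \<alpha>\<close>, which is zero.\<close>
    then have "nr_act k (koszul_d \<alpha>) \<beta> x = nr_comp (contract x (\<alpha> x)) (\<beta> x)"
      using koszul_anchor_koszul_d[OF \<alpha>] deriv_along_zero_field[OF \<beta>]
      by (auto simp: nr_act_def koszul_d_def[of \<alpha>])
    then show ?thesis
      using c False by (simp add: nr_act_def koszul_d_def)
  qed
qed

text \<open>The lowest case of \<open>koszul_d_nr_act\<close> says that the anchor of
  \<open>nr_act 1 \<alpha> \<beta>\<close> is the derivative of the anchor of \<beta> along that of
  \<alpha>. This is the flat connection on V; it is torsion-free, so antisymmetrising gives the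
  bracket of vector fields.\<close>

lemma koszul_anchor_nr_bracket:
  fixes \<alpha> \<beta> :: "'v::euclidean_space \<Rightarrow> 'v list \<Rightarrow> 'v"
  assumes \<alpha>: "\<alpha> \<in> smooth_sections (alt_forms 1)" and \<beta>: "\<beta> \<in> smooth_sections (alt_forms 1)"
  shows "koszul_anchor (nr_bracket 1 1 \<alpha> \<beta>) = vf_bracket (koszul_anchor \<alpha>) (koszul_anchor \<beta>)"
proof
  fix x
  have act: "koszul_d (nr_act 1 \<alpha> \<beta>) x [] = frechet_derivative (koszul_anchor \<beta>) (at x)
      (koszul_anchor \<alpha> x)"
    if \<alpha>: "\<alpha> \<in> smooth_sections (alt_forms 1)" and \<beta>: "\<beta> \<in> smooth_sections (alt_forms 1)"
    for \<alpha> \<beta> :: "'v \<Rightarrow> 'v list \<Rightarrow> 'v"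
  proof -
    have "nr_comp (\<alpha> x) (koszul_d \<beta> x) = 0"
      using section_degree[OF koszul_d_section[OF \<beta>]] by (intro nr_comp_0_form_right) simp
    then show ?thesis
      using koszul_d_nr_act[of \<alpha> 0 \<beta> 1 x] \<alpha> \<beta>
      by (simp add: nr_act_def deriv_along_def koszul_anchor_eq_koszul_d[abs_def])
  qed
  have "koszul_anchor (nr_bracket 1 1 \<alpha> \<beta>) x = koszul_d (nr_act 1 \<alpha> \<beta>) x [] - koszul_d (nr_act 1 \<beta>
      \<alpha>) x []"
    by (simp add: koszul_anchor_def koszul_d_def contract_def nr_bracket_nr_act)
  then show "koszul_anchor (nr_bracket 1 1 \<alpha> \<beta>) x = vf_bracket (koszul_anchor \<alpha>) (koszul_anchor \<beta>) x"
    unfolding act[OF \<alpha> \<beta>] act[OF \<beta> \<alpha>] by (simp add: vf_bracket_def)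
qed

section \<open>The commutator identity and the Jacobi identity\<close>

lemma deriv_along_diff:
  fixes \<beta> \<gamma> :: "'v::euclidean_space \<Rightarrow> 'v list \<Rightarrow> 'v"
  assumes "\<beta> \<in> smooth_sections (alt_forms k)" "\<gamma> \<in> smooth_sections (alt_forms l)"
  shows "deriv_along X (\<lambda>x. \<beta> x - r *\<^sub>R \<gamma> x) x = deriv_along X \<beta> x - r *\<^sub>R deriv_along X \<gamma> x"
  unfolding deriv_along_form_deriv
  by (rule form_derivI[where D="\<lambda>h. form_deriv \<beta> x h - r *\<^sub>R form_deriv \<gamma> x h"])
    (auto intro!: has_derivative_diff has_derivative_scaleR_right form_deriv_has_derivative[OF
        assms(1)] form_deriv_has_derivative[OF assms(2)])

lemma nr_act_diff_right:
  fixes \<beta> \<gamma> :: "'v::euclidean_space \<Rightarrow> 'v list \<Rightarrow> 'v"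
  assumes "\<beta> \<in> smooth_sections (alt_forms m)" "\<gamma> \<in> smooth_sections (alt_forms l)"
  shows "nr_act k \<alpha> (\<lambda>x. \<beta> x - r *\<^sub>R \<gamma> x) x = nr_act k \<alpha> \<beta> x - r *\<^sub>R nr_act k \<alpha> \<gamma> x"
  unfolding nr_act_def nr_comp_diff_right nr_comp_scaleR_right deriv_along_diff[OF assms]
  by (simp add: scaleR_add_right)

text \<open>Three kinds of terms: pure insertions are covered by the symmetry of the associator;
  mixed terms, expanded by \<open>L\<close> since a derivative is a derivation of the insertion, are
  insertions of the derivative parts of the bracket; two derivatives combine to the derivative along
  the bracket of the anchors.\<close>

lemma nr_act_commutator:
  fixes \<alpha> \<beta> \<gamma> :: "'v::euclidean_space \<Rightarrow> 'v list \<Rightarrow> 'v"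
  assumes \<alpha>: "\<alpha> \<in> smooth_sections (alt_forms (Suc k))" and \<beta>: "\<beta> \<in> smooth_sections (alt_forms (Suc l))"
    and \<gamma>: "\<gamma> \<in> smooth_sections (alt_forms m)"
  shows "nr_act (Suc (k + l)) (nr_bracket (Suc k) (Suc l) \<alpha> \<beta>) \<gamma> x
    = nr_act (Suc k) \<alpha> (nr_act (Suc l) \<beta> \<gamma>) x - (-1) ^ (k * l) *\<^sub>R nr_act (Suc l) \<beta> (nr_act (Suc k)
        \<alpha> \<gamma>) x"
proof -
  let ?X = "koszul_anchor \<alpha>" and ?Y = "koszul_anchor \<beta>"
  note X = smooth_koszul_anchor[OF \<alpha>] and Y = smooth_koszul_anchor[OF \<beta>]
  have L: "deriv_along Z (\<lambda>x. nr_comp (\<beta> x) (\<gamma> x) + (if c then deriv_along (koszul_anchor \<beta>) \<gamma> x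
      else 0)) x
     = nr_comp (deriv_along Z \<beta> x) (\<gamma> x) + nr_comp (\<beta> x) (deriv_along Z \<gamma> x)
       + (if c then deriv_along Z (deriv_along (koszul_anchor \<beta>) \<gamma>) x else 0)"
    if \<beta>: "\<beta> \<in> smooth_sections (alt_forms (Suc l))" for Z \<beta> l c
  proof (cases m)
    case 0
    have "nr_comp (\<beta> x) (\<gamma> x) = 0" for x
      using nr_comp_0_form_right section_degree[OF \<gamma>] 0 by blast
    moreover have "nr_comp (deriv_along Z \<beta> x) (\<gamma> x) = 0" "nr_comp (\<beta> x) (deriv_along Z \<gamma> x) = 0"
      using nr_comp_0_form_right section_degree[OF \<gamma>] alt_forms_degree[OF form_deriv_alt_forms[OF \<gamma>]] 0
      unfolding deriv_along_form_deriv by blast+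
    moreover have "deriv_along Z (\<lambda>x. 0) x = 0" by (simp add: deriv_along_def fun_eq_iff)
    ultimately show ?thesis by simp
  next
    case (Suc m')
    have 1: "(\<lambda>x. nr_comp (\<beta> x) (\<gamma> x)) \<in> smooth_sections (alt_forms (Suc l + m'))"
      by (rule nr_comp_section[OF \<beta>]) (use \<gamma> Suc in simp)
    have 2: "deriv_along (koszul_anchor \<beta>) \<gamma> \<in> smooth_sections (alt_forms m)"
      by (rule deriv_along_section[OF \<gamma> smooth_koszul_anchor[OF \<beta>]])
    \<comment> \<open>Additivity is the difference rule with \<open>r = -1\<close>.\<close>
    show ?thesis
      using deriv_along_diff[OF 1 2, of Z "-1" x]
      by (cases c) (simp_all add: deriv_along_nr_comp[OF \<beta> \<gamma>])
  qed
  note assoc = nr_comp_associator_symmetric[OF section_degree[OF \<alpha>] section_degree[OF \<beta>]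
      section_alt_forms[OF \<gamma>], of x x x]
  show ?thesis
  proof (cases "k = 0 \<and> l = 0")
    \<comment> \<open>Only here does the bracket have form degree 1 and hence a derivative term of
      its own; otherwise at most one of \<alpha> and \<beta> differentiates.\<close>
    case True
    have anchor: "koszul_anchor (nr_bracket (Suc k) (Suc l) \<alpha> \<beta>) = vf_bracket ?X ?Y"
      using koszul_anchor_nr_bracket[of \<alpha> \<beta>] \<alpha> \<beta> True by simp
    show ?thesis
      using True assoc deriv_along_commutator[OF \<gamma> X Y, of x]
      unfolding nr_act_def[of "Suc (k + l)"] anchor unfolding nr_bracket_nr_act nr_act_def L[OF \<alpha>]
          L[OF \<beta>]
      by (simp add: nr_comp_add_left nr_comp_add_right nr_comp_diff_left nr_comp_diff_right
          algebra_simps)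
  next
    case False
    show ?thesis
      using False assoc
      unfolding nr_act_def[of "Suc (k + l)"] unfolding nr_bracket_nr_act nr_act_def L[OF \<alpha>] L[OF \<beta>]
      by (cases "k = 0"; cases "l = 0") (simp_all add: nr_comp_add_left nr_comp_add_right
          nr_comp_diff_left nr_comp_diff_right
        nr_comp_scaleR_left nr_comp_scaleR_right algebra_simps)
  qed
qed

text \<open>Antisymmetrisation of \<open>koszul_d_nr_act\<close>. For \<open>k = l = 0\<close> the
  contraction of the bracket is the bracket of the anchors instead, hence the condition on
  \<open>k + l\<close>. The conditionals drop terms in which a 1-form would be sent to degree 1,
  where the complex is zero.\<close>

lemma koszul_d_nr_bracket:
  fixes \<alpha> \<beta> :: "'v::euclidean_space \<Rightarrow> 'v list \<Rightarrow> 'v"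
  assumes \<alpha>: "\<alpha> \<in> smooth_sections (alt_forms (Suc k))" and \<beta>: "\<beta> \<in> smooth_sections (alt_forms (Suc l))"
    and "k + l > 0"
  shows "koszul_d (nr_bracket (Suc k) (Suc l) \<alpha> \<beta>) x
    = (if k = 0 then 0 else nr_bracket k (Suc l) (koszul_d \<alpha>) \<beta> x)
      + (if l = 0 then 0 else (-1) ^ k *\<^sub>R nr_bracket (Suc k) l \<alpha> (koszul_d \<beta>) x)"
proof -
  have lin: "koszul_d (nr_bracket (Suc k) (Suc l) \<alpha> \<beta>) x
    = koszul_d (nr_act (Suc k) \<alpha> \<beta>) x - (-1) ^ (k * l) *\<^sub>R koszul_d (nr_act (Suc l) \<beta> \<alpha>) x"
    by (simp add: nr_bracket_nr_act koszul_d_def contract_diff contract_scaleR)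
  \<comment> \<open>The Euler contraction of a 1-form is a 0-form, into which nothing can be
    inserted, and for \<open>q > 0\<close> there is no derivative term.\<close>
  have 0: "nr_act (Suc q) \<psi> (koszul_d \<phi>) x = 0" if "\<phi> \<in> smooth_sections (alt_forms (Suc 0))" "q > 0"
      for \<phi> \<psi> q
    using that section_degree[OF koszul_d_section[OF that(1)], of x]
    by (simp add: nr_act_def nr_comp_0_form_right)
  show ?thesis
    unfolding lin koszul_d_nr_act[OF \<alpha> \<beta>] koszul_d_nr_act[OF \<beta> \<alpha>]
    using assms(3) 0[of \<alpha> l \<beta>] 0[of \<beta> k \<alpha>] \<alpha> \<beta>
    by (cases k; cases l) (simp_all add: nr_bracket_nr_act algebra_simps power_add flip:
        power_mult_distrib)
qed

lemma nr_act_nr_bracket: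
  fixes \<alpha> \<beta> \<gamma> :: "'v::euclidean_space \<Rightarrow> 'v list \<Rightarrow> 'v"
  assumes \<beta>: "\<beta> \<in> smooth_sections (alt_forms (Suc l))" and \<gamma>: "\<gamma> \<in> smooth_sections (alt_forms (Suc m))"
  shows "nr_act k \<alpha> (nr_bracket (Suc l) (Suc m) \<beta> \<gamma>) x
    = nr_act k \<alpha> (nr_act (Suc l) \<beta> \<gamma>) x - (-1) ^ (l * m) *\<^sub>R nr_act k \<alpha> (nr_act (Suc m) \<gamma> \<beta>) x"
  using nr_act_diff_right[OF nr_act_section[OF \<beta> \<gamma>] nr_act_section[OF \<gamma> \<beta>], of k \<alpha> "(-1) ^ (l * m)" x]
  by (simp add: nr_bracket_nr_act)

text \<open>The commutator identity, applied with each of the three sections as the last argument,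
  removes every action of a bracket. What is left is an identity between iterated actions of two
  sections on the third.\<close>

lemma nr_bracket_jacobi:
  fixes \<alpha> \<beta> \<gamma> :: "'v::euclidean_space \<Rightarrow> 'v list \<Rightarrow> 'v"
  assumes \<alpha>: "\<alpha> \<in> smooth_sections (alt_forms (Suc k))" and \<beta>: "\<beta> \<in> smooth_sections (alt_forms (Suc l))"
    and \<gamma>: "\<gamma> \<in> smooth_sections (alt_forms (Suc m))"
  shows "nr_bracket (Suc k) (Suc (l + m)) \<alpha> (nr_bracket (Suc l) (Suc m) \<beta> \<gamma>) x
    = nr_bracket (Suc (k + l)) (Suc m) (nr_bracket (Suc k) (Suc l) \<alpha> \<beta>) \<gamma> x
      + (-1) ^ (k * l) *\<^sub>R nr_bracket (Suc l) (Suc (k + m)) \<beta> (nr_bracket (Suc k) (Suc m) \<alpha> \<gamma>) x"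
proof -
  define ab where "ab = (-1::real) ^ (k * l)"
  define ac where "ac = (-1::real) ^ (k * m)"
  define bc where "bc = (-1::real) ^ (l * m)"
  have sq: "ab * ab = 1" "ac * ac = 1" "bc * bc = 1"
    by (simp_all add: ab_def ac_def bc_def flip: power_mult_distrib)
  have sgn: "(-1::real) ^ (k * (l + m)) = ab * ac" "(-1::real) ^ ((k + l) * m) = ac * bc"
    "(-1::real) ^ (l * (k + m)) = ab * bc"
    by (simp_all add: ab_def ac_def bc_def algebra_simps power_add)
  \<comment> \<open>All signs are products of the three pairwise ones; once these are fixed to 1 or
    -1, the identity is linear in the iterated actions.\<close>
  have sign: "e = 1 \<or> e = -1" if "e * e = 1" for e :: real
    using that by algebra
  have br: "nr_bracket (Suc p) (Suc q) \<phi> \<psi> x = nr_act (Suc p) \<phi> \<psi> x - (-1) ^ (p * q) *\<^sub>R nr_act (Suc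
      q) \<psi> \<phi> x"
    for p q and \<phi> \<psi> :: "'v \<Rightarrow> 'v list \<Rightarrow> 'v"
    by (simp add: nr_bracket_nr_act)
  show ?thesis
    unfolding br[of k "l + m"] br[of "k + l" m] br[of l "k + m"] sgn
      nr_act_nr_bracket[OF \<beta> \<gamma>] nr_act_nr_bracket[OF \<alpha> \<beta>] nr_act_nr_bracket[OF \<alpha> \<gamma>]
      nr_act_commutator[OF \<alpha> \<beta> \<gamma>] nr_act_commutator[OF \<beta> \<gamma> \<alpha>] nr_act_commutator[OF \<alpha> \<gamma> \<beta>]
    unfolding ab_def[symmetric] ac_def[symmetric] bc_def[symmetric]
    using sign[OF sq(1)] sign[OF sq(2)] sign[OF sq(3)]
    by (elim disjE) (simp_all add: algebra_simps)
qed

section \<open>The homotopy for the Koszul complex\<close>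

text \<open>Its components \<open>identity_form vs \<bullet> b\<close> are the coordinate 1-forms,
  so wedging them with partial derivatives and summing over \<open>b\<close> gives an exterior
  derivative.\<close>

definition identity_form :: "'v list \<Rightarrow> 'v::real_vector"
  where "identity_form vs = (case vs of [v] \<Rightarrow> v | _ \<Rightarrow> 0)"

lemma contract_identity_form: "contract v identity_form = (\<lambda>vs. if vs = [] then v else 0)"
  by (auto simp: contract_def identity_form_def fun_eq_iff split: list.splits)

lemma identity_form_alt_forms: "(identity_form :: 'v::real_vector list \<Rightarrow> 'v) \<in> alt_forms 1"
proof -
  have "(identity_form :: 'v list \<Rightarrow> 'v) \<in> alt_forms (Suc 0)"
  proof (rule alt_forms_SucI)
    show "linear (\<lambda>v::'v. contract v identity_form)"
      by (rule linearI) (auto simp: contract_identity_form)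
  qed (auto simp: identity_form_def contract_identity_form contract_def intro!: alt_forms_0I)
  then show ?thesis by simp
qed

text \<open>Insertion of the identity counts the degree: after contraction with \<open>v\<close>,
  one term is \<open>v\<close> inserted into \<phi>, the other is the induction hypothesis for the
  contracted form.\<close>

lemma nr_comp_identity_form:
  fixes \<phi> :: "'v::euclidean_space list \<Rightarrow> 'u::real_vector"
  assumes "\<phi> \<in> alt_forms k"
  shows "nr_comp identity_form \<phi> = real k *\<^sub>R \<phi>"
  using assms
proof (induction k arbitrary: \<phi>)
  case 0
  then show ?case
    using nr_comp_0_form_right[of \<phi>] by (simp add: alt_forms_0_iff)
next
  case (Suc k)
  show ?case
  proof (rule form_eqI)
    have "form_degree (Suc k) (nr_comp identity_form \<phi>)"
      using nr_comp_alt_forms[OF identity_form_alt_forms Suc.prems] alt_forms_degree by auto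
    then show "nr_comp identity_form \<phi> [] = (real (Suc k) *\<^sub>R \<phi>) []"
      using alt_forms_degree[OF Suc.prems] by (simp add: form_degree_def)
    fix v
    have "nr_comp (contract v identity_form) \<phi> = contract v \<phi>"
      using nr_comp_0_form_left[OF form_degree_contract[OF alt_forms_degree[OF
          identity_form_alt_forms], of v, simplified] Suc.prems]
      by (simp add: contract_identity_form)
    then show "contract v (nr_comp identity_form \<phi>) = contract v (real (Suc k) *\<^sub>R \<phi>)"
      using contract_nr_comp[OF alt_forms_degree[OF identity_form_alt_forms] Suc.prems, of v]
        Suc.IH[OF alt_forms_contract[OF Suc.prems, of v]]
      unfolding contract_scaleR by (simp add: fun_eq_iff scaleR_left_distrib)
  qed
qed

lemma contract_identity_wedge_sum:
  fixes M :: "'v::euclidean_space \<Rightarrow> 'v list \<Rightarrow> 'u::real_vector"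
  shows "contract v (\<Sum>b\<in>Basis. wedge (\<lambda>vs. identity_form vs \<bullet> b) (M b))
    = (\<Sum>b\<in>Basis. (v \<bullet> b) *\<^sub>R M b) - (\<Sum>b\<in>Basis. wedge (\<lambda>vs. identity_form vs \<bullet> b) (contract v (M b)))"
proof -
  have d: "form_degree 1 (\<lambda>vs. identity_form vs \<bullet> b)" for b :: 'v
    by (rule form_degree_inner[OF alt_forms_degree[OF identity_form_alt_forms]])
  have "contract v (wedge (\<lambda>vs. identity_form vs \<bullet> b) (M b))
     = (v \<bullet> b) *\<^sub>R M b - wedge (\<lambda>vs. identity_form vs \<bullet> b) (contract v (M b))" for b
    unfolding contract_wedge[OF d]
    using wedge_0_form_left[OF form_degree_contract[OF d, simplified], of v b "M b"]
    by (simp add: contract_def identity_form_def)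
  then show ?thesis
    by (simp add: contract_sum sum_subtractf)
qed

text \<open>With \<open>Q = id - P\<close> the projection along the image of \<open>P\<close>, a form is horizontal if it factors
  through \<open>Q\<close>. The primitive is \<open>\<integral>\<^sub>0\<^sup>1 t\<^sup>k (d\<^sub>Q\<gamma>)(P x + t Q x) dt\<close>, where \<open>d\<^sub>Q\<close> is the exterior
  derivative in the directions of the image of \<open>Q\<close>; for \<open>k = 0\<close> this is Hadamard's lemma.\<close>

lemma koszul_primitive:
  fixes \<gamma> :: "'v::euclidean_space \<Rightarrow> 'v list \<Rightarrow> 'v" and P :: "'v \<Rightarrow> 'v"
  assumes \<gamma>: "\<gamma> \<in> smooth_sections (alt_forms k)"
    and P: "linear P" and PP: "\<And>x. P (P x) = P x"
    and horizontal: "\<And>x v vs. \<gamma> x (P v # vs) = 0"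
    and closed: "koszul_d \<gamma> = (\<lambda>x. 0)"
    and start: "\<And>x. k = 0 \<Longrightarrow> \<gamma> (P x) = 0"
  obtains \<beta> where "\<beta> \<in> smooth_sections (alt_forms (Suc k))" "koszul_d \<beta> = \<gamma>"
    "\<And>x v vs. \<beta> x (P v # vs) = 0"
proof -
  define Q where "Q x = x - P x" for x
  have Q: "linear Q"
    unfolding Q_def by (intro linear_compose_sub linear_ident P)
  have QP: "Q (P x) = 0" for x
    by (simp add: Q_def PP)
  \<comment> \<open>The segment from P x to x with velocity Q x. Its Q-part at time t is t Q x,
    which is the origin of the weights t^k.\<close>
  define L where "L t x = P x + t *\<^sub>R Q x" for t x
  have Q_L: "Q (L t x) = t *\<^sub>R Q x" for t x
    by (simp add: L_def linear_add[OF Q] linear_cmul[OF Q] QP) (simp add: Q_def linear_diff[OF P] PP)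
  define I :: "(real \<Rightarrow> real) \<Rightarrow> ('v \<Rightarrow> 'v) \<Rightarrow> 'v \<Rightarrow> 'v"
    where "I p f x = integral {0..1} (\<lambda>t. p t *\<^sub>R f (L t x))" for p f x
  have contL: "continuous_on {0..1} (\<lambda>t. f (L t x))" if "smooth f" for f :: "'v \<Rightarrow> 'v" and x
    unfolding L_def by (rule continuous_on_compose2[OF smooth_continuous[OF that, of UNIV]]) (auto
        intro!: continuous_intros)
  have int: "(\<lambda>t. p t *\<^sub>R f (L t x)) integrable_on {0..1}" if "continuous_on {0..1} p" "smooth f"
      for p and f :: "'v \<Rightarrow> 'v" and x
    by (intro integrable_continuous_interval continuous_on_scaleR that contL)
  have I_add: "I p (\<lambda>x. f x + g x) x = I p f x + I p g x" if "continuous_on {0..1} p" "smooth f"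
      "smooth g" for p f g x
    unfolding I_def scaleR_add_right by (intro integral_add int that)
  have I_scale: "I p (\<lambda>x. r *\<^sub>R f x) x = r *\<^sub>R I p f x" for p f x r
    unfolding I_def by (subst integral_cmul[symmetric]) (simp add: mult.commute)
  have I_smooth: "smooth (I p f)" if "continuous_on {0..1} p" "smooth f" for p f
    unfolding I_def[abs_def] L_def by (rule smooth_integral_segment[OF P Q that])
  have pow: "continuous_on {0..1} (\<lambda>t::real. t ^ m)" for m
    by (intro continuous_intros)
  have I_alt: "(\<lambda>vs. I p (\<lambda>y. \<alpha> y vs) x) \<in> alt_forms m"
    if "continuous_on {0..1} p" "\<alpha> \<in> smooth_sections (alt_forms m)" for p m x and \<alpha> :: "'v \<Rightarrow> 'v list
        \<Rightarrow> 'v"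
    by (rule alt_forms_functional[OF _ _ that(2)]) (simp_all add: I_add[OF that(1)] I_scale)

  define G where "G h = deriv_along (\<lambda>x. h) \<gamma>" for h
  have G: "G h \<in> smooth_sections (alt_forms k)" for h
    unfolding G_def by (rule deriv_along_section[OF \<gamma> smooth_const])
  have G_lin: "linear (\<lambda>h. G h x)" for x
    using linear_form_deriv[OF \<gamma>, of x] by (simp add: G_def deriv_along_form_deriv)
  have G_horizontal: "G h x (P v # vs) = 0" for h x v vs
    by (simp add: G_def deriv_along_def horizontal)
  define M where "M h x = (\<lambda>vs. I (\<lambda>t. t ^ k) (\<lambda>y. G (Q h) y vs) x)" for h x
  \<comment> \<open>The exponent is truncated for \<open>k = 0\<close>; there \<open>N\<close>
    enters only through its contractions, which vanish, or with the factor k.\<close>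
  define N where "N x = (\<lambda>vs. I (\<lambda>t. t ^ (k - 1)) (\<lambda>y. \<gamma> y vs) x)" for x
  have M_alt: "M h x \<in> alt_forms k" for h x
    unfolding M_def by (rule I_alt[OF pow G])
  have N_alt: "N x \<in> alt_forms k" for x
    unfolding N_def by (rule I_alt[OF pow \<gamma>])
  have M_lin: "linear (\<lambda>h. M h x)" for x
    by (rule linearI) (simp_all add: M_def linear_add[OF Q] linear_add[OF G_lin] linear_cmul[OF Q]
        linear_cmul[OF G_lin]
        I_add[OF pow] I_scale section_smooth[OF G] fun_eq_iff)
  have M_P: "M (P h) x = 0" for h x
    by (simp add: M_def QP linear_0[OF G_lin] I_def fun_eq_iff)
  have M_horizontal: "contract (P v) (M h x) = 0" for v h x
    by (simp add: M_def contract_def G_horizontal I_def fun_eq_iff)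
  define \<beta> where "\<beta> x = (\<Sum>b\<in>Basis. wedge (\<lambda>vs. identity_form vs \<bullet> b) (M b x))" for x
  have M_sum: "(\<Sum>b\<in>Basis. (v \<bullet> b) *\<^sub>R M b x) = M v x" for v x
  proof -
    interpret linear "\<lambda>h. M h x" by (rule M_lin)
    have "M v x = M (\<Sum>b\<in>Basis. (v \<bullet> b) *\<^sub>R b) x" by (simp add: euclidean_representation)
    then show ?thesis by (simp only: sum scale)
  qed
  have contract_\<beta>: "contract v (\<beta> x) = M v x - (\<Sum>b\<in>Basis. wedge (\<lambda>vs. identity_form vs \<bullet> b)
      (contract v (M b x)))" for v x
    unfolding \<beta>_def contract_identity_wedge_sum M_sum ..
  have 1: "\<beta> \<in> smooth_sections (alt_forms (Suc k))"
    unfolding smooth_sections_alt_forms_iff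
  proof (intro conjI allI)
    have "\<beta> x \<in> alt_forms (1 + k)" for x
      unfolding \<beta>_def by (intro subspace_sum[OF subspace_alt_forms] wedge_alt_forms alt_forms_inner
          identity_form_alt_forms M_alt)
    then show "\<beta> x \<in> alt_forms (Suc k)" for x by simp
    show "smooth (\<lambda>x. \<beta> x vs)" for vs
      unfolding \<beta>_def wedge_def sum_fun_apply M_def
      by (intro smooth_sum smooth_scaleR smooth_const I_smooth pow section_smooth[OF G])
  qed
  have 3: "\<beta> x (P v # vs) = 0" for x v vs
  proof -
    have "contract (P v) (\<beta> x) = 0"
      unfolding contract_\<beta> M_P M_horizontal by simp
    then show ?thesis by (simp add: contract_def fun_eq_iff)
  qed
  have drop_P: "\<phi> (Q v # vs) = \<phi> (v # vs)" if "\<phi> \<in> alt_forms m" "\<And>v. \<phi> (P v # vs) = 0"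
    for \<phi> :: "'v list \<Rightarrow> 'v" and m v vs
    using linear_diff[OF linear_contract[OF that(1)], of v "P v" vs] that(2) by (simp add: Q_def)
  \<comment> \<open>Differentiate the closedness of \<gamma>, whose value at y vanishes when y is
    inserted, in the direction Q b at y = L t x. Horizontality then replaces the inserted y by its
    Q-part t Q x and removes Q from the arguments.\<close>
  have key: "t *\<^sub>R G (Q b) (L t x) (x # vs) = - \<gamma> (L t x) (b # vs)" for t b x vs
  proof -
    let ?y = "L t x"
    have "contract ?y (G (Q b) ?y) + contract (Q b) (\<gamma> ?y) = 0"
      using deriv_along_koszul_d[OF \<gamma>, of "\<lambda>x. Q b" ?y] unfolding closed G_def
      by (simp add: deriv_along_def fun_eq_iff)
    then have "G (Q b) ?y (?y # vs) = - \<gamma> ?y (Q b # vs)"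
      by (simp add: contract_def fun_eq_iff eq_neg_iff_add_eq_0)
    also have "\<gamma> ?y (Q b # vs) = \<gamma> ?y (b # vs)"
      by (rule drop_P[OF section_alt_forms[OF \<gamma>] horizontal])
    also have "G (Q b) ?y (?y # vs) = G (Q b) ?y (Q ?y # vs)"
      by (rule drop_P[OF section_alt_forms[OF G] G_horizontal, symmetric])
    also have "\<dots> = t *\<^sub>R G (Q b) ?y (Q x # vs)"
      unfolding Q_L by (rule linear_cmul[OF linear_contract[OF section_alt_forms[OF G]]])
    also have "G (Q b) ?y (Q x # vs) = G (Q b) ?y (x # vs)"
      by (rule drop_P[OF section_alt_forms[OF G] G_horizontal])
    finally show ?thesis .
  qed
  have contract_M: "contract x (M b x) = - contract b (N x)" for b x
  proof (cases k)
    case 0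
    show ?thesis
      using contract_0_form alt_forms_degree[OF M_alt, of b x] alt_forms_degree[OF N_alt, of x] 0 by
          (metis neg_equal_0_iff_equal)
  next
    case (Suc k')
    show ?thesis
    proof
      fix vs
      have "M b x (x # vs) = integral {0..1} (\<lambda>t. t ^ k' *\<^sub>R (t *\<^sub>R G (Q b) (L t x) (x # vs)))"
        unfolding M_def I_def Suc by (simp add: mult.commute)
      also have "\<dots> = - N x (b # vs)"
        unfolding key N_def I_def Suc by simp
      finally show "contract x (M b x) vs = (- contract b (N x)) vs"
        by (simp add: contract_def)
    qed
  qed
  \<comment> \<open>Contracting \<beta> with x gives \<open>M x x\<close>, and by
    \<open>contract_M\<close> and the degree count the remaining sum contributes k times
    \<open>N x\<close>. Together the integrands form the derivative of t^k \<gamma>(L t x) in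
    t.\<close>
  have 2: "koszul_d \<beta> = \<gamma>"
  proof (intro ext)
    fix x vs
    have "(\<Sum>b\<in>Basis. wedge (\<lambda>vs. identity_form vs \<bullet> b) (contract x (M b x))) = - nr_comp
        identity_form (N x)"
      unfolding contract_M nr_comp_def
      by (simp add: wedge_uminus_right sum_negf)
    then have "koszul_d \<beta> x = M x x + real k *\<^sub>R N x"
      unfolding koszul_d_def contract_\<beta> nr_comp_identity_form[OF N_alt] by simp
    then have "koszul_d \<beta> x vs = I (\<lambda>t. t ^ k) (\<lambda>y. G (Q x) y vs) x + I (\<lambda>t. real k * t ^ (k - 1))
        (\<lambda>y. \<gamma> y vs) x"
      unfolding M_def N_def I_def scaleR_scaleR[symmetric] integral_cmul plus_fun_apply
          scaleR_fun_apply by (simp only:)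
    also have "\<dots> = integral {0..1} (\<lambda>t. t ^ k *\<^sub>R G (Q x) (L t x) vs + (real k * t ^ (k - 1)) *\<^sub>R \<gamma>
        (L t x) vs)"
      unfolding I_def by (intro integral_add[symmetric] int section_smooth[OF G] section_smooth[OF
          \<gamma>] continuous_intros)
    \<comment> \<open>At t = 0 the factor \<open>0 ^ k\<close> vanishes for k > 0; for
      \<open>k = 0\<close> it equals 1, and \<open>start\<close> removes the term.\<close>
    also have "\<dots> = 1 ^ k *\<^sub>R \<gamma> (L 1 x) vs - 0 ^ k *\<^sub>R \<gamma> (L 0 x) vs"
    proof (rule integral_unique[OF fundamental_theorem_of_calculus])
      fix t :: real
      have "((\<lambda>t. \<gamma> (L t x) vs) has_vector_derivative G (Q x) (L t x) vs) (at t within {0..1})"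
      proof -
        have "((\<lambda>t. L t x) has_derivative (\<lambda>s. s *\<^sub>R Q x)) (at t within {0..1})"
          unfolding L_def by (auto intro!: derivative_eq_intros)
        from has_derivative_compose[OF this form_deriv_has_derivative[OF \<gamma>]]
        have "((\<lambda>t. \<gamma> (L t x) vs) has_derivative (\<lambda>s. G (s *\<^sub>R Q x) (L t x) vs)) (at t within {0..1})"
          by (simp add: G_def deriv_along_form_deriv)
        then show ?thesis
          unfolding has_vector_derivative_def linear_cmul[OF G_lin] by simp
      qed
      then show "((\<lambda>t. t ^ k *\<^sub>R \<gamma> (L t x) vs) has_vector_derivative
        t ^ k *\<^sub>R G (Q x) (L t x) vs + (real k * t ^ (k - 1)) *\<^sub>R \<gamma> (L t x) vs) (at t within {0..1})"
        by (intro has_vector_derivative_scaleR) (auto intro!: derivative_eq_intros)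
    qed simp
    also have "\<dots> = \<gamma> x vs"
      using start[of x] by (cases k) (simp_all add: L_def Q_def)
    finally show "koszul_d \<beta> x vs = \<gamma> x vs" .
  qed
  show thesis by (rule that[OF 1 2 3])
qed

section \<open>The subcomplex of a linear subspace\<close>

lemma subspace_projection:
  fixes W :: "'v::real_vector set"
  assumes "subspace W"
  obtains P where "linear P" "\<And>x. P x \<in> W" "\<And>w. w \<in> W \<Longrightarrow> P w = w"
  using linear_exists_left_inverse_on[OF linear_id assms] by (auto simp: image_subset_iff)

text \<open>With P and R projections onto W and S, differentiate the identity R \<circ> f \<circ> P
  = f \<circ> P. The cases used are S = {0} for functions vanishing on W, S = W for vector fields
  tangent to W, and the whole space as domain for W-valued maps.\<close>

lemma frechet_derivative_tangent:
  fixes f :: "'v::euclidean_space \<Rightarrow> 'b::euclidean_space"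
  assumes f: "smooth f" and W: "subspace W" and S: "subspace S" and sub: "\<And>w. w \<in> W \<Longrightarrow> f w \<in> S"
    and w: "w \<in> W" and h: "h \<in> W"
  shows "frechet_derivative f (at w) h \<in> S"
proof -
  obtain P where P: "linear P" "\<And>x. P x \<in> W" "\<And>w. w \<in> W \<Longrightarrow> P w = w"
    using subspace_projection[OF W] by blast
  obtain R where R: "linear R" "\<And>x. R x \<in> S" "\<And>w. w \<in> S \<Longrightarrow> R w = w"
    using subspace_projection[OF S] by blast
  have "(f has_derivative frechet_derivative f (at w)) (at (P w))"
    using smooth_has_derivative[OF f] P(3)[OF w] by simp
  from diff_chain_at[OF linear_imp_has_derivative[OF P(1)] this]
  have D: "(f \<circ> P has_derivative frechet_derivative f (at w) \<circ> P) (at w)" .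
  have "(R \<circ> (f \<circ> P) has_derivative R \<circ> (frechet_derivative f (at w) \<circ> P)) (at w)"
    by (rule diff_chain_at[OF D linear_imp_has_derivative[OF R(1)]])
  moreover have "R \<circ> (f \<circ> P) = f \<circ> P"
    using R(3) sub P(2) by (auto simp: fun_eq_iff)
  ultimately have "R \<circ> (frechet_derivative f (at w) \<circ> P) = frechet_derivative f (at w) \<circ> P"
    using has_derivative_unique[OF _ D] by metis
  from fun_cong[OF this, of h] show ?thesis
    using R(2)[of "frechet_derivative f (at w) h"] P(3)[OF h] by simp
qed

section \<open>Stability under the differential and the bracket\<close>

lemma K_forms_iff:
  assumes "subspace W"
  shows "\<phi> \<in> K_forms W k \<longleftrightarrow> \<phi> \<in> alt_forms k \<and> (\<forall>w\<in>W. \<forall>vs. \<phi> (w # vs) \<in> W)"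
proof -
  have "\<phi> (w # vs) \<in> W" if "\<phi> \<in> K_forms W k" "w \<in> W" for w vs
  proof (cases "length vs = k - 1")
    case False
    then have "\<phi> (w # vs) = 0"
      using that(1) unfolding K_forms_def alt_forms_def by auto
    then show ?thesis using subspace_0[OF assms] by simp
  qed (use that in \<open>auto simp: K_forms_def\<close>)
  then show ?thesis by (auto simp: K_forms_def)
qed

lemma K_forms_subset: "K_forms W k \<subseteq> alt_forms k"
  by (auto simp: K_forms_def)

lemma subspace_K_forms: "subspace W \<Longrightarrow> subspace (K_forms W k)"
  by (rule subspaceI) (simp_all add: K_forms_iff subspace_0 subspace_add subspace_scale
      subspace_alt_forms)

lemma K_section_iff:
  assumes "subspace W"
  shows "\<alpha> \<in> smooth_sections (K_forms W k) \<longleftrightarrow>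
    \<alpha> \<in> smooth_sections (alt_forms k) \<and> (\<forall>x. \<forall>w\<in>W. \<forall>vs. \<alpha> x (w # vs) \<in> W)"
  unfolding smooth_sections_alt_forms_iff smooth_sections_iff[OF subspace_K_forms[OF assms]
      K_forms_subset] K_forms_iff[OF assms]
  by blast

lemma K_section_section: "subspace W \<Longrightarrow> \<alpha> \<in> smooth_sections (K_forms W k) \<Longrightarrow> \<alpha> \<in> smooth_sections
    (alt_forms k)"
  by (simp add: K_section_iff)

text \<open>The basis need not be adapted to W, so membership in W cannot be read off from the
  defining sum. In this basis-free form whole values of \<alpha> are inserted into \<beta>.\<close>

lemma nr_comp_insertion:
  fixes \<alpha> :: "'v::euclidean_space list \<Rightarrow> 'v" and \<beta> :: "'v list \<Rightarrow> 'u::real_vector"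
  assumes "\<beta> \<in> alt_forms l"
  shows "nr_comp \<alpha> \<beta> vs = (\<Sum>S\<in>Pow {..<length vs}.
    shuffle_sign (length vs) S *\<^sub>R \<beta> (\<alpha> (nths vs S) # nths vs ({..<length vs} - S)))"
proof -
  have lin: "(\<Sum>b\<in>Basis. (v \<bullet> b) *\<^sub>R \<beta> (b # us)) = \<beta> (v # us)" for v us
    using fun_cong[OF contract_basis_sum[OF assms, of v], of us] by (simp add: contract_def
        sum_fun_apply)
  have "nr_comp \<alpha> \<beta> vs = (\<Sum>S\<in>Pow {..<length vs}. \<Sum>b\<in>Basis.
      (shuffle_sign (length vs) S * (\<alpha> (nths vs S) \<bullet> b)) *\<^sub>R \<beta> (b # nths vs ({..<length vs} - S)))"
    unfolding nr_comp_def sum_fun_apply wedge_def contract_def by (rule sum.swap)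
  also have "\<dots> = (\<Sum>S\<in>Pow {..<length vs}.
      shuffle_sign (length vs) S *\<^sub>R \<beta> (\<alpha> (nths vs S) # nths vs ({..<length vs} - S)))"
    by (simp only: scaleR_scaleR[symmetric] scaleR_sum_right[symmetric] lin)
  finally show ?thesis .
qed

text \<open>By \<open>contract_nr_comp\<close> an argument from W enters either \<alpha>, whose
  value then lies in W and goes into the first slot of \<beta>, or \<beta> itself.\<close>

lemma K_forms_nr_comp:
  assumes W: "subspace W" and \<alpha>: "\<alpha> \<in> K_forms W k" and \<beta>: "\<beta> \<in> K_forms W (Suc l)"
  shows "nr_comp \<alpha> \<beta> \<in> K_forms W (k + l)"
  unfolding K_forms_iff[OF W]
proof (intro conjI ballI allI)
  have \<alpha>': "\<alpha> \<in> alt_forms k" "\<And>w vs. w \<in> W \<Longrightarrow> \<alpha> (w # vs) \<in> W"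
    and \<beta>': "\<beta> \<in> alt_forms (Suc l)" "\<And>w vs. w \<in> W \<Longrightarrow> \<beta> (w # vs) \<in> W"
    using \<alpha> \<beta> by (auto simp: K_forms_iff[OF W])
  show "nr_comp \<alpha> \<beta> \<in> alt_forms (k + l)"
    by (rule nr_comp_alt_forms[OF \<alpha>'(1) \<beta>'(1)])
  fix w vs assume w: "w \<in> W"
  have 1: "nr_comp (contract w \<alpha>) \<beta> vs \<in> W"
    unfolding nr_comp_insertion[OF \<beta>'(1)]
    by (intro subspace_sum[OF W] subspace_scale[OF W] \<beta>'(2)) (simp add: contract_def \<alpha>'(2) w)
  have 2: "nr_comp \<alpha> (contract w \<beta>) vs \<in> W"
    unfolding nr_comp_insertion[OF alt_forms_contract[OF \<beta>'(1)]]
    by (intro subspace_sum[OF W] subspace_scale[OF W]) (simp add: contract_def \<beta>'(2) w)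
  have "contract w (nr_comp \<alpha> \<beta>) vs \<in> W"
    unfolding contract_nr_comp[OF alt_forms_degree[OF \<alpha>'(1)] \<beta>'(1)]
    using 1 2 by (auto intro!: subspace_diff[OF W] subspace_scale[OF W])
  then show "nr_comp \<alpha> \<beta> (w # vs) \<in> W"
    by (simp add: contract_def)
qed

text \<open>The Euler vector is moved behind the argument from W at the cost of a sign.\<close>

lemma K_section_koszul_d:
  assumes W: "subspace W" and \<alpha>: "\<alpha> \<in> smooth_sections (K_forms W (Suc k))"
  shows "koszul_d \<alpha> \<in> smooth_sections (K_forms W k)"
  unfolding K_section_iff[OF W]
proof (intro conjI allI ballI)
  note \<alpha>' = K_section_section[OF W \<alpha>]
  show "koszul_d \<alpha> \<in> smooth_sections (alt_forms k)"
    using koszul_d_section[OF \<alpha>'] by simp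
  fix x w vs assume w: "w \<in> W"
  have "\<alpha> x (x # w # vs) = - \<alpha> x (w # x # vs)"
    using contract_contract_anticomm[OF section_alt_forms[OF \<alpha>', of x], of w x] by (simp add:
        contract_def fun_eq_iff)
  then show "koszul_d \<alpha> x (w # vs) \<in> W"
    using \<alpha> w subspace_neg[OF W] unfolding K_section_iff[OF W] koszul_d_def contract_def by simp
qed

lemma K_section_nr_act:
  assumes W: "subspace W" and \<alpha>: "\<alpha> \<in> smooth_sections (K_forms W (Suc k))" and \<beta>: "\<beta> \<in>
      smooth_sections (K_forms W (Suc l))"
  shows "nr_act (Suc k) \<alpha> \<beta> \<in> smooth_sections (K_forms W (Suc (k + l)))"
  unfolding K_section_iff[OF W]
proof (intro conjI allI ballI)
  note \<alpha>' = K_section_section[OF W \<alpha>] and \<beta>' = K_section_section[OF W \<beta>]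
  show "nr_act (Suc k) \<alpha> \<beta> \<in> smooth_sections (alt_forms (Suc (k + l)))"
    using nr_act_section[OF \<alpha>' \<beta>'] by simp
  fix x w vs assume w: "w \<in> W"
  have "nr_comp (\<alpha> x) (\<beta> x) \<in> K_forms W (Suc k + l)"
    using \<alpha> \<beta> by (intro K_forms_nr_comp[OF W]) (auto simp: K_section_iff[OF W] K_forms_iff[OF W]
        section_alt_forms)
  then have "nr_comp (\<alpha> x) (\<beta> x) (w # vs) \<in> W"
    using w by (simp add: K_forms_iff[OF W])
  \<comment> \<open>A derivative of a W-valued map is W-valued: the tangency lemma with the whole
    space as domain.\<close>
  moreover have "deriv_along (koszul_anchor \<alpha>) \<beta> x (w # vs) \<in> W"
    unfolding deriv_along_def
    by (rule frechet_derivative_tangent[OF section_smooth[OF \<beta>'] subspace_UNIV W]) (use \<beta> w in \<open>auto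
        simp: K_section_iff[OF W]\<close>)
  ultimately show "nr_act (Suc k) \<alpha> \<beta> x (w # vs) \<in> W"
    using subspace_0[OF W] by (auto simp: nr_act_def intro!: subspace_add[OF W])
qed

lemma K_section_nr_bracket:
  assumes W: "subspace W" and \<alpha>: "\<alpha> \<in> smooth_sections (K_forms W (Suc k))" and \<beta>: "\<beta> \<in>
      smooth_sections (K_forms W (Suc l))"
  shows "nr_bracket (Suc k) (Suc l) \<alpha> \<beta> \<in> smooth_sections (K_forms W (Suc (k + l)))"
  unfolding nr_bracket_nr_act
  using K_section_nr_act[OF W \<alpha> \<beta>] K_section_nr_act[OF W \<beta> \<alpha>]
  by (intro smooth_sections_diff_scaleR[OF subspace_K_forms[OF W] K_forms_subset]) (simp_all add:
      add.commute)

text \<open>The \<open>W\<close>-component of a closed section has a primitive for the trivial projection \<open>P = 0\<close>; the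
  complementary component is horizontal, and its primitive along \<open>W\<close> is horizontal again. A section
  for \<open>k = 0\<close> is a vector field.\<close>

lemma K_section_primitive:
  fixes W :: "'v::euclidean_space set"
  assumes W: "subspace W"
    and \<alpha>: "\<alpha> \<in> smooth_sections (alt_forms k)" and K: "\<And>x w vs. w \<in> W \<Longrightarrow> \<alpha> x (w # vs) \<in> W"
    and closed: "koszul_d \<alpha> = (\<lambda>x. 0)"
    and start: "k = 0 \<Longrightarrow> \<alpha> 0 [] = 0" "\<And>w. k = 0 \<Longrightarrow> w \<in> W \<Longrightarrow> \<alpha> w [] \<in> W"
  obtains \<beta> where "\<beta> \<in> smooth_sections (K_forms W (Suc k))" "koszul_d \<beta> = \<alpha>"
proof -
  obtain P where P: "linear P" "\<And>x. P x \<in> W" "\<And>w. w \<in> W \<Longrightarrow> P w = w"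
    using subspace_projection[OF W] by blast
  have image: "(\<lambda>x vs. L (\<gamma> x vs)) \<in> smooth_sections (alt_forms m)"
    if "linear L" "\<gamma> \<in> smooth_sections (alt_forms m)" for L :: "'v \<Rightarrow> 'v" and m and \<gamma> :: "'v \<Rightarrow> 'v
        list \<Rightarrow> 'v"
    using that(2) alt_forms_linear_image[OF that(1)] smooth_linear[OF that(1)]
    unfolding smooth_sections_alt_forms_iff by blast
  have d_image: "koszul_d (\<lambda>x vs. L (\<gamma> x vs)) = (\<lambda>x vs. L (koszul_d \<gamma> x vs))" for L and \<gamma> :: "'v \<Rightarrow>
      'v list \<Rightarrow> 'v"
    by (simp add: koszul_d_def contract_def)
  have closed': "koszul_d (\<lambda>x vs. L (\<alpha> x vs)) = (\<lambda>x. 0)" if "linear L" for L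
    unfolding d_image closed using linear_0[OF that] by (simp add: fun_eq_iff)
  have Q: "linear (\<lambda>v. v - P v)"
    by (intro linear_compose_sub linear_ident P)
  have nil: "\<phi> = 0" if "\<phi> \<in> alt_forms k" "k = 0" "\<phi> [] = 0" for \<phi> :: "'v list \<Rightarrow> 'v"
  proof
    fix vs show "\<phi> vs = 0 vs"
      using that alt_forms_degree[OF that(1)] by (cases vs) (auto simp: form_degree_def)
  qed
  \<comment> \<open>For the projection 0 every form is horizontal, and the boundary condition at
    \<open>k = 0\<close> is vanishing at the origin.\<close>
  obtain \<beta>1 where \<beta>1: "\<beta>1 \<in> smooth_sections (alt_forms (Suc k))" "koszul_d \<beta>1 = (\<lambda>x vs. P (\<alpha> x vs))"
  proof (rule koszul_primitive[OF image[OF P(1) \<alpha>], of "\<lambda>x. 0"])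
    show "P (\<alpha> x (0 # vs)) = 0" for x vs
      using linear_0[OF linear_contract[OF section_alt_forms[OF \<alpha>]]] linear_0[OF P(1)] by simp
    show "(\<lambda>vs. P (\<alpha> 0 vs)) = 0" if "k = 0"
      by (rule nil[OF section_alt_forms[OF image[OF P(1) \<alpha>]] that]) (simp add: start that
          linear_0[OF P(1)])
  qed (auto simp: linear_zero closed'[OF P(1)])
  \<comment> \<open>An argument from W gives a value in W, which the complementary projection kills;
    at \<open>k = 0\<close> the same holds for values at points of W.\<close>
  obtain \<beta>2 where \<beta>2: "\<beta>2 \<in> smooth_sections (alt_forms (Suc k))" "koszul_d \<beta>2 = (\<lambda>x vs. \<alpha> x vs - P
      (\<alpha> x vs))"
    "\<And>x v vs. \<beta>2 x (P v # vs) = 0"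
  proof (rule koszul_primitive[OF image[OF Q \<alpha>] P(1)])
    show "\<alpha> x (P v # vs) - P (\<alpha> x (P v # vs)) = 0" for x v vs
      using K[OF P(2)] P(3) by simp
    show "(\<lambda>vs. \<alpha> (P x) vs - P (\<alpha> (P x) vs)) = 0" if "k = 0" for x
      by (rule nil[OF section_alt_forms[OF image[OF Q \<alpha>]] that]) (simp add: start that P)
  qed (auto simp: P closed'[OF Q])
  \<comment> \<open>A constant linear map on values commutes with \<open>koszul_d\<close>.
    Projecting forces the first part into W, and the second part vanishes on arguments from
    W.\<close>
  define \<beta> where "\<beta> x = (\<lambda>vs. P (\<beta>1 x vs)) + \<beta>2 x" for x
  have "\<beta> \<in> smooth_sections (alt_forms (Suc k))"
    unfolding \<beta>_def[abs_def]
    by (rule smooth_sections_add[OF subspace_alt_forms order_refl image[OF P(1) \<beta>1(1)] \<beta>2(1)])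
  moreover have "\<beta> x (w # vs) \<in> W" if "w \<in> W" for x w vs
    using \<beta>2(3)[of x w vs] P(3)[OF that] by (simp add: \<beta>_def P(2))
  ultimately have "\<beta> \<in> smooth_sections (K_forms W (Suc k))"
    unfolding K_section_iff[OF W] by blast
  moreover have "koszul_d \<beta> = \<alpha>"
  proof (intro ext)
    fix x vs
    have "koszul_d \<beta> x vs = P (koszul_d \<beta>1 x vs) + koszul_d \<beta>2 x vs"
      by (simp add: koszul_d_def contract_def \<beta>_def)
    then show "koszul_d \<beta> x vs = \<alpha> x vs"
      unfolding \<beta>1(2) \<beta>2(2) by (simp add: P)
  qed
  ultimately show thesis by (rule that)
qed

lemma koszul_exact:
  assumes W: "subspace W"
  shows "{\<alpha> \<in> smooth_sections (K_forms W (Suc k)). koszul_d \<alpha> = (\<lambda>x. 0)} = koszul_d `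
      smooth_sections (K_forms W (Suc (Suc k)))"
proof (intro set_eqI iffI)
  fix \<alpha> assume "\<alpha> \<in> {\<alpha> \<in> smooth_sections (K_forms W (Suc k)). koszul_d \<alpha> = (\<lambda>x. 0)}"
  then have \<alpha>: "\<alpha> \<in> smooth_sections (alt_forms (Suc k))" "\<And>x w vs. w \<in> W \<Longrightarrow> \<alpha> x (w # vs) \<in> W"
      "koszul_d \<alpha> = (\<lambda>x. 0)"
    by (auto simp: K_section_iff[OF W, of _ "Suc k"])
  obtain \<beta> where "\<beta> \<in> smooth_sections (K_forms W (Suc (Suc k)))" "koszul_d \<beta> = \<alpha>"
    by (rule K_section_primitive[OF W \<alpha>]) auto
  then show "\<alpha> \<in> koszul_d ` smooth_sections (K_forms W (Suc (Suc k)))"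
    by blast
next
  fix \<alpha> assume "\<alpha> \<in> koszul_d ` smooth_sections (K_forms W (Suc (Suc k)))"
  then show "\<alpha> \<in> {\<alpha> \<in> smooth_sections (K_forms W (Suc k)). koszul_d \<alpha> = (\<lambda>x. 0)}"
    using K_section_koszul_d[OF W] koszul_d_koszul_d[OF K_section_section[OF W]] by auto
qed

lemma koszul_anchor_eq_0_iff:
  fixes \<alpha> :: "'v::euclidean_space \<Rightarrow> 'v list \<Rightarrow> 'v"
  assumes "\<alpha> \<in> smooth_sections (alt_forms 1)"
  shows "koszul_anchor \<alpha> = (\<lambda>x. 0) \<longleftrightarrow> koszul_d \<alpha> = (\<lambda>x. 0)"
proof -
  have "koszul_d \<alpha> x vs = 0" if "koszul_d \<alpha> x [] = 0" for x vs
    using section_degree[OF koszul_d_section[OF assms], of x] that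
    by (cases vs) (auto simp: form_degree_def)
  then have "koszul_d \<alpha> x = 0 \<longleftrightarrow> koszul_d \<alpha> x [] = 0" for x
    by (auto simp: fun_eq_iff[of "koszul_d \<alpha> x"])
  then show ?thesis
    by (simp add: koszul_anchor_eq_koszul_d fun_eq_iff[of "koszul_anchor \<alpha>"] fun_eq_iff[of "koszul_d
        \<alpha>"])
qed

section \<open>The foliation\<close>

text \<open>Linear functions suffice to test tangency: with u the complementary part of
  \<open>X w\<close>, pairing the complementary part of a point with u is a function in the ideal
  whose derivative along X at w is the squared length of u. The converse differentiates a function
  vanishing on W along W.\<close>

lemma subspace_foliation_iff:
  fixes W :: "'v::euclidean_space set"
  assumes W: "subspace W"
  shows "X \<in> subspace_foliation W \<longleftrightarrow> smooth X \<and> X 0 = 0 \<and> (\<forall>w\<in>W. X w \<in> W)"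
proof (intro iffI conjI ballI)
  assume X: "X \<in> subspace_foliation W"
  then show "smooth X" "X 0 = 0" by (auto simp: subspace_foliation_def)
  fix w assume w: "w \<in> W"
  obtain P where P: "linear P" "\<And>x. P x \<in> W" "\<And>w. w \<in> W \<Longrightarrow> P w = w"
    using subspace_projection[OF W] by blast
  define u where "u = X w - P (X w)"
  define f where "f x = (x - P x) \<bullet> u" for x
  have f: "bounded_linear f"
    unfolding f_def[abs_def] linear_conv_bounded_linear[symmetric]
    by (rule linearI) (simp_all add: linear_add[OF P(1)] linear_cmul[OF P(1)] algebra_simps inner_simps)
  have "f \<in> vanishing_ideal W"
    using smooth_bounded_linear[OF f smooth_ident] P(3) by (auto simp: vanishing_ideal_def) (simp
        add: f_def)
  then have "vf_apply X f w = 0"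
    using X w by (auto simp: subspace_foliation_def vanishing_ideal_def)
  moreover have "vf_apply X f w = f (X w)"
    using frechet_derivative_linear_image[OF f smooth_ident] by (simp add: vf_apply_def)
  ultimately have "u = 0" by (simp add: f_def u_def)
  then show "X w \<in> W" using P(2)[of "X w"] by (simp add: u_def)
next
  assume X: "smooth X \<and> X 0 = 0 \<and> (\<forall>w\<in>W. X w \<in> W)"
  have "vf_apply X f \<in> vanishing_ideal W" if "f \<in> vanishing_ideal W" for f
  proof -
    have f: "smooth f" "\<And>w. w \<in> W \<Longrightarrow> f w \<in> {0}"
      using that by (auto simp: vanishing_ideal_def)
    have "frechet_derivative f (at w) (X w) \<in> {0}" if "w \<in> W" for w
      using frechet_derivative_tangent[OF f(1) W subspace_single_0 f(2) that, of "X w"] X that by blast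
    then show ?thesis
      using smooth_frechet_along[OF f(1), of X] X by (simp add: vanishing_ideal_def vf_apply_def)
  qed
  then show "X \<in> subspace_foliation W"
    using X by (simp add: subspace_foliation_def)
qed

text \<open>For surjectivity, view a vector field as a section of 0-forms. Closedness and the
  condition on arguments from W hold trivially there, and the boundary conditions of
  \<open>K_section_primitive\<close> are those of the foliation.\<close>

lemma koszul_anchor_image:
  fixes W :: "'v::euclidean_space set"
  assumes W: "subspace W"
  shows "koszul_anchor ` smooth_sections (K_forms W 1) = subspace_foliation W"
proof (intro set_eqI iffI)
  fix X assume "X \<in> koszul_anchor ` smooth_sections (K_forms W 1)"
  then obtain \<alpha> where \<alpha>: "X = koszul_anchor \<alpha>" "\<alpha> \<in> smooth_sections (K_forms W 1)" by blast
  note \<alpha>' = K_section_section[OF W \<alpha>(2)]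
  show "X \<in> subspace_foliation W"
    using \<alpha> smooth_koszul_anchor[OF \<alpha>'] linear_0[OF linear_contract[OF section_alt_forms[OF \<alpha>']]]
    by (auto simp: subspace_foliation_iff[OF W] koszul_anchor_def[of \<alpha>] K_section_iff[OF W])
next
  fix X assume X: "X \<in> subspace_foliation W"
  define \<alpha> :: "'v \<Rightarrow> 'v list \<Rightarrow> 'v" where "\<alpha> x = (\<lambda>vs. if vs = [] then X x else 0)" for x
  have "smooth (\<lambda>x. \<alpha> x vs)" for vs
    using X by (cases "vs = []") (simp_all add: \<alpha>_def subspace_foliation_iff[OF W])
  then have \<alpha>: "\<alpha> \<in> smooth_sections (alt_forms 0)"
    by (auto simp: smooth_sections_alt_forms_iff \<alpha>_def intro!: alt_forms_0I)
  have "koszul_d \<alpha> = (\<lambda>x. 0)"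
    by (simp add: koszul_d_def contract_def \<alpha>_def fun_eq_iff)
  then obtain \<beta> where \<beta>: "\<beta> \<in> smooth_sections (K_forms W (Suc 0))" "koszul_d \<beta> = \<alpha>"
    by (rule K_section_primitive[OF W \<alpha>, rotated]) (use X W in \<open>auto simp: \<alpha>_def
        subspace_foliation_iff subspace_0\<close>)
  have "koszul_anchor \<beta> = X"
    using \<beta>(2) by (simp add: koszul_anchor_eq_koszul_d fun_eq_iff \<alpha>_def)
  then show "X \<in> koszul_anchor ` smooth_sections (K_forms W 1)"
    using \<beta>(1) by auto
qed

lemma vf_bracket_zero:
  assumes "smooth X"
  shows "vf_bracket (\<lambda>x. 0) X = (\<lambda>x. 0)" "vf_bracket X (\<lambda>x. 0) = (\<lambda>x. 0)"
  using linear_0[OF smooth_linear_derivative[OF assms]] by (simp_all add: vf_bracket_def fun_eq_iff)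

text \<open>The generators are anchors of constant sections, that is, linear vector fields whose
  endomorphism preserves W. Surjectivity of the anchor supplies globally smooth
  coefficients.\<close>

lemma subspace_foliation_finitely_generated:
  fixes W :: "'v::euclidean_space set"
  assumes W: "subspace W"
  obtains G where "finite G" "G \<subseteq> subspace_foliation W"
    "\<And>X. X \<in> subspace_foliation W \<Longrightarrow> \<exists>c. (\<forall>Y\<in>G. smooth (c Y)) \<and> (\<forall>x. X x = (\<Sum>Y\<in>G. c Y x *\<^sub>R Y x))"
proof -
  obtain F and u :: "'v list \<times> 'v \<Rightarrow> 'v list \<Rightarrow> 'v"
    where F: "finite F" "\<And>i. u i \<in> K_forms W 1" "\<And>\<phi>. \<phi> \<in> K_forms W 1 \<Longrightarrow> \<phi> = (\<Sum>i\<in>F. (\<phi> (fst i) \<bullet> snd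
        i) *\<^sub>R u i)"
    using alt_forms_subspace_coordinates[OF subspace_K_forms[OF W] K_forms_subset] by blast
  define Y where "Y i = koszul_anchor (\<lambda>x. u i)" for i
  have "Y i \<in> subspace_foliation W" for i
  proof -
    have "(\<lambda>x::'v. u i) \<in> smooth_sections (K_forms W 1)"
      using F(2) by (simp add: smooth_sections_iff[OF subspace_K_forms[OF W] K_forms_subset])
    then show ?thesis
      unfolding Y_def koszul_anchor_image[OF W, symmetric] by blast
  qed
  moreover have "\<exists>c. (\<forall>Z\<in>Y ` F. smooth (c Z)) \<and> (\<forall>x. X x = (\<Sum>Z\<in>Y ` F. c Z x *\<^sub>R Z x))"
    if X: "X \<in> subspace_foliation W" for X
  proof -
    obtain \<alpha> where \<alpha>: "X = koszul_anchor \<alpha>" "\<alpha> \<in> smooth_sections (K_forms W 1)"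
      using X unfolding koszul_anchor_image[OF W, symmetric] by blast
    then have \<alpha>': "\<And>x. \<alpha> x \<in> K_forms W 1" "\<And>vs. smooth (\<lambda>x. \<alpha> x vs)"
      by (auto simp: smooth_sections_iff[OF subspace_K_forms[OF W] K_forms_subset])
    define c where "c Z x = (\<Sum>i\<in>{i\<in>F. Y i = Z}. \<alpha> x (fst i) \<bullet> snd i)" for Z x
    have "X x = (\<Sum>Z\<in>Y ` F. c Z x *\<^sub>R Z x)" for x
    proof -
      have "\<alpha> x [x] = (\<Sum>i\<in>F. (\<alpha> x (fst i) \<bullet> snd i) *\<^sub>R u i) [x]"
        using fun_cong[OF F(3)[OF \<alpha>'(1)]] .
      then have "X x = (\<Sum>i\<in>F. (\<alpha> x (fst i) \<bullet> snd i) *\<^sub>R Y i x)"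
        by (simp add: \<alpha>(1) koszul_anchor_def Y_def sum_fun_apply)
      also have "\<dots> = (\<Sum>Z\<in>Y ` F. \<Sum>i\<in>{i\<in>F. Y i = Z}. (\<alpha> x (fst i) \<bullet> snd i) *\<^sub>R Y i x)"
        by (rule sum.image_gen[OF F(1)])
      also have "\<dots> = (\<Sum>Z\<in>Y ` F. c Z x *\<^sub>R Z x)"
        unfolding c_def scaleR_sum_left by (intro sum.cong) auto
      finally show ?thesis .
    qed
    moreover have "smooth (c Z)" for Z
      unfolding c_def[abs_def] by (intro smooth_sum smooth_inner_left \<alpha>'(2))
    ultimately show ?thesis by blast
  qed
  ultimately show thesis
    using F(1) that[of "Y ` F"] by blast
qed

text \<open>By \<open>subspace_foliation_iff\<close> membership of a smooth field is a pointwise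
  condition, so locality is immediate, and one finite generating set serves all points.\<close>

lemma singular_foliation_subspace_foliation:
  fixes W :: "'v::euclidean_space set"
  assumes W: "subspace W"
  shows "singular_foliation (subspace_foliation W)"
  unfolding singular_foliation_def
proof (intro conjI allI ballI impI)
  note iff = subspace_foliation_iff[OF W]
  show "subspace_foliation W \<subseteq> Collect smooth" by (auto simp: iff)
  show "(\<lambda>x. 0) \<in> subspace_foliation W" by (simp add: iff subspace_0[OF W])
  fix X Y :: "'v \<Rightarrow> 'v" assume X: "X \<in> subspace_foliation W"
  show "(\<lambda>x. f x *\<^sub>R X x) \<in> subspace_foliation W" if "smooth f" for f
    using X that by (auto simp: iff intro: subspace_scale[OF W])
  assume Y: "Y \<in> subspace_foliation W"
  show "(\<lambda>x. X x + Y x) \<in> subspace_foliation W"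
    using X Y by (auto simp: iff intro: subspace_add[OF W])
  show "vf_bracket X Y \<in> subspace_foliation W"
    unfolding iff
  proof (intro conjI ballI)
    show "smooth (vf_bracket X Y)"
      unfolding vf_bracket_def using X Y by (auto simp: iff intro!: smooth_diff smooth_frechet_along)
    show "vf_bracket X Y 0 = 0"
      using X Y linear_0[OF smooth_linear_derivative, of X 0] linear_0[OF smooth_linear_derivative,
          of Y 0]
      by (simp add: iff vf_bracket_def)
    show "vf_bracket X Y w \<in> W" if "w \<in> W" for w
      unfolding vf_bracket_def using X Y that
      by (auto simp: iff intro!: subspace_diff[OF W] frechet_derivative_tangent[OF _ W W])
  qed
next
  fix p :: 'v
  obtain G where G: "finite G" "G \<subseteq> subspace_foliation W"
    "\<And>X. X \<in> subspace_foliation W \<Longrightarrow> \<exists>c. (\<forall>Y\<in>G. smooth (c Y)) \<and> (\<forall>x. X x = (\<Sum>Y\<in>G. c Y x *\<^sub>R Y x))"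
    using subspace_foliation_finitely_generated[OF W] by blast
  show "\<exists>U G. open U \<and> p \<in> U \<and> finite G \<and> G \<subseteq> subspace_foliation W \<and>
        (\<forall>X\<in>subspace_foliation W. \<exists>c. (\<forall>Y\<in>G. smooth (c Y)) \<and> (\<forall>x\<in>U. X x = (\<Sum>Y\<in>G. c Y x *\<^sub>R Y x)))"
    by (rule exI[of _ UNIV], rule exI[of _ G]) (use G in simp)
next
  fix X :: "'v \<Rightarrow> 'v"
  assume X: "smooth X \<and> (\<forall>p. \<exists>U. open U \<and> p \<in> U \<and> (\<exists>Y\<in>subspace_foliation W. \<forall>x\<in>U. X x = Y x))"
  have Y: "\<exists>Y. smooth Y \<and> Y 0 = 0 \<and> (\<forall>w\<in>W. Y w \<in> W) \<and> X p = Y p" for p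
  proof -
    obtain U Y where "p \<in> U" "Y \<in> subspace_foliation W" "\<forall>x\<in>U. X x = Y x"
      using X by blast
    then show ?thesis
      unfolding subspace_foliation_iff[OF W] by blast
  qed
  have "X 0 = 0" using Y[of 0] by auto
  moreover have "X w \<in> W" if "w \<in> W" for w using Y[of w] that by auto
  ultimately show "X \<in> subspace_foliation W"
    using X unfolding subspace_foliation_iff[OF W] by blast
qed

section \<open>The graded structure\<close>

lemma nr_act_add_left:
  fixes \<gamma> :: "'v::euclidean_space \<Rightarrow> 'v list \<Rightarrow> 'v"
  assumes "\<gamma> \<in> smooth_sections (alt_forms l)"
  shows "nr_act k (\<lambda>x. \<alpha> x + \<beta> x) \<gamma> x = nr_act k \<alpha> \<gamma> x + nr_act k \<beta> \<gamma> x"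
  unfolding nr_act_def nr_comp_add_left deriv_along_form_deriv koszul_anchor_def plus_fun_apply
    linear_add[OF linear_form_deriv[OF assms]]
  by (simp add: fun_eq_iff)

lemma nr_act_mult_left:
  fixes \<gamma> :: "'v::euclidean_space \<Rightarrow> 'v list \<Rightarrow> 'v"
  assumes "\<gamma> \<in> smooth_sections (alt_forms l)"
  shows "nr_act k (\<lambda>x. f x *\<^sub>R \<alpha> x) \<gamma> x = f x *\<^sub>R nr_act k \<alpha> \<gamma> x"
  unfolding nr_act_def nr_comp_scaleR_left deriv_along_form_deriv koszul_anchor_def scaleR_fun_apply
    linear_cmul[OF linear_form_deriv[OF assms]]
  by (simp add: fun_eq_iff scaleR_add_right)

lemma nr_act_mult_right:
  fixes \<beta> :: "'v::euclidean_space \<Rightarrow> 'v list \<Rightarrow> 'v"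
  assumes \<beta>: "\<beta> \<in> smooth_sections (alt_forms l)" and f: "smooth f"
  shows "nr_act k \<alpha> (\<lambda>x. f x *\<^sub>R \<beta> x) x
    = f x *\<^sub>R nr_act k \<alpha> \<beta> x + (if k = 1 then vf_apply (koszul_anchor \<alpha>) f x *\<^sub>R \<beta> x else 0)"
proof -
  have "deriv_along X (\<lambda>x. f x *\<^sub>R \<beta> x) x = f x *\<^sub>R deriv_along X \<beta> x + vf_apply X f x *\<^sub>R \<beta> x" for X
    unfolding deriv_along_form_deriv vf_apply_def
    by (rule form_derivI[where D="\<lambda>h. f x *\<^sub>R form_deriv \<beta> x h + frechet_derivative f (at x) h *\<^sub>R \<beta>
        x"])
      (auto intro!: has_derivative_scaleR smooth_has_derivative[OF f] form_deriv_has_derivative[OF \<beta>])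
  then show ?thesis
    by (simp add: nr_act_def nr_comp_scaleR_right scaleR_add_right)
qed

text \<open>Linearity over functions, applied to the function 0. The form degrees are arbitrary so
  as to cover sections of positive degree, for which \<open>nat (1 - i)\<close> is
  truncated.\<close>

lemma nr_bracket_zero:
  fixes \<beta> :: "'v::euclidean_space \<Rightarrow> 'v list \<Rightarrow> 'v"
  assumes "\<beta> \<in> smooth_sections (alt_forms m)"
  shows "nr_bracket k l (\<lambda>x. 0) \<beta> = (\<lambda>x. 0)" "nr_bracket l k \<beta> (\<lambda>x. 0) = (\<lambda>x. 0)"
proof -
  have "nr_act k (\<lambda>x. 0) \<beta> x = 0" for x k
    using nr_act_mult_left[OF assms, of k "\<lambda>x. 0" "\<lambda>x. 0" x] by simp
  moreover have "nr_act k \<beta> (\<lambda>x. 0) x = 0" for x k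
    using nr_act_mult_right[OF assms, of "\<lambda>x. 0" k \<beta> x] by (simp add: vf_apply_def)
  ultimately show "nr_bracket k l (\<lambda>x. 0) \<beta> = (\<lambda>x. 0)" "nr_bracket l k \<beta> (\<lambda>x. 0) = (\<lambda>x. 0)"
    by (simp_all add: nr_bracket_nr_act)
qed

section \<open>Passage to integer degrees\<close>

lemma K_forms_above_dim:
  fixes W :: "'v::euclidean_space set"
  assumes "subspace W" "DIM('v) < k"
  shows "K_forms W k = {0}"
  using alt_forms_above_dim[OF _ assms(2)] K_forms_subset subspace_0[OF subspace_K_forms[OF
      assms(1)]] by blast

text \<open>Below the lower cut-off of \<open>K_graded\<close> the forms vanish by dimension as
  well, so one formula covers all non-positive degrees.\<close>

lemma K_graded_nonpositive:
  fixes W :: "'v::euclidean_space set"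
  assumes "subspace W" "i \<le> 0"
  shows "K_graded W i = K_forms W (nat (1 - i))"
proof (cases "1 - int DIM('v) \<le> i")
  case False
  then have "DIM('v) < nat (1 - i)" by linarith
  then show ?thesis
    using False K_forms_above_dim[OF assms(1)] by (simp add: K_graded_def)
qed (use assms in \<open>simp add: K_graded_def\<close>)

lemma K_graded_positive: "i > 0 \<Longrightarrow> K_graded W i = {0}"
  by (simp add: K_graded_def)

lemma subspace_K_graded: "subspace W \<Longrightarrow> subspace (K_graded W i)"
  using subspace_K_forms by (cases "i > 0") (auto simp: K_graded_positive K_graded_nonpositive)

lemma K_graded_subset:
  assumes "subspace W"
  shows "K_graded W i \<subseteq> alt_forms (nat (1 - i))"
  using K_forms_subset subspace_0[OF subspace_alt_forms]
  by (cases "i > 0") (auto simp: K_graded_positive K_graded_nonpositive[OF assms])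

lemma smooth_sections_zero: "smooth_sections {0} = {\<lambda>x. 0}"
proof -
  have "s x = 0" if s: "s \<in> smooth_sections {0}" for s :: "'a \<Rightarrow> 'b" and x
  proof -
    obtain B c where B: "B \<subseteq> {0}" "\<forall>x. s x = (\<Sum>b\<in>B. c b x *\<^sub>R b)"
      using s unfolding smooth_sections_def mem_Collect_eq by (elim exE conjE) (rule that)
    have "(\<Sum>b\<in>B. c b x *\<^sub>R b) = 0"
      by (rule sum.neutral) (use B(1) in auto)
    then show ?thesis using B(2) by simp
  qed
  then show ?thesis
    using zero_section by blast
qed

text \<open>Reduces the structure identities to natural form degrees: a section of degree - int k is
  a (k+1)-form, and in positive degree only the zero section is left.\<close>

lemma graded_section_cases:
  assumes "subspace W" "a \<in> smooth_sections (K_graded W i)"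
  obtains "i > 0" "a = (\<lambda>x. 0)" | k where "i = - int k" "a \<in> smooth_sections (K_forms W (Suc k))"
proof (cases "i > 0")
  case True
  then show ?thesis using assms(2) that(1) by (simp add: K_graded_positive smooth_sections_zero)
next
  case False
  then have "i = - int (nat (- i))" "nat (1 - i) = Suc (nat (- i))" by linarith+
  then show ?thesis using assms that(2)[of "nat (- i)"] False by (simp add: K_graded_nonpositive)
qed

lemma K_graded_minus_int: "subspace W \<Longrightarrow> K_graded W (- int k) = K_forms W (Suc k)"
  by (simp add: K_graded_nonpositive nat_add_distrib flip: of_nat_Suc)

lemma graded_bracket_minus_int: "graded_bracket (- int k) (- int l) = nr_bracket (Suc k) (Suc l)"
  by (simp add: graded_bracket_def nat_add_distrib)

lemma ksign_minus_int: "ksign (- int k) = (-1) ^ k" "ksign (- int k * - int l) = (-1) ^ (k * l)"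
  by (simp_all add: ksign_def flip: of_nat_mult)

lemma dg_lie_algebroid_K_graded:
  fixes W :: "'v::euclidean_space set"
  assumes W: "subspace W"
  shows "dg_lie_algebroid (K_graded W) graded_d koszul_anchor graded_bracket"
proof -
  let ?\<Gamma> = "\<lambda>i. smooth_sections (K_graded W i) :: ('v \<Rightarrow> 'v list \<Rightarrow> 'v) set"
  note iff = smooth_sections_iff[OF subspace_K_graded[OF W] K_graded_subset[OF W]]
  note zero_sec = zero_section
  note cases_sec = graded_section_cases[OF W, consumes 1, case_names positive nonpositive]
  note sec = K_section_section[OF W]
  have alt: "a \<in> smooth_sections (alt_forms (nat (1 - i)))" if "a \<in> ?\<Gamma> i" for a i
    using that K_graded_subset[OF W] unfolding iff smooth_sections_alt_forms_iff by blast
  have br0: "graded_bracket i k (\<lambda>x. 0) b = (\<lambda>x. 0)" "graded_bracket k i b (\<lambda>x. 0) = (\<lambda>x. 0)"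
    if "b \<in> ?\<Gamma> k" for i k b
    unfolding graded_bracket_def by (rule nr_bracket_zero[OF alt[OF that]])+
  have d_zero: "graded_d i (\<lambda>x. 0) = (\<lambda>x. 0 :: 'v list \<Rightarrow> 'v)" for i
    by (simp add: graded_d_def koszul_d_def)
  have d_closed: "graded_d i a \<in> ?\<Gamma> (i + 1)" if a: "a \<in> ?\<Gamma> i" for i a
    using a
  proof (cases rule: cases_sec)
    case (nonpositive k)
    then show ?thesis
    proof (cases k)
      case (Suc l)
      then show ?thesis
        using nonpositive K_section_koszul_d[OF W] K_graded_minus_int[OF W, of l] by (simp add:
            graded_d_def)
    qed (simp add: graded_d_def zero_sec)
  qed (simp add: graded_d_def zero_sec)
  have br_closed: "graded_bracket i k a b \<in> ?\<Gamma> (i + k)" if a: "a \<in> ?\<Gamma> i" and b: "b \<in> ?\<Gamma> k" for i k a b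
    using a
  proof (cases rule: cases_sec)
    case positive
    then show ?thesis using br0[OF b] zero_sec by simp
  next
    case (nonpositive p)
    note p = this
    show ?thesis using b
    proof (cases rule: cases_sec)
      case positive
      then show ?thesis using br0[OF a] zero_sec by simp
    next
      case (nonpositive q)
      then show ?thesis
        using p K_section_nr_bracket[OF W, of a p b q] K_graded_minus_int[OF W, of "p + q"]
        by (simp add: graded_bracket_minus_int)
    qed
  qed
  have add_sec: "(\<lambda>x. a x + b x) \<in> ?\<Gamma> i" if "a \<in> ?\<Gamma> i" "b \<in> ?\<Gamma> i" for i a b
    by (rule smooth_sections_add[OF subspace_K_graded[OF W] K_graded_subset[OF W] that])
  have mult_sec: "(\<lambda>x. f x *\<^sub>R a x) \<in> ?\<Gamma> i" if "a \<in> ?\<Gamma> i" "smooth f" for i a f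
    by (rule smooth_sections_mult[OF subspace_K_graded[OF W] K_graded_subset[OF W] that])
  have ext_smooth: "smooth (extended_anchor koszul_anchor i a)" if "a \<in> ?\<Gamma> i" for i a
    using smooth_koszul_anchor[OF alt[OF that]] by (simp add: extended_anchor_def)
  have ext_zero: "extended_anchor koszul_anchor i (\<lambda>x. 0 :: 'v list \<Rightarrow> 'v) = (\<lambda>x. 0)" for i
    by (simp add: extended_anchor_def koszul_anchor_def)
  show ?thesis
  proof
    fix i k l :: int and a b c :: "'v \<Rightarrow> 'v list \<Rightarrow> 'v" and f :: "'v \<Rightarrow> real"
    show "subspace (K_graded W i)" by (rule subspace_K_graded[OF W])
    show "\<exists>B. finite B \<and> span B = K_graded W i"
      by (rule alt_forms_subspace_finite_span[OF subspace_K_graded[OF W] K_graded_subset[OF W]])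
    show "K_graded W i = {0}" if "i > 0" by (rule K_graded_positive[OF that])
    show "graded_d i a \<in> ?\<Gamma> (i + 1)" if "a \<in> ?\<Gamma> i" by (rule d_closed[OF that])
    show "graded_d i (\<lambda>x. a x + b x) = (\<lambda>x. graded_d i a x + graded_d i b x)"
      by (simp add: graded_d_def koszul_d_def contract_add)
    show "graded_d i (\<lambda>x. f x *\<^sub>R a x) = (\<lambda>x. f x *\<^sub>R graded_d i a x)"
      by (simp add: graded_d_def koszul_d_def contract_scaleR)
    show "graded_d (i + 1) (graded_d i a) = (\<lambda>x. 0)" if "a \<in> ?\<Gamma> i"
      using koszul_d_koszul_d[OF alt[OF that]] by (simp add: graded_d_def)
    show "smooth (koszul_anchor a)" if "a \<in> ?\<Gamma> 0" by (rule smooth_koszul_anchor[OF alt[OF that]])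
    show "koszul_anchor (\<lambda>x. a x + b x) = (\<lambda>x. koszul_anchor a x + koszul_anchor b x)"
      by (simp add: koszul_anchor_def)
    show "koszul_anchor (\<lambda>x. f x *\<^sub>R a x) = (\<lambda>x. f x *\<^sub>R koszul_anchor a x)"
      by (simp add: koszul_anchor_def)
    show "koszul_anchor (graded_d (- 1) a) = (\<lambda>x. 0)" if "a \<in> ?\<Gamma> (- 1)"
      using koszul_anchor_koszul_d[OF alt[OF that]] by (simp add: graded_d_def)
  next
    fix i k :: int and a b :: "'v \<Rightarrow> 'v list \<Rightarrow> 'v"
    assume a: "a \<in> ?\<Gamma> i" and b: "b \<in> ?\<Gamma> k"
    show "graded_bracket i k a b \<in> ?\<Gamma> (i + k)" by (rule br_closed[OF a b])
    show "graded_bracket i k a (\<lambda>x. b x + c x) = (\<lambda>x. graded_bracket i k a b x + graded_bracket i k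
        a c x)"
      if c: "c \<in> ?\<Gamma> k" for c
    proof
      fix x
      show "graded_bracket i k a (\<lambda>x. b x + c x) x = graded_bracket i k a b x + graded_bracket i k a
          c x"
        \<comment> \<open>Additivity is the difference rule with \<open>r = -1\<close>.\<close>
        using nr_act_diff_right[OF alt[OF b] alt[OF c], of "nat (1 - i)" a "-1" x]
        unfolding graded_bracket_def nr_bracket_nr_act nr_act_add_left[OF alt[OF a]]
        by (simp add: algebra_simps)
    qed
    show "graded_bracket i k a b = (\<lambda>x. - ksign (i * k) *\<^sub>R graded_bracket k i b a x)"
      using a
    proof (cases rule: cases_sec)
      case positive
      then show ?thesis using br0[OF b] by simp
    next
      case (nonpositive p)
      note p = this
      show ?thesis using b
      proof (cases rule: cases_sec)
        case positive
        then show ?thesis using br0[OF a] by simp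
      next
        case (nonpositive q)
        show ?thesis
          unfolding p(1) nonpositive(1) graded_bracket_minus_int ksign_minus_int nr_bracket_nr_act
          by (simp add: fun_eq_iff algebra_simps flip: power_mult_distrib)
      qed
    qed
    show "graded_bracket i k a (\<lambda>x. f x *\<^sub>R b x)
      = (\<lambda>x. f x *\<^sub>R graded_bracket i k a b x + vf_apply (extended_anchor koszul_anchor i a) f x *\<^sub>R
          b x)"
      if f: "smooth f" for f
      using a
    proof (cases rule: cases_sec)
      case positive
      then show ?thesis using br0[OF b] br0[OF mult_sec[OF b f]] linear_0[OF
          smooth_linear_derivative[OF f]]
        by (simp add: ext_zero vf_apply_def)
    next
      case (nonpositive p)
      note p = this
      show ?thesis
      proof
        fix x
        have "vf_apply (extended_anchor koszul_anchor i a) f x = (if p = 0 then vf_apply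
            (koszul_anchor a) f x else 0)"
          using p(1) linear_0[OF smooth_linear_derivative[OF f]] by (simp add: extended_anchor_def
              vf_apply_def)
        moreover have "nat (1 - i) = Suc p" using p(1) by simp
        ultimately show "graded_bracket i k a (\<lambda>x. f x *\<^sub>R b x) x
           = f x *\<^sub>R graded_bracket i k a b x + vf_apply (extended_anchor koszul_anchor i a) f x *\<^sub>R
               b x"
          unfolding graded_bracket_def nr_bracket_nr_act nr_act_mult_left[OF alt[OF a]]
              nr_act_mult_right[OF alt[OF b] f]
          by (simp add: scaleR_diff_right mult.commute)
      qed
    qed
    show "extended_anchor koszul_anchor (i + k) (graded_bracket i k a b)
      = vf_bracket (extended_anchor koszul_anchor i a) (extended_anchor koszul_anchor k b)"
    proof (cases "i = 0 \<and> k = 0")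
      case True
      have "a \<in> smooth_sections (alt_forms 1)" "b \<in> smooth_sections (alt_forms 1)"
        using alt[OF a] alt[OF b] True by simp_all
      then show ?thesis
        using True koszul_anchor_nr_bracket by (simp add: extended_anchor_def graded_bracket_def)
    next
      case False
      have "extended_anchor koszul_anchor i a = (\<lambda>x. 0) \<or> extended_anchor koszul_anchor k b = (\<lambda>x. 0)"
        using False by (auto simp: extended_anchor_def)
      then have "vf_bracket (extended_anchor koszul_anchor i a) (extended_anchor koszul_anchor k b)
          = (\<lambda>x. 0)"
        using vf_bracket_zero ext_smooth[OF a] ext_smooth[OF b] by auto
      moreover have "extended_anchor koszul_anchor (i + k) (graded_bracket i k a b) = (\<lambda>x. 0)"
      \<comment> \<open>Degrees of opposite sign may also add up to 0; then one of them is positive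
        and its section is zero.\<close>
      proof (cases "i + k = 0")
        case True
        then have "i > 0 \<or> k > 0" using False by linarith
        then have "graded_bracket i k a b = (\<lambda>x. 0)"
          using a b br0[OF a] br0[OF b] by (auto simp: K_graded_positive smooth_sections_zero)
        then show ?thesis by (simp add: ext_zero)
      qed (simp add: extended_anchor_def)
      ultimately show ?thesis by simp
    qed
    show "graded_d (i + k) (graded_bracket i k a b)
      = (\<lambda>x. graded_bracket (i + 1) k (graded_d i a) b x + ksign i *\<^sub>R graded_bracket i (k + 1) a
          (graded_d k b) x)"
      using a
    proof (cases rule: cases_sec)
      case positive
      then show ?thesis using br0[OF b] br0[OF d_closed[OF b]] by (simp add: d_zero)
    next
      case (nonpositive p)
      note p = this
      show ?thesis using b
      proof (cases rule: cases_sec)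
        case positive
        then show ?thesis using br0[OF a] br0[OF d_closed[OF a]] by (simp add: d_zero)
      next
        case (nonpositive q)
        note q = this
        \<comment> \<open>For \<open>p = 0\<close> or \<open>q = 0\<close> the form degree 0 stands
          for degree 1; \<open>graded_d\<close> returns the zero section there, and \<open>z\<close>
          applies.\<close>
        have bp: "graded_bracket (- int p + 1) (- int q) = nr_bracket p (Suc q)"
          and bq: "graded_bracket (- int p) (- int q + 1) = nr_bracket (Suc p) q"
          by (simp_all add: graded_bracket_def nat_add_distrib)
        have z: "nr_bracket m n (\<lambda>x. 0) b = (\<lambda>x. 0)" "nr_bracket m n a (\<lambda>x. 0) = (\<lambda>x. 0)" for m n
          using nr_bracket_zero[OF alt[OF a]] nr_bracket_zero[OF alt[OF b]] by blast+
        show ?thesis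
        \<comment> \<open>For \<open>p + q = 0\<close> every term vanishes, because
          \<open>graded_d\<close> is zero in degree 0.\<close>
        proof (cases "p + q > 0")
          case True
          show ?thesis
            unfolding p(1) q(1) graded_bracket_minus_int bp bq ksign_minus_int
            using koszul_d_nr_bracket[OF sec[OF p(2)] sec[OF q(2)] True] True
            by (auto simp: graded_d_def z fun_eq_iff[of "koszul_d _"])
        next
          case False
          then show ?thesis
            unfolding p(1) q(1) graded_bracket_minus_int bp bq ksign_minus_int
            by (simp add: graded_d_def z)
        qed
      qed
    qed
    show "graded_bracket i (k + l) a (graded_bracket k l b c)
      = (\<lambda>x. graded_bracket (i + k) l (graded_bracket i k a b) c x + ksign (i * k) *\<^sub>R
          graded_bracket k (i + l) b (graded_bracket i l a c) x)"
      if c: "c \<in> ?\<Gamma> l" for l c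
      using a
    proof (cases rule: cases_sec)
      case positive
      then show ?thesis using br0[OF b] br0[OF c] br0[OF br_closed[OF b c]] by simp
    next
      case (nonpositive p)
      note p = this
      show ?thesis using b
      proof (cases rule: cases_sec)
        case positive
        then show ?thesis using br0[OF a] br0[OF c] br0[OF br_closed[OF a c]] by simp
      next
        case (nonpositive q)
        note q = this
        show ?thesis using c
        proof (cases rule: cases_sec)
          case positive
          then show ?thesis using br0[OF a] br0[OF b] br0[OF br_closed[OF a b]] by simp
        next
          case (nonpositive r)
          have s: "- int m + - int n = - int (m + n)" for m n by simp
          show ?thesis
            unfolding p(1) q(1) nonpositive(1) s graded_bracket_minus_int ksign_minus_int
            by (rule ext, rule nr_bracket_jacobi[OF sec[OF p(2)] sec[OF q(2)] sec[OF nonpositive(2)]])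
        qed
      qed
    qed
  qed
qed

lemma universal_dg_lie_algebroid_K_graded:
  fixes W :: "'v::euclidean_space set"
  assumes W: "subspace W"
  shows "universal_dg_lie_algebroid (K_graded W) graded_d koszul_anchor graded_bracket
      (subspace_foliation W)"
proof -
  interpret dg_lie_algebroid "K_graded W" graded_d koszul_anchor graded_bracket
    by (rule dg_lie_algebroid_K_graded[OF W])
  note K0 = K_graded_minus_int[OF W, of 0, simplified] and K1 = K_graded_minus_int[OF W, of 1,
      simplified]
  show ?thesis
  proof
    show "singular_foliation (subspace_foliation W)"
      by (rule singular_foliation_subspace_foliation[OF W])
    show "koszul_anchor ` smooth_sections (K_graded W 0) = subspace_foliation W"
      using koszul_anchor_image[OF W] by (simp add: K0)
    show "{a \<in> smooth_sections (K_graded W 0). koszul_anchor a = (\<lambda>x. 0)}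
      = graded_d (- 1) ` smooth_sections (K_graded W (- 1))"
      using koszul_exact[OF W, of 0] koszul_anchor_eq_0_iff[OF K_section_section[OF W]]
      by (auto simp: K0 K1 graded_d_def numeral_2_eq_2)
    fix i :: int assume "i < 0"
    define k where "k = nat (- i) - 1"
    have k: "i = - int (Suc k)"
      using \<open>i < 0\<close> by (simp add: k_def)
    show "{a \<in> smooth_sections (K_graded W i). graded_d i a = (\<lambda>x. 0)} = graded_d (i - 1) `
        smooth_sections (K_graded W (i - 1))"
      using koszul_exact[OF W, of "Suc k"] K_graded_minus_int[OF W, of "Suc k"]
          K_graded_minus_int[OF W, of "Suc (Suc k)"]
      by (simp add: k graded_d_def)
  qed
qed

theorem proposition2p4:
  fixes W :: "'v::euclidean_space set"
  assumes "subspace W"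
  shows
    "(\<forall>j\<in>{2..DIM('v)}. \<forall>\<alpha>\<in>smooth_sections (K_forms W j). koszul_d \<alpha> \<in> smooth_sections (K_forms W (j
        - 1)))
   \<and> (\<forall>k\<in>{1..DIM('v)}. \<forall>l\<in>{1..DIM('v)}.
        \<forall>\<alpha>\<in>smooth_sections (K_forms W k). \<forall>\<beta>\<in>smooth_sections (K_forms W l).
          nr_bracket k l \<alpha> \<beta> \<in> smooth_sections (K_forms W (k + l - 1)))
   \<and> (koszul_anchor ` smooth_sections (K_forms W 1) = subspace_foliation W
     \<and> {\<alpha> \<in> smooth_sections (K_forms W 1). koszul_anchor \<alpha> = (\<lambda>x. 0)} =
         (if DIM('v) = 1 then {\<lambda>x. 0} else koszul_d ` smooth_sections (K_forms W 2))
     \<and> (\<forall>j\<in>{2..DIM('v)}. {\<alpha> \<in> smooth_sections (K_forms W j). koszul_d \<alpha> = (\<lambda>x. 0)} =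
         (if j = DIM('v) then {\<lambda>x. 0} else koszul_d ` smooth_sections (K_forms W (j + 1)))))
   \<and> universal_dg_lie_algebroid (K_graded W) graded_d koszul_anchor graded_bracket
       (subspace_foliation W)
   \<and> minimal_at (K_graded W) graded_d (0 :: 'v)"
proof (intro conjI ballI)
  note W = assms
  have exact: "{\<alpha> \<in> smooth_sections (K_forms W j). koszul_d \<alpha> = (\<lambda>x. 0)} =
      (if j = DIM('v) then {\<lambda>x. 0} else koszul_d ` smooth_sections (K_forms W (j + 1)))" if j: "j \<ge>
          1" for j
  proof -
    obtain i where i: "j = Suc i" using j by (cases j) auto
    \<comment> \<open>No non-zero forms exceed the dimension, so at the left end the general
      exactness statement becomes injectivity.\<close>
    have "koszul_d ` smooth_sections (K_forms W (j + 1)) = {\<lambda>x. 0}" if "j = DIM('v)"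
      using K_forms_above_dim[OF W, of "j + 1"] that
      by (simp add: smooth_sections_zero koszul_d_def fun_eq_iff)
    then show ?thesis using koszul_exact[OF W, of i] i by simp
  qed
  show "koszul_d \<alpha> \<in> smooth_sections (K_forms W (j - 1))"
    if "j \<in> {2..DIM('v)}" "\<alpha> \<in> smooth_sections (K_forms W j)" for j \<alpha>
    using K_section_koszul_d[OF W, of \<alpha> "j - 1"] that by simp
  show "nr_bracket k l \<alpha> \<beta> \<in> smooth_sections (K_forms W (k + l - 1))"
    if "k \<in> {1..DIM('v)}" "l \<in> {1..DIM('v)}" "\<alpha> \<in> smooth_sections (K_forms W k)" "\<beta> \<in>
        smooth_sections (K_forms W l)"
    for k l \<alpha> \<beta>
  proof -
    have "Suc (k - 1) = k" "Suc (l - 1) = l" "Suc (k - 1 + (l - 1)) = k + l - 1"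
      using that by auto
    then show ?thesis
      using K_section_nr_bracket[OF W, of \<alpha> "k - 1" \<beta> "l - 1"] that by simp
  qed
  show "koszul_anchor ` smooth_sections (K_forms W 1) = subspace_foliation W"
    by (rule koszul_anchor_image[OF W])
  show "{\<alpha> \<in> smooth_sections (K_forms W 1). koszul_anchor \<alpha> = (\<lambda>x. 0)} =
         (if DIM('v) = 1 then {\<lambda>x. 0} else koszul_d ` smooth_sections (K_forms W 2))"
  proof -
    have "{\<alpha> \<in> smooth_sections (K_forms W 1). koszul_anchor \<alpha> = (\<lambda>x. 0)} = {\<alpha> \<in> smooth_sections
        (K_forms W 1). koszul_d \<alpha> = (\<lambda>x. 0)}"
      using koszul_anchor_eq_0_iff[OF K_section_section[OF W]] by blast
    then show ?thesis using exact[of 1] by (simp add: numeral_2_eq_2)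
  qed
  show "{\<alpha> \<in> smooth_sections (K_forms W j). koszul_d \<alpha> = (\<lambda>x. 0)} =
      (if j = DIM('v) then {\<lambda>x. 0} else koszul_d ` smooth_sections (K_forms W (j + 1)))"
    if "j \<in> {2..DIM('v)}" for j
    by (rule exact) (use that in simp)
  show "universal_dg_lie_algebroid (K_graded W) graded_d koszul_anchor graded_bracket
      (subspace_foliation W)"
    by (rule universal_dg_lie_algebroid_K_graded[OF W])
  show "minimal_at (K_graded W) graded_d (0 :: 'v)"
    unfolding minimal_at_def
  proof (intro allI impI ballI)
    fix i :: int and a :: "'v \<Rightarrow> 'v list \<Rightarrow> 'v"
    assume "i < 0" and a: "a \<in> smooth_sections (K_graded W i)"
    have "a 0 \<in> alt_forms (nat (1 - i))"
      using a K_graded_subset[OF W] unfolding smooth_sections_iff[OF subspace_K_graded[OF W]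
          K_graded_subset[OF W]] by blast
    \<comment> \<open>The differential contracts with the Euler vector, which is 0 at the
      origin.\<close>
    from linear_0[OF contract_linear[OF this]]
    show "graded_d i a 0 = 0"
      using \<open>i < 0\<close> by (simp add: graded_d_def koszul_d_def)
  qed
qed

end
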